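(* Let $f\in L^2(\Omega)$. For every mesh $\mathcal{M}_h=(\mathcal{T}_h,\mathcal{F}_h)$ and every $k\ge 0$, the discrete problem: find $\underline{u}_h\in\underline{U}_{h,0}^k$ such that $$\left(1+a_h(\underline{u}_h,\underline{u}_h)\right)a_h(\underline{u}_h,\underline{v}_h)=(f,v_h)\qquad\forall\,\underline{v}_h\in\underline{U}_{h,0}^k$$ has a unique solution.
   Context: This is a (stabilized-coefficient) hybrid high-order discretization of $-(1+\|\nabla u\|^2)\Delta u=f(x)$ in $\Omega$, $u=0$ on $\partial\Omega$. **Domain and norms.** $\Omega\subset\mathbb{R}^d$, $d\in\{2,3\}$, is a bounded polytopal domain with Lipschitz boundary. $(\cdot,\cdot)_K$ and $\|\cdot\|_K$ are the $L^2(K)$ inner product and norm; the subscript is omitted for $K=\Omega$. **Meshes.** $\mathcal{H}\subset(0,\infty)$ is a countable set of meshsizes with $0$ as its unique accumulation point. For each $h\in\mathcal{H}$, $\mathcal{M}_h=(\mathcal{T}_h,\mathcal{F}_h)$ is a polytopal mesh of $\Omega$: $\mathcal{T}_h$ is a finite collection of nonempty disjoint open polytopes $T$ of diameter $h_T$, with $\overline\Omega=\bigcup_{T}\overline T$ and $h=\max_T h_T$; $\mathcal{F}_h$ is a finite collection of disjoint faces (nonempty, connected, relatively open subsets of hyperplanes) with $\bigcup_T\partial T=\bigcup_F\overline F$, each $F$ being either an internal face ($F\subset\partial T_1\cap\partial T_2$ for distinct $T_1,T_2$) or a boundary face ($F\subset\partial T\cap\partial\Omega$). $\mathcal{F}_h^i$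 and $\mathcal{F}_h^b$ are the sets of internal and boundary faces, $\mathcal{F}_T=\{F\in\mathcal{F}_h: F\subset\partial T\}$, and $\boldsymbol{n}_{TF}$ is the unit normal on $F$ pointing out of $T$. The mesh sequence is regular: there is $\varrho>0$ such that for every $h\in\mathcal{H}$ all $T\in\mathcal{T}_h$ and all $F\in\mathcal{F}_h$ are connected by star-shaped sets with parameter $\varrho$, i.e. each such set $X$, of diameter $h_X$, is a union of at most $\varrho^{-1}$ open subsets (relatively open for faces), each star-shaped with respect to every point of a ball of radius $\varrho h_X$, and any two of these subsets are linked by a chain of them in which consecutive members have an intersection containing a ball of radius $\varrho h_X$. **HHO space.** $\mathbb{P}_d^l(T)$ and $\mathbb{P}_{d-1}^l(F)$ are the polynomials of degree at most $l$ on $T$ and $F$; $\pi_T^k$, $\pi_F^k$ are the $L^2$-orthogonal projectors onto $\mathbb{P}_d^k(T)$, $\mathbb{P}_{d-1}^k(F)$. $\underline{U}_T^k=\mathbb{P}_d^k(T)\times\prod_{F\in\mathcal{F}_T}\mathbb{P}_{d-1}^k(F)$, $\underline{U}_h^k=\prod_{T\in\mathcal{T}_h}\mathbb{P}_d^k(T)\times\prod_{F\in\mathcal{F}_h}\mathbb{P}_{d-1}^k(F)$, and $\underline{U}_{h,0}^k$ is the subspace of $\underline{v}_h=((v_T)_T,(v_F)_F)\in\underline{U}_h^k$ with $v_F=0$ for all $F\in\mathcal{F}_h^b$. For $\underline{v}_h\in\underline{U}_h^k$, $\underline{v}_T=(v_T,(v_F)_{F\in\mathcal{F}_T})$ is its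 restriction to $T$, and $v_h$ (not underlined) is the piecewise polynomial with $v_h|_T=v_T$. **Reconstruction.** $R_T^{k+1}:\underline{U}_T^k\to\mathbb{P}_d^{k+1}(T)$ is defined by $(\nabla R_T^{k+1}\underline{v}_T,\nabla w)_T=(\nabla v_T,\nabla w)_T+\sum_{F\in\mathcal{F}_T}(v_F-v_T,\nabla w\cdot\boldsymbol{n}_{TF})_F$ for all $w\in\mathbb{P}_d^{k+1}(T)$, and $(R_T^{k+1}\underline{v}_T,1)_T=(v_T,1)_T$. **Bilinear form.** $a_h(\underline{u}_h,\underline{v}_h)=\sum_{T\in\mathcal{T}_h}\big[(\nabla R_T^{k+1}\underline{u}_T,\nabla R_T^{k+1}\underline{v}_T)_T+s_T(\underline{u}_T,\underline{v}_T)\big]$ with $s_T(\underline{u}_T,\underline{v}_T)=\frac1{h_T}\sum_{F\in\mathcal{F}_T}(\delta_{TF}\underline{u}_T,\delta_{TF}\underline{v}_T)_F$, where $\delta_{TF}\underline{v}_T=\pi_F^k\big(v_F-v_T-(R_T^{k+1}\underline{v}_T-\pi_T^kR_T^{k+1}\underline{v}_T)\big)$. *)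

theory Defs
  imports "HOL-Analysis.Analysis"
begin

section \<open>Polytopal domains and regular mesh sequences\<close>

text \<open>Polytopes in the sense of the finite element literature: open and not necessarily convex.
  Here \<^const>\<open>polytope\<close> is the library's notion, the convex hull of a finite set.\<close>

definition polytopal_set :: "'a::euclidean_space set \<Rightarrow> bool" where
  "polytopal_set X \<longleftrightarrow> (\<exists>\<P>. finite \<P> \<and> (\<forall>P\<in>\<P>. polytope P) \<and> X = interior (\<Union>\<P>))"

text \<open>Near each boundary point, the set is the strict subgraph, in some direction \<open>e\<close>, of a
  Lipschitz function on the hyperplane through the origin orthogonal to \<open>e\<close>.\<close>

definition lipschitz_boundary :: "'a::euclidean_space set \<Rightarrow> bool" where
  "lipschitz_boundary X \<longleftrightarrow>
     (\<forall>z\<in>frontier X. \<exists>e r L \<phi>. norm e = 1 \<and> 0 < r \<and> L-lipschitz_on {y. y \<bullet> e = 0} \<phi> \<and>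
        X \<inter> ball z r = {y \<in> ball z r. y \<bullet> e < \<phi> (y - (y \<bullet> e) *\<^sub>R e)})"

definition polytopal_domain :: "'a::euclidean_space set \<Rightarrow> bool" where
  "polytopal_domain \<Omega> \<longleftrightarrow>
     \<Omega> \<noteq> {} \<and> open \<Omega> \<and> connected \<Omega> \<and> bounded \<Omega> \<and> polytopal_set \<Omega> \<and> lipschitz_boundary \<Omega>"

definition internal_faces :: "'a::euclidean_space set set \<Rightarrow> 'a set set \<Rightarrow> 'a set set" where
  "internal_faces \<T> \<F> =
     {F \<in> \<F>. \<exists>T\<^sub>1\<in>\<T>. \<exists>T\<^sub>2\<in>\<T>. T\<^sub>1 \<noteq> T\<^sub>2 \<and> F \<subseteq> frontier T\<^sub>1 \<inter> frontier T\<^sub>2}"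

definition boundary_faces ::
    "'a::euclidean_space set \<Rightarrow> 'a set set \<Rightarrow> 'a set set \<Rightarrow> 'a set set" where
  "boundary_faces \<Omega> \<T> \<F> = {F \<in> \<F>. \<exists>T\<in>\<T>. F \<subseteq> frontier T \<inter> frontier \<Omega>}"

definition cell_faces :: "'a::euclidean_space set set \<Rightarrow> 'a set \<Rightarrow> 'a set set" where
  "cell_faces \<F> T = {F \<in> \<F>. F \<subseteq> frontier T}"

definition polytopal_mesh ::
    "'a::euclidean_space set \<Rightarrow> 'a set set \<Rightarrow> 'a set set \<Rightarrow> real \<Rightarrow> bool" where
  "polytopal_mesh \<Omega> \<T> \<F> h \<longleftrightarrow>
     finite \<T> \<and> disjoint \<T> \<and> (\<forall>T\<in>\<T>. T \<noteq> {} \<and> open T \<and> polytopal_set T) \<and>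
     closure \<Omega> = (\<Union>T\<in>\<T>. closure T) \<and> h = Max (diameter ` \<T>) \<and>
     finite \<F> \<and> disjoint \<F> \<and>
     (\<forall>F\<in>\<F>. F \<noteq> {} \<and> connected F \<and>
        (\<exists>a b. a \<noteq> 0 \<and> openin (top_of_set {x. a \<bullet> x = b}) F)) \<and>
     (\<Union>T\<in>\<T>. frontier T) = (\<Union>F\<in>\<F>. closure F) \<and>
     \<F> = internal_faces \<T> \<F> \<union> boundary_faces \<Omega> \<T> \<F>"

definition star_shaped_wrt :: "'a::euclidean_space set \<Rightarrow> 'a \<Rightarrow> bool" where
  "star_shaped_wrt S x \<longleftrightarrow> x \<in> S \<and> (\<forall>y\<in>S. closed_segment x y \<subseteq> S)"

text \<open>Openness and balls are relative to the affine hull: this is the whole space for a mesh cell,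
  and the hyperplane of the face for a mesh face.\<close>

definition hull_balls :: "'a::euclidean_space set \<Rightarrow> real \<Rightarrow> 'a set set" where
  "hull_balls X r = {ball x r \<inter> affine hull X | x. x \<in> affine hull X}"

definition connected_by_star_shaped :: "real \<Rightarrow> 'a::euclidean_space set \<Rightarrow> bool" where
  "connected_by_star_shaped \<rho> X \<longleftrightarrow>
     (\<exists>\<S>. finite \<S> \<and> real (card \<S>) \<le> 1 / \<rho> \<and> X = \<Union>\<S> \<and>
        (\<forall>S\<in>\<S>. openin (top_of_set (affine hull X)) S \<and>
           (\<exists>B\<in>hull_balls X (\<rho> * diameter X). \<forall>x\<in>B. star_shaped_wrt S x)) \<and>
        (\<forall>S\<in>\<S>. \<forall>S'\<in>\<S>.
           (S, S') \<in> {(A, A'). A \<in> \<S> \<and> A' \<in> \<S> \<and>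
                        (\<exists>B\<in>hull_balls X (\<rho> * diameter X). B \<subseteq> A \<inter> A')}\<^sup>*))"

definition regular_mesh_sequence :: "'a::euclidean_space set \<Rightarrow> real set \<Rightarrow>
    (real \<Rightarrow> 'a set set) \<Rightarrow> (real \<Rightarrow> 'a set set) \<Rightarrow> bool" where
  "regular_mesh_sequence \<Omega> H \<T> \<F> \<longleftrightarrow>
     H \<subseteq> {0<..} \<and> countable H \<and> (\<forall>x. x islimpt H \<longleftrightarrow> x = 0) \<and>
     (\<forall>h\<in>H. polytopal_mesh \<Omega> (\<T> h) (\<F> h) h) \<and>
     (\<exists>\<rho>>0. \<forall>h\<in>H. \<forall>X \<in> \<T> h \<union> \<F> h. connected_by_star_shaped \<rho> X)"

section \<open>Surface measure, inner products, gradients and normals\<close>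

text \<open>Lebesgue measure of the affine hull of \<open>X\<close>, transported along \<open>y \<mapsto> p + (\<Sum>b\<in>B. y b *\<^sub>R b)\<close>
  for an orthonormal basis \<open>B\<close> of the direction space, just as \<^const>\<open>lborel\<close> itself is defined from
  \<^const>\<open>Basis\<close>; it does not depend on the choices of \<open>p\<close> and \<open>B\<close>.  For a face this is the
  \<open>(d-1)\<close>-dimensional surface measure.\<close>

definition hull_lborel :: "'a::euclidean_space set \<Rightarrow> 'a measure" where
  "hull_lborel X =
     (let p = (SOME p. p \<in> X);
          B = (SOME B. pairwise orthogonal B \<and> (\<forall>b\<in>B. norm b = 1) \<and>
                       span B = span {x - y | x y. x \<in> X \<and> y \<in> X})
      in distr (\<Pi>\<^sub>M b\<in>B. lborel) borel (\<lambda>y. p + (\<Sum>b\<in>B. y b *\<^sub>R b)))"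

definition cell_inner ::
    "'a::euclidean_space set \<Rightarrow> ('a \<Rightarrow> 'b::euclidean_space) \<Rightarrow> ('a \<Rightarrow> 'b) \<Rightarrow> real" where
  "cell_inner K u v = (LINT x:K|lebesgue. u x \<bullet> v x)"

definition face_inner ::
    "'a::euclidean_space set \<Rightarrow> ('a \<Rightarrow> real) \<Rightarrow> ('a \<Rightarrow> real) \<Rightarrow> real" where
  "face_inner F u v = (LINT x:F|hull_lborel F. u x * v x)"

definition gradient :: "('a::euclidean_space \<Rightarrow> real) \<Rightarrow> 'a \<Rightarrow> 'a" where
  "gradient u x = (THE D. GDERIV u x :> D)"

text \<open>The unit normal pointing out of \<open>T\<close>, at a boundary point near which \<open>T\<close> is a half-space.
  For a face \<open>F \<subseteq> frontier T\<close> of a polytope \<open>T\<close> this covers all of \<open>F\<close> up to a set of surface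
  measure zero; the normal is then orthogonal to \<open>F\<close>, and it is constant along \<open>F\<close> (up to that
  set) whenever \<open>T\<close> stays on one side of \<open>F\<close>.\<close>

definition outward_normal :: "'a::euclidean_space set \<Rightarrow> 'a \<Rightarrow> 'a" where
  "outward_normal T x =
     (THE n. norm n = 1 \<and> (\<exists>r>0. T \<inter> ball x r = {y \<in> ball x r. (y - x) \<bullet> n < 0}))"

section \<open>Hybrid high-order spaces\<close>

text \<open>Real polynomial functions of total degree at most \<open>l\<close>.\<close>

definition multi_indices :: "nat \<Rightarrow> ('a::euclidean_space \<Rightarrow> nat) set" where
  "multi_indices l = {\<alpha> \<in> Basis \<rightarrow>\<^sub>E UNIV. (\<Sum>b\<in>Basis. \<alpha> b) \<le> l}"

definition poly_space :: "nat \<Rightarrow> ('a::euclidean_space \<Rightarrow> real) set" where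
  "poly_space l =
     {p. \<exists>c. p = (\<lambda>x. \<Sum>\<alpha>\<in>multi_indices l. c \<alpha> * (\<Prod>b\<in>Basis. (x \<bullet> b) ^ \<alpha> b))}"

text \<open>A polynomial on a cell is identified with its unique extension to the whole space (a cell is
  nonempty and open), so that \<^const>\<open>poly_space\<close> also serves as the space of polynomials on a cell
  and traces on faces make sense.  A polynomial on a face does not have a unique
  extension; it is represented by its values on the face only (and is \<^const>\<open>undefined\<close> elsewhere).
  Restricting \<open>d\<close>-variate polynomials to a face gives exactly the polynomials of the same degree in
  \<open>d - 1\<close> affine coordinates of its hyperplane.\<close>

definition face_poly_space :: "nat \<Rightarrow> 'a::euclidean_space set \<Rightarrow> ('a \<Rightarrow> real) set" where
  "face_poly_space l F = (\<lambda>p. restrict p F) ` poly_space l"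

definition cell_proj :: "nat \<Rightarrow> 'a::euclidean_space set \<Rightarrow> ('a \<Rightarrow> real) \<Rightarrow> 'a \<Rightarrow> real" where
  "cell_proj k T u =
     (THE p. p \<in> poly_space k \<and> (\<forall>w\<in>poly_space k. cell_inner T p w = cell_inner T u w))"

definition face_proj :: "nat \<Rightarrow> 'a::euclidean_space set \<Rightarrow> ('a \<Rightarrow> real) \<Rightarrow> 'a \<Rightarrow> real" where
  "face_proj k F u =
     (THE p. p \<in> face_poly_space k F \<and>
        (\<forall>w\<in>face_poly_space k F. face_inner F p w = face_inner F u w))"

type_synonym 'a local_dofs = "('a \<Rightarrow> real) \<times> ('a set \<Rightarrow> 'a \<Rightarrow> real)"
type_synonym 'a global_dofs = "('a set \<Rightarrow> 'a \<Rightarrow> real) \<times> ('a set \<Rightarrow> 'a \<Rightarrow> real)"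

definition hho_space ::
    "nat \<Rightarrow> 'a::euclidean_space set set \<Rightarrow> 'a set set \<Rightarrow> 'a global_dofs set" where
  "hho_space k \<T> \<F> = (\<Pi>\<^sub>E T\<in>\<T>. poly_space k) \<times> (\<Pi>\<^sub>E F\<in>\<F>. face_poly_space k F)"

definition hho_space0 ::
    "nat \<Rightarrow> 'a::euclidean_space set \<Rightarrow> 'a set set \<Rightarrow> 'a set set \<Rightarrow> 'a global_dofs set" where
  "hho_space0 k \<Omega> \<T> \<F> =
     {v \<in> hho_space k \<T> \<F>. \<forall>F\<in>boundary_faces \<Omega> \<T> \<F>. \<forall>x\<in>F. snd v F x = 0}"

definition local_restriction ::
    "'a::euclidean_space set set \<Rightarrow> 'a set \<Rightarrow> 'a global_dofs \<Rightarrow> 'a local_dofs" where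
  "local_restriction \<F> T v = (fst v T, restrict (snd v) (cell_faces \<F> T))"

text \<open>The piecewise polynomial \<open>v\<^sub>h\<close>; it is set to zero on the mesh skeleton, a null set.\<close>

definition broken_poly :: "'a::euclidean_space set set \<Rightarrow> 'a global_dofs \<Rightarrow> 'a \<Rightarrow> real" where
  "broken_poly \<T> v x = (\<Sum>T\<in>\<T>. indicat_real T x * fst v T x)"

section \<open>Reconstruction and bilinear form\<close>

text \<open>\<open>reconstruction l \<F> T\<close> is the operator \<open>R\<close> with values in the polynomials of degree at most
  \<open>l\<close>; it is used with \<open>l = k + 1\<close>.\<close>

definition reconstruction ::
    "nat \<Rightarrow> 'a::euclidean_space set set \<Rightarrow> 'a set \<Rightarrow> 'a local_dofs \<Rightarrow> 'a \<Rightarrow> real" where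
  "reconstruction l \<F> T v =
     (THE r. r \<in> poly_space l \<and>
        (\<forall>w\<in>poly_space l.
           cell_inner T (gradient r) (gradient w) =
             cell_inner T (gradient (fst v)) (gradient w) +
             (\<Sum>F\<in>cell_faces \<F> T.
                face_inner F (\<lambda>x. snd v F x - fst v x) (\<lambda>x. gradient w x \<bullet> outward_normal T x))) \<and>
        cell_inner T r (\<lambda>x. 1) = cell_inner T (fst v) (\<lambda>x. 1))"

definition face_diff :: "nat \<Rightarrow> 'a::euclidean_space set set \<Rightarrow> 'a set \<Rightarrow> 'a set \<Rightarrow>
    'a local_dofs \<Rightarrow> 'a \<Rightarrow> real" where
  "face_diff k \<F> T F v =
     (let r = reconstruction (k + 1) \<F> T v
      in face_proj k F (\<lambda>x. snd v F x - fst v x - (r x - cell_proj k T r x)))"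

definition stabilization :: "nat \<Rightarrow> 'a::euclidean_space set set \<Rightarrow> 'a set \<Rightarrow>
    'a local_dofs \<Rightarrow> 'a local_dofs \<Rightarrow> real" where
  "stabilization k \<F> T u v =
     1 / diameter T *
       (\<Sum>F\<in>cell_faces \<F> T. face_inner F (face_diff k \<F> T F u) (face_diff k \<F> T F v))"

definition hho_form :: "nat \<Rightarrow> 'a::euclidean_space set set \<Rightarrow> 'a set set \<Rightarrow>
    'a global_dofs \<Rightarrow> 'a global_dofs \<Rightarrow> real" where
  "hho_form k \<T> \<F> u v =
     (\<Sum>T\<in>\<T>. let u\<^sub>T = local_restriction \<F> T u; v\<^sub>T = local_restriction \<F> T v in
        cell_inner T (gradient (reconstruction (k + 1) \<F> T u\<^sub>T))
                     (gradient (reconstruction (k + 1) \<F> T v\<^sub>T)) +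
        stabilization k \<F> T u\<^sub>T v\<^sub>T)"

end

theory Submission
  imports Defs
begin

text \<open>On the finite-dimensional space of discrete unknowns, \<open>a\<^sub>h\<close> is a symmetric positive definite
  bilinear form, so the load \<open>v \<mapsto> (f, v\<^sub>h)\<close> has a Riesz representative \<open>z\<close>.  A solution satisfies
  \<open>(1 + a\<^sub>h(u, u)) u = z\<close>, hence is \<open>u = t z\<close> with \<open>t (1 + t\<^sup>2 a\<^sub>h(z, z)) = 1\<close>, and this cubic
  has exactly one real root.  Definiteness: \<open>a\<^sub>h(v, v) = 0\<close> forces \<open>v\<close> to be constant on every cell and
  equal to this constant on its faces; since \<open>v\<close> vanishes on boundary faces and every cell is linked
  to the boundary through faces, all these constants are zero.\<close>

section \<open>The abstract nonlocal problem\<close>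

text \<open>The projections, the reconstruction and the gradient are definite descriptions, so
  nothing can be said about the form before existence and uniqueness are known for each of them. The
  unknowns form sets of functions and of pairs of functions rather than a vector space type, so
  existence is reduced to coefficients: one finite-dimensional Riesz lemma serves the face
  projection, the cell projection, the reconstruction and the load. A polynomial on a face can have
  many coefficient vectors, because different polynomials on the space agree on a hyperplane. The
  form pulled back to coefficients is therefore only semidefinite, and the Riesz lemma asks instead
  that the load vanish wherever the form does.

  Definiteness has a geometric obstacle: a face is only an open piece of a hyperplane inside the
  frontier of some cells, cells may be nonconvex, and no chain of adjacent cells is given
  beforehand. Adjacency has to be read off from the position of the cells near a well-chosen point,
  with open sets, null sets and finitely many hyperplanes as the only means.\<close>

lemma psd_form_kernel:
  fixes B :: "('i \<Rightarrow> real) \<Rightarrow> ('i \<Rightarrow> real) \<Rightarrow> real"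
  assumes lin: "\<And>c d e t. B (\<lambda>i. c i + t * d i) e = B c e + t * B d e"
    and sym: "\<And>c d. B c d = B d c"
    and nonneg: "\<And>c. B c c \<ge> 0"
    and "B c c = 0"
  shows "B e c = 0"
proof (rule ccontr)
  assume ne: "B e c \<noteq> 0"
  \<comment> \<open>As \<open>B c c = 0\<close>, the quadratic in \<open>t\<close> below degenerates
    to the affine function \<open>B e e + 2 * t * B e c\<close>; this \<open>t\<close> gives it the
    value -1.\<close>
  define t where "t = - (B e e + 1) / (2 * B e c)"
  have "B (\<lambda>i. e i + t * c i) (\<lambda>i. e i + t * c i) = B e e + 2 * t * B e c"
    using \<open>B c c = 0\<close> sym[of c e]
    by (simp add: lin sym[of e "\<lambda>i. e i + t * c i"] sym[of c "\<lambda>i. e i + t * c i"])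
  also have "\<dots> = -1"
    using ne by (simp add: t_def field_simps)
  finally show False
    using nonneg[of "\<lambda>i. e i + t * c i"] by simp
qed

text \<open>Gram-Schmidt for a semidefinite form, by induction on \<open>S\<close>: the new unit
  vector is made orthogonal to the old ones, and the load then fixes its coefficient. The last
  hypothesis is the solvability condition for a degenerate direction. \<open>L\<close> is
  generalized because the induction hypothesis is used for two loads.\<close>

lemma riesz_coefficients:
  fixes B :: "('i \<Rightarrow> real) \<Rightarrow> ('i \<Rightarrow> real) \<Rightarrow> real" and L :: "('i \<Rightarrow> real) \<Rightarrow> real"
  assumes "finite S"
    and lin: "\<And>c d e t. B (\<lambda>i. c i + t * d i) e = B c e + t * B d e"
    and sym: "\<And>c d. B c d = B d c"
    and nonneg: "\<And>c. B c c \<ge> 0"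
    and "\<And>c d t. L (\<lambda>i. c i + t * d i) = L c + t * L d"
    and "\<And>c. B c c = 0 \<Longrightarrow> L c = 0"
  shows "\<exists>c. (\<forall>i. i \<notin> S \<longrightarrow> c i = 0) \<and> (\<forall>d. (\<forall>i. i \<notin> S \<longrightarrow> d i = 0) \<longrightarrow> B c d = L d)"
  using \<open>finite S\<close> assms(5,6)
proof (induction S arbitrary: L rule: finite_induct)
  case empty
  \<comment> \<open>Linearity is only given for combinations \<open>c + t d\<close>; with
    \<open>0 = 0 + (-1) 0\<close> it yields the value at zero.\<close>
  have "B (\<lambda>i. 0) (\<lambda>i. 0) = B (\<lambda>i. 0) (\<lambda>i. 0) + (-1) * B (\<lambda>i. 0) (\<lambda>i. 0)"
    using lin[of "\<lambda>i. 0" "-1" "\<lambda>i. 0" "\<lambda>i. 0"] by simp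
  then have "B (\<lambda>i. 0) (\<lambda>i. 0) = 0" by simp
  moreover from this have "L (\<lambda>i. 0) = 0" by (rule empty)
  ultimately have "B (\<lambda>i. 0) d = L d" if "\<forall>i. d i = 0" for d :: "'i \<Rightarrow> real"
    using that by (metis ext)
  then show ?case by (intro exI[of _ "\<lambda>i. 0"]) simp
next
  case (insert s S)
  define e :: "'i \<Rightarrow> real" where "e i = (if i = s then 1 else 0)" for i
  have lin2: "B e (\<lambda>i. c i + t * d i) = B e c + t * B e d" for e c d t
    using lin[of c t d e] sym[of e c] sym[of e d] sym[of e "\<lambda>i. c i + t * d i"] by simp
  have "\<exists>w. (\<forall>i. i \<notin> S \<longrightarrow> w i = 0) \<and> (\<forall>d. (\<forall>i. i \<notin> S \<longrightarrow> d i = 0) \<longrightarrow> B w d = L d)"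
    by (rule insert.IH) (fact insert.prems)+
  then obtain w where w0: "\<forall>i. i \<notin> S \<longrightarrow> w i = 0"
    and w: "\<forall>d. (\<forall>i. i \<notin> S \<longrightarrow> d i = 0) \<longrightarrow> B w d = L d"
    by (elim exE conjE)
  have "\<exists>p. (\<forall>i. i \<notin> S \<longrightarrow> p i = 0) \<and> (\<forall>d. (\<forall>i. i \<notin> S \<longrightarrow> d i = 0) \<longrightarrow> B p d = B e d)"
    by (rule insert.IH) (fact lin2, rule psd_form_kernel[of B, OF lin sym nonneg])
  then obtain p where p0: "\<forall>i. i \<notin> S \<longrightarrow> p i = 0"
    and p: "\<forall>d. (\<forall>i. i \<notin> S \<longrightarrow> d i = 0) \<longrightarrow> B p d = B e d"
    by (elim exE conjE)
  define e' where "e' i = e i + (-1) * p i" for i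
  have e'_def': "e' = (\<lambda>i. e i + (-1) * p i)" by (auto simp: e'_def)
  have orth: "B e' d = 0" if "\<forall>i. i \<notin> S \<longrightarrow> d i = 0" for d
  proof -
    have "B p d = B e d" using p that by blast
    then show ?thesis unfolding e'_def' lin by simp
  qed
  \<comment> \<open>The coefficient of \<open>e'\<close> that testing with \<open>e'\<close>
    requires. If \<open>B e' e' = 0\<close>, both sides of \<open>kill\<close> vanish:
    \<open>B w e'\<close> by \<open>psd_form_kernel\<close> and \<open>L e'\<close> by the
    hypothesis on \<open>L\<close>.\<close>
  define \<tau> where "\<tau> = (L e' - B w e') / B e' e'"
  have kill: "B e' e' * \<tau> = L e' - B w e'"
  proof (cases "B e' e' = 0")
    case True
    then show ?thesis
      using insert.prems(2)[of e'] psd_form_kernel[of B, OF lin sym nonneg] by simp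
  qed (simp add: \<tau>_def)
  define c where "c i = w i + \<tau> * e' i" for i
  have c_def': "c = (\<lambda>i. w i + \<tau> * e' i)" by (auto simp: c_def)
  show ?case
  proof (intro exI[of _ c] conjI allI impI)
    fix i assume "i \<notin> insert s S"
    then show "c i = 0" by (auto simp: c_def e'_def e_def w0 p0)
  next
    fix d :: "'i \<Rightarrow> real"
    assume d: "\<forall>i. i \<notin> insert s S \<longrightarrow> d i = 0"
    \<comment> \<open>Since \<open>p s = 0\<close>, the entry of \<open>e'\<close> at
      \<open>s\<close> is 1, so subtracting \<open>d s\<close> times \<open>e'\<close> moves the
      support of \<open>d\<close> into \<open>S\<close>.\<close>
    define d' where "d' i = d i + (- d s) * e' i" for i
    have d': "\<forall>i. i \<notin> S \<longrightarrow> d' i = 0"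
      using d by (auto simp: d'_def e'_def e_def p0 \<open>s \<notin> S\<close>)
    have d_eq: "d = (\<lambda>i. d' i + d s * e' i)" by (auto simp: d'_def)
    have "B c d = B c d' + d s * B c e'" by (subst d_eq) (rule lin2)
    also have "B c d' = L d'"
    proof -
      have "B w d' = L d'" using w d' by blast
      then show ?thesis using orth[OF d'] by (simp add: c_def' lin)
    qed
    also have "B c e' = L e'" using kill by (simp add: c_def' lin algebra_simps)
    also have "L d' + d s * L e' = L d" by (subst (2) d_eq) (rule insert.prems(1)[symmetric])
    finally show "B c d = L d" .
  qed
qed

text \<open>The form in which the Riesz lemma is used: \<open>V\<close> is a mere set, parametrized
  by coefficients through \<open>\<Phi>\<close>, which need not be injective. Linearity is stated
  along \<open>\<Phi>\<close>, so that \<open>V\<close> needs no algebraic structure of its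
  own.\<close>

lemma riesz_param:
  fixes \<Phi> :: "('i \<Rightarrow> real) \<Rightarrow> 'b" and B :: "'b \<Rightarrow> 'b \<Rightarrow> real" and L :: "'b \<Rightarrow> real"
  assumes "finite S"
    and ran: "\<And>c. \<Phi> c \<in> V"
    and sur: "\<And>v. v \<in> V \<Longrightarrow> \<exists>c. (\<forall>i. i \<notin> S \<longrightarrow> c i = 0) \<and> \<Phi> c = v"
    and lin: "\<And>c d w t. w \<in> V \<Longrightarrow> B (\<Phi> (\<lambda>i. c i + t * d i)) w = B (\<Phi> c) w + t * B (\<Phi> d) w"
    and sym: "\<And>v w. v \<in> V \<Longrightarrow> w \<in> V \<Longrightarrow> B v w = B w v"
    and nonneg: "\<And>v. v \<in> V \<Longrightarrow> B v v \<ge> 0"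
    and L: "\<And>c d t. L (\<Phi> (\<lambda>i. c i + t * d i)) = L (\<Phi> c) + t * L (\<Phi> d)"
    and ker: "\<And>v. v \<in> V \<Longrightarrow> B v v = 0 \<Longrightarrow> L v = 0"
  shows "\<exists>v\<in>V. \<forall>w\<in>V. B v w = L w"
proof -
  have "\<exists>c. (\<forall>i. i \<notin> S \<longrightarrow> c i = 0) \<and>
          (\<forall>d. (\<forall>i. i \<notin> S \<longrightarrow> d i = 0) \<longrightarrow> B (\<Phi> c) (\<Phi> d) = L (\<Phi> d))"
    using ran by (intro riesz_coefficients \<open>finite S\<close> lin sym nonneg L ker) auto
  then show ?thesis using ran sur by metis
qed

text \<open>The left side is \<open>t + A * t ^ 3\<close>: strictly increasing as \<open>A\<close>
  is nonnegative, 0 at 0 and at least 1 at 1.\<close>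

lemma cubic_ex1:
  fixes A :: real
  assumes "A \<ge> 0"
  shows "\<exists>!t. t * (1 + t\<^sup>2 * A) = 1"
proof -
  define g where "g t = t + A * t ^ 3" for t :: real
  have g: "t * (1 + t\<^sup>2 * A) = g t" for t by (simp add: g_def algebra_simps power2_eq_square power3_eq_cube)
  have "\<exists>t. 0 \<le> t \<and> t \<le> 1 \<and> g t = 1"
    by (rule IVT') (use assms in \<open>auto simp: g_def intro!: continuous_intros\<close>)
  moreover have "s = t" if "g s = 1" "g t = 1" for s t
  proof -
    have mono: "g x < g y" if "x < y" for x y
      using that assms mult_left_mono[OF power_mono_odd[of 3 x y], of A]
      by (auto simp: g_def)
    show ?thesis
      using that mono[of s t] mono[of t s] by (cases s t rule: linorder_cases) auto
  qed
  ultimately show ?thesis unfolding g by blast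
qed

text \<open>Vector space operations are abstracted: \<open>comb u t v\<close> stands for u + t v and
  \<open>z0\<close> for zero. Accordingly, \<open>definite\<close> is phrased as the step from u + t
  v = 0 to u = - t v.\<close>

lemma nonlocal_problem_ex1:
  fixes V :: "'b set" and a :: "'b \<Rightarrow> 'b \<Rightarrow> real" and comb :: "'b \<Rightarrow> real \<Rightarrow> 'b \<Rightarrow> 'b"
  assumes closed: "\<And>u v t. u \<in> V \<Longrightarrow> v \<in> V \<Longrightarrow> comb u t v \<in> V"
    and lin: "\<And>u v w t. u \<in> V \<Longrightarrow> v \<in> V \<Longrightarrow> w \<in> V \<Longrightarrow> a (comb u t v) w = a u w + t * a v w"
    and sym: "\<And>u v. a u v = a v u"
    and nonneg: "\<And>u. u \<in> V \<Longrightarrow> a u u \<ge> 0"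
    and zero: "z0 \<in> V" "\<And>v. v \<in> V \<Longrightarrow> a z0 v = 0"
    and definite: "\<And>u v t. u \<in> V \<Longrightarrow> v \<in> V \<Longrightarrow> a (comb u t v) (comb u t v) = 0 \<Longrightarrow> u = comb z0 (- t) v"
    and riesz: "\<exists>z\<in>V. \<forall>v\<in>V. a z v = L v"
  shows "\<exists>!u. u \<in> V \<and> (\<forall>v\<in>V. (1 + a u u) * a u v = L v)"
proof -
  obtain z where z: "z \<in> V" "\<And>v. v \<in> V \<Longrightarrow> a z v = L v" using riesz by blast
  have scaled: "a (comb z0 s z) v = s * a z v" if "v \<in> V" for s v
    using lin[OF zero(1) z(1) that] zero(2)[OF that] by simp
  have self: "a (comb z0 s z) (comb z0 s z) = s\<^sup>2 * a z z" for s
    using scaled[OF closed[OF zero(1) z(1)], of s s] scaled[OF z(1), of s] sym[of z "comb z0 s z"]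
    by (simp add: power2_eq_square)
  obtain t where t: "t * (1 + t\<^sup>2 * a z z) = 1"
      and t_uniq: "\<And>s. s * (1 + s\<^sup>2 * a z z) = 1 \<Longrightarrow> s = t"
    using cubic_ex1[OF nonneg[OF z(1)]] by metis
  show ?thesis
  proof (rule ex1I[of _ "comb z0 t z"], intro conjI ballI)
    show "comb z0 t z \<in> V" by (rule closed[OF zero(1) z(1)])
    fix v assume v: "v \<in> V"
    have "(1 + t\<^sup>2 * a z z) * (t * a z v) = (t * (1 + t\<^sup>2 * a z z)) * a z v" by simp
    then show "(1 + a (comb z0 t z) (comb z0 t z)) * a (comb z0 t z) v = L v"
      by (simp add: self scaled[OF v] t z(2)[OF v])
  next
    fix u assume u: "u \<in> V \<and> (\<forall>v\<in>V. (1 + a u u) * a u v = L v)"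
    then have uV: "u \<in> V" and eq: "\<And>v. v \<in> V \<Longrightarrow> (1 + a u u) * a u v = L v" by auto
    \<comment> \<open>The equation divided by the positive number \<open>1 + a u u\<close> says that
      \<open>u - s z\<close> is orthogonal to \<open>V\<close>, hence to itself. Then
      \<open>a u u = s\<^sup>2 * a z z\<close> turns the definition of \<open>s\<close> into the
      cubic equation.\<close>
    define s where "s = 1 / (1 + a u u)"
    have pos: "1 + a u u > 0" using nonneg[OF uV] by simp
    have dV: "comb u (- s) z \<in> V" by (rule closed[OF uV z(1)])
    have "a (comb u (- s) z) v = 0" if "v \<in> V" for v
      using eq[OF that] z(2)[OF that] pos lin[OF uV z(1) that, of "- s"]
      by (simp add: s_def field_simps)
    from definite[OF uV z(1) this[OF dV]] have u_eq: "u = comb z0 s z" by simp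
    have "a u u = s\<^sup>2 * a z z" using self[of s] u_eq by simp
    then have "s * (1 + s\<^sup>2 * a z z) = 1" using pos by (simp add: s_def)
    then show "u = comb z0 t z" using t_uniq u_eq by simp
  qed
qed

section \<open>Polynomials\<close>

text \<open>The expansion from \<open>poly_space_def\<close> as a function of its coefficients, to
  serve as the parametrization in \<open>riesz_param\<close>.\<close>

definition poly_comb ::
    "nat \<Rightarrow> (('a::euclidean_space \<Rightarrow> nat) \<Rightarrow> real) \<Rightarrow> 'a \<Rightarrow> real" where
  "poly_comb l c x = (\<Sum>\<alpha>\<in>multi_indices l. c \<alpha> * (\<Prod>b\<in>Basis. (x \<bullet> b) ^ \<alpha> b))"

lemma poly_space_eq_range: "poly_space l = range (poly_comb l)"
  unfolding poly_space_def poly_comb_def by (auto simp: fun_eq_iff image_iff)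

lemma poly_comb_lin: "poly_comb l (\<lambda>\<alpha>. c \<alpha> + t * d \<alpha>) x = poly_comb l c x + t * poly_comb l d x"
  by (simp add: poly_comb_def sum.distrib sum_distrib_left algebra_simps)

lemma poly_comb_cong: "(\<And>\<alpha>. \<alpha> \<in> multi_indices l \<Longrightarrow> c \<alpha> = d \<alpha>) \<Longrightarrow> poly_comb l c = poly_comb l d"
  by (auto simp: poly_comb_def fun_eq_iff intro!: sum.cong)

lemma finite_multi_indices: "finite (multi_indices l :: ('a::euclidean_space \<Rightarrow> nat) set)"
proof (rule finite_subset)
  show "multi_indices l \<subseteq> (Basis :: 'a set) \<rightarrow>\<^sub>E {..l}"
  proof
    fix \<alpha> :: "'a \<Rightarrow> nat" assume \<alpha>: "\<alpha> \<in> multi_indices l"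
    have "\<alpha> b \<le> l" if "b \<in> Basis" for b
      using member_le_sum[of b Basis \<alpha>] that \<alpha> by (auto simp: multi_indices_def)
    then show "\<alpha> \<in> Basis \<rightarrow>\<^sub>E {..l}" using \<alpha> by (auto simp: multi_indices_def PiE_iff)
  qed
  show "finite ((Basis :: 'a set) \<rightarrow>\<^sub>E {..l})" by (intro finite_PiE) auto
qed

lemma poly_space_coeffs:
  assumes "p \<in> poly_space l"
  obtains c where "\<And>\<alpha>. \<alpha> \<notin> multi_indices l \<Longrightarrow> c \<alpha> = 0" "p = poly_comb l c"
proof -
  obtain c where "p = poly_comb l c" using assms by (auto simp: poly_space_eq_range)
  then have "p = poly_comb l (\<lambda>\<alpha>. if \<alpha> \<in> multi_indices l then c \<alpha> else 0)"
    by (simp cong: poly_comb_cong)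
  then show thesis using that[of "\<lambda>\<alpha>. if \<alpha> \<in> multi_indices l then c \<alpha> else 0"] by auto
qed

lemma poly_space_lin:
  assumes "p \<in> poly_space l" "q \<in> poly_space l"
  shows "(\<lambda>x. p x + t * q x) \<in> poly_space l"
proof -
  obtain c d where "p = poly_comb l c" "q = poly_comb l d"
    using assms by (auto simp: poly_space_eq_range)
  then have "(\<lambda>x. p x + t * q x) = poly_comb l (\<lambda>\<alpha>. c \<alpha> + t * d \<alpha>)"
    by (simp add: fun_eq_iff poly_comb_lin)
  then show ?thesis by (auto simp: poly_space_eq_range)
qed

text \<open>It makes the cell unknown, of degree \<open>k\<close>, an admissible test function for
  the reconstruction of degree \<open>k + 1\<close>.\<close>

lemma poly_space_mono:
  assumes "k \<le> l"
  shows "poly_space k \<subseteq> (poly_space l :: ('a::euclidean_space \<Rightarrow> real) set)"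
proof
  fix p :: "'a \<Rightarrow> real" assume "p \<in> poly_space k"
  then obtain c where c: "\<And>\<alpha>. \<alpha> \<notin> multi_indices k \<Longrightarrow> c \<alpha> = 0" "p = poly_comb k c"
    by (rule poly_space_coeffs) blast
  have "poly_comb k c x = poly_comb l c x" for x
    unfolding poly_comb_def
    by (rule sum.mono_neutral_left[OF finite_multi_indices])
       (use assms c in \<open>auto simp: multi_indices_def\<close>)
  then show "p \<in> poly_space l" using c(2) by (auto simp: poly_space_eq_range fun_eq_iff)
qed

lemma poly_space_const: "(\<lambda>x. a) \<in> (poly_space l :: ('a::euclidean_space \<Rightarrow> real) set)"
proof -
  \<comment> \<open>The zero multi-index; it must be extensional on \<open>Basis\<close>, hence
    \<open>restrict\<close>.\<close>
  define \<zeta> :: "'a \<Rightarrow> nat" where "\<zeta> = restrict (\<lambda>b. 0) Basis"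
  have \<zeta>: "\<zeta> \<in> multi_indices l" by (auto simp: \<zeta>_def multi_indices_def)
  have "a = poly_comb l (\<lambda>\<alpha>. if \<alpha> = \<zeta> then a else 0) x" for x
    using \<zeta> by (simp add: poly_comb_def finite_multi_indices if_distrib[of "\<lambda>c. c * _"] \<zeta>_def
      cong: if_cong)
  then have "(\<lambda>x. a) = poly_comb l (\<lambda>\<alpha>. if \<alpha> = \<zeta> then a else 0)" by (rule ext)
  then show ?thesis unfolding poly_space_eq_range by blast
qed

lemma poly_space_imp_real_polynomial_function:
  assumes "p \<in> poly_space l" shows "real_polynomial_function p"
proof -
  obtain c where "p = poly_comb l c" using assms by (auto simp: poly_space_eq_range)
  then have "p = (\<lambda>x. \<Sum>\<alpha>\<in>multi_indices l. c \<alpha> * (\<Prod>b\<in>Basis. (x \<bullet> b) ^ \<alpha> b))"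
    by (auto simp: poly_comb_def)
  moreover have "real_polynomial_function (\<lambda>x. x \<bullet> b)" for b :: 'a
    by (intro real_polynomial_function.intros(1) bounded_linear_inner_left)
  ultimately show ?thesis
    by (simp add: finite_multi_indices real_polynomial_function_sum real_polynomial_function.intros real_polynomial_function_prod real_polynomial_function_power)
qed

lemma continuous_on_poly_space: "p \<in> poly_space l \<Longrightarrow> continuous_on A p"
  by (drule poly_space_imp_real_polynomial_function)
     (simp add: continuous_on_polymonial_function real_polynomial_function_eq)

section \<open>Gradients and the identity theorem for polynomials\<close>

lemma GDERIV_unique:
  assumes "GDERIV u x :> D" "GDERIV u x :> E"
  shows "D = E"
proof -
  have "(u has_derivative (\<lambda>h. h \<bullet> D)) (at x)" "(u has_derivative (\<lambda>h. h \<bullet> E)) (at x)"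
    using assms by (simp_all only: gderiv_def)
  then have eq: "(\<lambda>h. h \<bullet> D) = (\<lambda>h. h \<bullet> E)" by (rule has_derivative_unique)
  have "h \<bullet> D = h \<bullet> E" for h using eq by (rule fun_cong)
  then have "(D - E) \<bullet> (D - E) = 0" by (simp only: inner_diff_right diff_self)
  then show ?thesis by simp
qed

lemma gradient_eqI: "GDERIV u x :> D \<Longrightarrow> gradient u x = D"
  unfolding gradient_def by (rule the_equality) (assumption, rule GDERIV_unique)

text \<open>Structural induction with the sum and product rules. Continuity is carried along because
  it makes gradients bounded and measurable on cells and faces.\<close>

lemma real_polynomial_function_GDERIV:
  fixes p :: "'a::euclidean_space \<Rightarrow> real"
  assumes "real_polynomial_function p"
  shows "\<exists>g. continuous_on UNIV g \<and> (\<forall>x. GDERIV p x :> g x)"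
  using assms
proof (induction p rule: real_polynomial_function.induct)
  case (linear f)
  then have f: "linear f" by (rule bounded_linear.linear)
  \<comment> \<open>The vector that represents the linear functional \<open>f\<close>.\<close>
  define a where "a = (\<Sum>b\<in>Basis. f b *\<^sub>R b)"
  have "f h = h \<bullet> a" for h
  proof -
    have "f h = f (\<Sum>b\<in>Basis. (h \<bullet> b) *\<^sub>R b)" by (simp only: euclidean_representation)
    also have "\<dots> = h \<bullet> a" by (simp add: linear_sum[OF f] linear_scale[OF f] a_def inner_sum_right mult.commute)
    finally show ?thesis .
  qed
  then have "f = (\<lambda>h. h \<bullet> a)" by (rule ext)
  moreover have "GDERIV (\<lambda>h. h \<bullet> a) x :> a" for x
    unfolding gderiv_def by (intro bounded_linear_imp_has_derivative bounded_linear_inner_left)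
  ultimately show ?case by (intro exI[of _ "\<lambda>x. a"]) auto
next
  case (const c)
  show ?case by (intro exI[of _ "\<lambda>x. 0"]) (auto intro: GDERIV_const)
next
  case (add f g)
  then obtain f' g' where "continuous_on UNIV f'" "\<forall>x. GDERIV f x :> f' x"
      "continuous_on UNIV g'" "\<forall>x. GDERIV g x :> g' x" by blast
  then show ?case
    by (intro exI[of _ "\<lambda>x. f' x + g' x"]) (auto intro!: GDERIV_add continuous_intros)
next
  case (mult f g)
  then obtain f' g' where "continuous_on UNIV f'" "\<forall>x. GDERIV f x :> f' x"
      "continuous_on UNIV g'" "\<forall>x. GDERIV g x :> g' x" by blast
  moreover have "continuous_on UNIV f" "continuous_on UNIV g"
    using mult.hyps by (auto simp: continuous_on_polymonial_function real_polynomial_function_eq)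
  ultimately show ?case
    by (intro exI[of _ "\<lambda>x. f x *\<^sub>R g' x + g x *\<^sub>R f' x"])
       (auto intro!: GDERIV_mult continuous_intros)
qed

lemma
  assumes "p \<in> poly_space l"
  shows poly_space_GDERIV: "GDERIV p x :> gradient p x"
    and continuous_on_gradient: "continuous_on A (gradient p)"
proof -
  obtain g where g: "continuous_on UNIV g" "\<And>x. GDERIV p x :> g x"
    using real_polynomial_function_GDERIV poly_space_imp_real_polynomial_function assms by blast
  have "gradient p = g" using gradient_eqI[OF g(2)] by auto
  then show "GDERIV p x :> gradient p x" "continuous_on A (gradient p)"
    using g continuous_on_subset[OF g(1)] by auto
qed

lemma gradient_lin:
  assumes "p \<in> poly_space l" "q \<in> poly_space l"
  shows "gradient (\<lambda>x. p x + t * q x) x = gradient p x + t *\<^sub>R gradient q x"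
proof (rule gradient_eqI)
  have "GDERIV (\<lambda>x. t * q x) x :> t *\<^sub>R gradient q x + q x *\<^sub>R 0"
    by (rule GDERIV_mult[OF GDERIV_const poly_space_GDERIV[OF assms(2)]])
  from GDERIV_add[OF poly_space_GDERIV[OF assms(1)] this]
  show "GDERIV (\<lambda>x. p x + t * q x) x :> gradient p x + t *\<^sub>R gradient q x" by simp
qed

lemma gradient_const: "gradient (\<lambda>x. a) = (\<lambda>x. 0)"
  using gradient_eqI[OF GDERIV_const] by auto

text \<open>A nonzero polynomial in one variable has finitely many roots, an interval infinitely
  many points.\<close>

lemma real_polynomial_function_zero_real:
  fixes q :: "real \<Rightarrow> real"
  assumes "real_polynomial_function q" "e > 0" "\<And>t. \<bar>t\<bar> < e \<Longrightarrow> q t = 0"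
  shows "q t = 0"
proof -
  obtain a n where q: "q = (\<lambda>x. \<Sum>i\<le>n. a i * x ^ i)"
    using assms(1) by (auto simp: real_polynomial_function_iff_sum)
  have "{x. (\<Sum>i\<le>n. a i * x ^ i) = 0} \<supseteq> {-e<..<e}"
    using assms(3) q by (fastforce simp: abs_less_iff)
  moreover have "infinite {-e<..<e}" using \<open>e > 0\<close> by simp
  ultimately have "infinite {x. (\<Sum>i\<le>n. a i * x ^ i) = 0}" using infinite_super by blast
  then have "a i = 0" if "i \<le> n" for i
    using polyfun_finite_roots[where n = n and c = a] that by auto
  then show ?thesis by (simp add: q)
qed

text \<open>Reduction to one variable along the line from the center of a ball in \<open>T\<close>
  to \<open>y\<close>. This is what lets a polynomial on a cell be identified with a function on the
  whole space.\<close>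

lemma poly_space_zero_on_open:
  fixes p :: "'a::euclidean_space \<Rightarrow> real"
  assumes "p \<in> poly_space l" "open T" "T \<noteq> {}" "\<And>x. x \<in> T \<Longrightarrow> p x = 0"
  shows "p y = 0"
proof -
  obtain x r where x: "r > 0" "ball x r \<subseteq> T"
    using assms(2,3) by (meson ex_in_conv open_contains_ball)
  define m where "m t = x + t *\<^sub>R (y - x)" for t :: real
  have "polynomial_function m"
    unfolding m_def by (intro polynomial_function_add polynomial_function_const
      polynomial_function_mult polynomial_function_id)
  then have "real_polynomial_function (p \<circ> m)"
    by (rule real_polynomial_function_compose[OF _ poly_space_imp_real_polynomial_function[OF assms(1)]])
  \<comment> \<open>A parameter range in which the line stays in the ball; adding 1 covers the case
    \<open>y = x\<close>.\<close>
  moreover have "r / (norm (y - x) + 1) > 0" using x by (simp add: add_nonneg_pos)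
  moreover have "(p \<circ> m) t = 0" if "\<bar>t\<bar> < r / (norm (y - x) + 1)" for t
  proof -
    have "\<bar>t\<bar> * norm (y - x) \<le> \<bar>t\<bar> * (norm (y - x) + 1)" by (simp add: mult_left_mono)
    also have "\<dots> < r" using that by (simp add: pos_less_divide_eq add_nonneg_pos)
    finally have "norm (t *\<^sub>R (y - x)) < r" by simp
    then have "m t \<in> ball x r" by (simp add: m_def dist_norm)
    then show ?thesis using assms(4) x by auto
  qed
  ultimately have "(p \<circ> m) 1 = 0" by (rule real_polynomial_function_zero_real)
  then show ?thesis by (simp add: m_def)
qed

text \<open>\<open>T\<close> may be disconnected, so constancy is derived on a single ball and
  spread to the whole space by the identity theorem.\<close>

lemma poly_space_gradient_zero_on_open:
  fixes p :: "'a::euclidean_space \<Rightarrow> real"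
  assumes p: "p \<in> poly_space l" and "open T" "T \<noteq> {}" "\<And>x. x \<in> T \<Longrightarrow> gradient p x = 0"
  obtains c where "p = (\<lambda>x. c)"
proof -
  obtain x r where x: "r > 0" "ball x r \<subseteq> T"
    using assms(2,3) by (meson ex_in_conv open_contains_ball)
  have "(p has_derivative (\<lambda>h. 0)) (at y within ball x r)" if "y \<in> ball x r" for y
  proof -
    have "gradient p y = 0" using assms(4) that x by blast
    then show ?thesis
      using poly_space_GDERIV[OF p, of y] by (simp add: gderiv_def has_derivative_at_withinI)
  qed
  then obtain c where c: "\<And>y. y \<in> ball x r \<Longrightarrow> p y = c"
    using has_derivative_zero_constant[of "ball x r" p] by auto
  have q: "(\<lambda>y. p y + (-1) * c) \<in> poly_space l"
    by (rule poly_space_lin[OF p poly_space_const])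
  have zero: "p y + (-1) * c = 0" for y
    by (rule poly_space_zero_on_open[OF q open_ball, of x r]) (use x(1) c in auto)
  have "p = (\<lambda>x. c)"
  proof (rule ext)
    show "p y = c" for y using zero[of y] by linarith
  qed
  then show thesis by (rule that)
qed

section \<open>Integrals over cells and faces\<close>

text \<open>A class of integrands closed under combinations and inner products and integrable for
  every measure that is finite on \<open>K\<close>. It looks at values on \<open>K\<close> only,
  since face polynomials and normals have arbitrary values off the face.\<close>

definition bounded_borel_on ::
    "'a::euclidean_space set \<Rightarrow> ('a \<Rightarrow> 'b::euclidean_space) \<Rightarrow> bool" where
  "bounded_borel_on K u \<longleftrightarrow>
     (\<lambda>x. indicat_real K x *\<^sub>R u x) \<in> borel_measurable borel \<and> bounded (u ` K)"

lemma bounded_borel_onI: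
  assumes "(\<lambda>x. indicat_real K x *\<^sub>R u x) \<in> borel_measurable borel" "\<And>x. x \<in> K \<Longrightarrow> norm (u x) \<le> C"
  shows "bounded_borel_on K u"
  using assms unfolding bounded_borel_on_def bounded_iff by blast

lemma bounded_borel_onE:
  assumes "bounded_borel_on K u"
  obtains C where "(\<lambda>x. indicat_real K x *\<^sub>R u x) \<in> borel_measurable borel"
    "\<And>x. x \<in> K \<Longrightarrow> norm (u x) \<le> C" "C \<ge> 0"
proof -
  obtain C where C: "\<forall>x\<in>K. norm (u x) \<le> C"
    using assms unfolding bounded_borel_on_def bounded_iff by blast
  show thesis
  proof (rule that[of "\<bar>C\<bar>"])
    show "norm (u x) \<le> \<bar>C\<bar>" if "x \<in> K" for x using C that abs_ge_self order_trans by blast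
  qed (use assms in \<open>auto simp: bounded_borel_on_def\<close>)
qed

lemma bounded_borel_on_cong:
  assumes "\<And>x. x \<in> K \<Longrightarrow> u x = v x"
  shows "bounded_borel_on K u \<longleftrightarrow> bounded_borel_on K v"
proof -
  have "(\<lambda>x. indicat_real K x *\<^sub>R u x) = (\<lambda>x. indicat_real K x *\<^sub>R v x)"
    using assms by (intro ext) (metis indicator_simps(2) scaleR_zero_left)
  moreover have "u ` K = v ` K" using assms by (rule image_cong[OF refl])
  ultimately show ?thesis by (simp add: bounded_borel_on_def)
qed

lemma bounded_borel_on_continuous:
  assumes "continuous_on UNIV u" "bounded K" "K \<in> sets borel"
  shows "bounded_borel_on K u"
  unfolding bounded_borel_on_def
proof
  have [measurable]: "u \<in> borel_measurable borel" using assms(1) by (rule borel_measurable_continuous_onI)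
  have [measurable]: "indicat_real K \<in> borel_measurable borel" using assms(3) by simp
  show "(\<lambda>x. indicat_real K x *\<^sub>R u x) \<in> borel_measurable borel" by measurable
  have "compact (u ` closure K)"
    using assms by (intro compact_continuous_image) (auto intro: continuous_on_subset)
  then show "bounded (u ` K)"
    using bounded_subset[OF compact_imp_bounded] closure_subset by (metis image_mono)
qed

lemma bounded_borel_on_lin:
  assumes "bounded_borel_on K u" "bounded_borel_on K v"
  shows "bounded_borel_on K (\<lambda>x. u x + t *\<^sub>R v x)"
proof -
  obtain C where [measurable]: "(\<lambda>x. indicat_real K x *\<^sub>R u x) \<in> borel_measurable borel"
    and C: "\<And>x. x \<in> K \<Longrightarrow> norm (u x) \<le> C" using assms(1) by (rule bounded_borel_onE) blast
  obtain D where [measurable]: "(\<lambda>x. indicat_real K x *\<^sub>R v x) \<in> borel_measurable borel"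
    and D: "\<And>x. x \<in> K \<Longrightarrow> norm (v x) \<le> D" using assms(2) by (rule bounded_borel_onE) blast
  have "(\<lambda>x. indicat_real K x *\<^sub>R u x + t *\<^sub>R (indicat_real K x *\<^sub>R v x)) \<in> borel_measurable borel"
    by measurable
  moreover have "norm (u x + t *\<^sub>R v x) \<le> C + \<bar>t\<bar> * D" if "x \<in> K" for x
    by (rule norm_triangle_le) (use C[OF that] D[OF that] in \<open>auto intro!: add_mono mult_left_mono\<close>)
  ultimately show ?thesis by (intro bounded_borel_onI) (auto simp: algebra_simps)
qed

lemma bounded_borel_on_inner:
  assumes "bounded_borel_on K u" "bounded_borel_on K v"
  shows "bounded_borel_on K (\<lambda>x. u x \<bullet> v x)"
proof -
  obtain C where [measurable]: "(\<lambda>x. indicat_real K x *\<^sub>R u x) \<in> borel_measurable borel"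
    and C: "\<And>x. x \<in> K \<Longrightarrow> norm (u x) \<le> C" "C \<ge> 0" using assms(1) by (rule bounded_borel_onE) blast
  obtain D where [measurable]: "(\<lambda>x. indicat_real K x *\<^sub>R v x) \<in> borel_measurable borel"
    and D: "\<And>x. x \<in> K \<Longrightarrow> norm (v x) \<le> D" using assms(2) by (rule bounded_borel_onE) blast
  have "(\<lambda>x. (indicat_real K x *\<^sub>R u x) \<bullet> (indicat_real K x *\<^sub>R v x)) \<in> borel_measurable borel"
    by measurable
  moreover have "(\<lambda>x. (indicat_real K x *\<^sub>R u x) \<bullet> (indicat_real K x *\<^sub>R v x)) =
      (\<lambda>x. indicat_real K x *\<^sub>R (u x \<bullet> v x))"
    by (auto simp: indicator_def)
  moreover have "norm (u x \<bullet> v x) \<le> C * D" if "x \<in> K" for x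
  proof -
    have "norm (u x \<bullet> v x) \<le> norm (u x) * norm (v x)" by (simp add: Cauchy_Schwarz_ineq2)
    also have "\<dots> \<le> C * D" using C D that by (intro mult_mono) auto
    finally show ?thesis .
  qed
  ultimately show ?thesis by (intro bounded_borel_onI) auto
qed

text \<open>Stated for a measure \<open>M\<close> on a sigma-algebra that contains the Borel sets,
  to cover \<open>lebesgue\<close> and \<open>hull_lborel\<close> alike. A constant on a set of
  finite measure dominates the integrand.\<close>

lemma set_integrable_bounded_borel:
  fixes u :: "'a::euclidean_space \<Rightarrow> 'b::euclidean_space"
  assumes "bounded_borel_on K u" and sub: "sets borel \<subseteq> sets M" "space M = UNIV"
    and K: "K \<in> sets M" "emeasure M K < \<infinity>"
  shows "set_integrable M K u"
proof -
  obtain C where meas: "(\<lambda>x. indicat_real K x *\<^sub>R u x) \<in> borel_measurable borel"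
    and C: "\<And>x. x \<in> K \<Longrightarrow> norm (u x) \<le> C" "C \<ge> 0" using assms(1) by (rule bounded_borel_onE) blast
  have "(\<lambda>x. indicat_real K x *\<^sub>R u x) \<in> borel_measurable M"
    using meas sub by (auto simp: measurable_def)
  moreover have "integrable M (\<lambda>x. C * indicat_real K x)"
    using K by (intro integrable_mult_right integrable_real_indicator)
  moreover have "norm (indicat_real K x *\<^sub>R u x) \<le> norm (C * indicat_real K x)" for x
    using C by (cases "x \<in> K") auto
  ultimately show ?thesis
    unfolding set_integrable_def using Bochner_Integration.integrable_bound by blast
qed

text \<open>The premises of \<open>set_integrable_bounded_borel\<close> for \<open>lebesgue\<close>,
  in the order in which \<open>OF\<close> consumes them; \<open>hull_lborel_finite\<close> plays the
  same part for faces.\<close>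

lemma lebesgue_bounded_borel:
  assumes "bounded K" "K \<in> sets (borel :: 'a::euclidean_space measure)"
  shows "sets (borel :: 'a measure) \<subseteq> sets lebesgue" "space (lebesgue :: 'a measure) = UNIV"
    "K \<in> sets lebesgue" "emeasure lebesgue K < \<infinity>"
proof -
  show sub: "sets (borel :: 'a measure) \<subseteq> sets lebesgue"
    using sets_completionI_sets by (metis sets_lborel subsetI)
  then show "K \<in> sets lebesgue" using assms(2) by auto
  show "emeasure lebesgue K < \<infinity>"
    using emeasure_bounded_finite[OF assms(1)] assms(2) by simp
qed simp

section \<open>Elementary properties of the inner products\<close>

lemma cell_inner_commute: "cell_inner K u v = cell_inner K v u"
  by (simp add: cell_inner_def inner_commute)

lemma face_inner_commute: "face_inner F u v = face_inner F v u"
  by (simp add: face_inner_def mult.commute)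

lemma cell_inner_cong:
  assumes "\<And>x. x \<in> K \<Longrightarrow> u x = u' x" "\<And>x. x \<in> K \<Longrightarrow> v x = v' x"
  shows "cell_inner K u v = cell_inner K u' v'"
  unfolding cell_inner_def set_lebesgue_integral_def
proof (rule Bochner_Integration.integral_cong[OF refl])
  fix x
  show "indicat_real K x *\<^sub>R (u x \<bullet> v x) = indicat_real K x *\<^sub>R (u' x \<bullet> v' x)"
    using assms[of x] by (cases "x \<in> K") simp_all
qed

lemma face_inner_cong:
  assumes "\<And>x. x \<in> K \<Longrightarrow> u x = u' x" "\<And>x. x \<in> K \<Longrightarrow> v x = v' x"
  shows "face_inner K u v = face_inner K u' v'"
  unfolding face_inner_def set_lebesgue_integral_def
proof (rule Bochner_Integration.integral_cong[OF refl])
  fix x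
  show "indicat_real K x *\<^sub>R (u x * v x) = indicat_real K x *\<^sub>R (u' x * v' x)"
    using assms[of x] by (cases "x \<in> K") simp_all
qed

lemma cell_inner_nonneg: "cell_inner K u u \<ge> 0"
  unfolding cell_inner_def set_lebesgue_integral_def
  by (rule Bochner_Integration.integral_nonneg) (auto simp: indicator_def)

lemma face_inner_nonneg: "face_inner K u u \<ge> 0"
  unfolding face_inner_def set_lebesgue_integral_def
  by (rule Bochner_Integration.integral_nonneg) (auto simp: indicator_def)

lemma cell_inner_lin:
  assumes "bounded K" "K \<in> sets borel"
    and "bounded_borel_on K u" "bounded_borel_on K v" "bounded_borel_on K w"
  shows "cell_inner K (\<lambda>x. u x + t *\<^sub>R v x) w = cell_inner K u w + t * cell_inner K v w"
proof -
  note int = set_integrable_bounded_borel[OF bounded_borel_on_inner lebesgue_bounded_borel[OF assms(1,2)]]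
  have "(LINT x:K|lebesgue. u x \<bullet> w x + t * (v x \<bullet> w x)) =
      (LINT x:K|lebesgue. u x \<bullet> w x) + (LINT x:K|lebesgue. t * (v x \<bullet> w x))"
    by (intro set_integral_add int set_integrable_mult_right assms)
  then show ?thesis by (simp add: cell_inner_def inner_add_left)
qed

text \<open>The points of \<open>T\<close> with \<open>u x \<noteq> 0\<close> form an open set, by
  continuity, and a null set, because the integral of the square vanishes; so there are
  none.\<close>

lemma cell_inner_definite:
  assumes "open T" "bounded T" "continuous_on UNIV u" "cell_inner T u u = 0" "x \<in> T"
  shows "u x = 0"
proof (rule ccontr)
  assume ne: "u x \<noteq> 0"
  have T: "T \<in> sets borel" using assms(1) by simp
  have bb: "bounded_borel_on T u" by (rule bounded_borel_on_continuous[OF assms(3,2) T])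
  have "integrable lebesgue (\<lambda>x. indicat_real T x *\<^sub>R (u x \<bullet> u x))"
    using set_integrable_bounded_borel[OF bounded_borel_on_inner[OF bb bb]
        lebesgue_bounded_borel[OF assms(2) T]]
    by (simp add: set_integrable_def)
  then have "AE x in lebesgue. indicat_real T x *\<^sub>R (u x \<bullet> u x) = 0"
    using assms(4) unfolding cell_inner_def set_lebesgue_integral_def
    by (subst integral_nonneg_eq_0_iff_AE[symmetric]) auto
  define N where "N = {x \<in> T. u x \<noteq> 0}"
  have ae: "AE x in lebesgue. x \<notin> N"
    using \<open>AE x in lebesgue. indicat_real T x *\<^sub>R (u x \<bullet> u x) = 0\<close> unfolding N_def
    by eventually_elim (auto simp: indicator_def split: if_splits)
  have "open (T \<inter> (u -` (- {0})))"
    using assms(1,3) by (intro open_Int open_vimage) auto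
  then have "open N" by (simp add: N_def vimage_def Int_def)
  have "bounded N" using assms(2) unfolding N_def by (rule bounded_subset) blast
  then have "N \<in> sets lebesgue" using \<open>open N\<close> by (intro lebesgue_bounded_borel(3)) auto
  then have "negligible N" using ae by (simp only: AE_iff_null_sets[symmetric] negligible_iff_null_sets)
  moreover have "N \<noteq> {}" using ne assms(5) unfolding N_def by blast
  ultimately show False using open_not_negligible \<open>open N\<close> by blast
qed

section \<open>Flat faces and their surface measure\<close>

definition flat_face :: "'a::euclidean_space set \<Rightarrow> bool" where
  "flat_face F \<longleftrightarrow> F \<noteq> {} \<and> bounded F \<and> (\<exists>a b. a \<noteq> 0 \<and> openin (top_of_set {x. a \<bullet> x = b}) F)"

lemma flat_face_borel:
  assumes "flat_face F" shows "F \<in> sets borel"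
proof -
  obtain a b where "openin (top_of_set {x. a \<bullet> x = b}) F" using assms by (auto simp: flat_face_def)
  then obtain U where "open U" "F = {x. a \<bullet> x = b} \<inter> U" by (auto simp: openin_open)
  moreover have "closed {x. a \<bullet> x = b}" by (rule closed_hyperplane)
  ultimately show ?thesis by auto
qed

text \<open>Both choices in \<open>hull_lborel\<close> are resolved here once. \<open>B\<close> is
  finite because orthogonal nonzero vectors are independent.\<close>

lemma hull_lborel_chart:
  fixes F :: "'a::euclidean_space set"
  assumes "F \<noteq> {}"
  obtains p B where "p \<in> F" "finite B" "pairwise orthogonal B" "\<And>b. b \<in> B \<Longrightarrow> norm b = 1"
    "span B = span {x - y | x y. x \<in> F \<and> y \<in> F}"
    "hull_lborel F = distr (\<Pi>\<^sub>M b\<in>B. lborel) borel (\<lambda>y. p + (\<Sum>b\<in>B. y b *\<^sub>R b))"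
proof -
  define p where "p = (SOME p. p \<in> F)"
  define P where "P B \<longleftrightarrow> pairwise orthogonal B \<and> (\<forall>b\<in>B. norm b = 1) \<and>
      span B = span {x - y | x y. x \<in> F \<and> y \<in> F}" for B
  define B where "B = (SOME B. P B)"
  have "p \<in> F" using assms some_in_eq unfolding p_def by blast
  have "\<exists>B. P B"
    by (rule orthonormal_basis_subspace[OF subspace_span, of "{x - y | x y. x \<in> F \<and> y \<in> F}"])
       (auto simp: P_def)
  then have "P B" unfolding B_def by (rule someI_ex)
  then have "0 \<notin> B" unfolding P_def by (metis norm_zero zero_neq_one)
  then have "finite B"
    using \<open>P B\<close> pairwise_orthogonal_independent independent_imp_finite unfolding P_def by blast
  moreover have "hull_lborel F = distr (\<Pi>\<^sub>M b\<in>B. lborel) borel (\<lambda>y. p + (\<Sum>b\<in>B. y b *\<^sub>R b))"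
    by (simp add: hull_lborel_def p_def B_def P_def Let_def)
  ultimately show thesis using that \<open>P B\<close> \<open>p \<in> F\<close> unfolding P_def by blast
qed

lemma chart_measurable:
  "(\<lambda>y. p + (\<Sum>b\<in>B. y b *\<^sub>R b)) \<in> measurable (\<Pi>\<^sub>M b\<in>B. lborel) (borel :: 'a::euclidean_space measure)"
proof -
  have [measurable]: "(\<lambda>y. y b) \<in> borel_measurable (\<Pi>\<^sub>M b\<in>B. lborel)" if "b \<in> B" for b :: 'a
    using measurable_component_singleton[OF that, of "\<lambda>_. lborel"] by simp
  show ?thesis by (intro borel_measurable_add borel_measurable_sum borel_measurable_scaleR) auto
qed

lemma chart_coordinate:
  assumes "finite B" "pairwise orthogonal B" "\<And>b. b \<in> B \<Longrightarrow> norm b = 1" "b \<in> B"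
  shows "(\<Sum>b'\<in>B. y b' *\<^sub>R b') \<bullet> b = y b"
proof -
  have "(\<Sum>b'\<in>B. y b' *\<^sub>R b') \<bullet> b = (\<Sum>b'\<in>B. if b' = b then y b else 0)"
    unfolding inner_sum_left
  proof (rule sum.cong[OF refl])
    fix b' assume "b' \<in> B"
    then show "(y b' *\<^sub>R b') \<bullet> b = (if b' = b then y b else 0)"
      using assms(2-4) by (auto simp: pairwise_def orthogonal_def dot_square_norm)
  qed
  then show ?thesis using assms(1,4) by simp
qed

text \<open>The coordinates of a point of \<open>F\<close> are inner products of unit vectors with a
  difference of two points of \<open>F\<close>. So they are at most \<open>2 * R\<close> in modulus,
  and the preimage of \<open>F\<close> lies in a cube.\<close>

lemma hull_lborel_finite:
  assumes "F \<noteq> {}" "bounded F" "F \<in> sets (borel :: 'a::euclidean_space measure)"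
  shows "sets (borel :: 'a measure) \<subseteq> sets (hull_lborel F)" "space (hull_lborel F) = UNIV"
    "F \<in> sets (hull_lborel F)" "emeasure (hull_lborel F) F < \<infinity>"
proof -
  obtain p B where B: "p \<in> F" "finite B" "pairwise orthogonal B" "\<And>b. b \<in> B \<Longrightarrow> norm b = 1"
    and eq: "hull_lborel F = distr (\<Pi>\<^sub>M b\<in>B. lborel) borel (\<lambda>y. p + (\<Sum>b\<in>B. y b *\<^sub>R b))"
    by (rule hull_lborel_chart[OF assms(1)]) blast
  show "sets (borel :: 'a measure) \<subseteq> sets (hull_lborel F)" "space (hull_lborel F) = UNIV"
    "F \<in> sets (hull_lborel F)"
    using assms(3) by (auto simp: eq)
  interpret product_sigma_finite "\<lambda>_::'a. lborel :: real measure" by standard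
  obtain R where R: "\<And>x. x \<in> F \<Longrightarrow> norm x \<le> R" using assms(2) by (auto simp: bounded_iff)
  define \<phi> where "\<phi> y = p + (\<Sum>b\<in>B. y b *\<^sub>R b)" for y :: "'a \<Rightarrow> real"
  let ?P = "\<Pi>\<^sub>M b\<in>B. (lborel :: real measure)"
  have "emeasure (hull_lborel F) F = emeasure ?P (\<phi> -` F \<inter> space ?P)"
    unfolding eq \<phi>_def by (rule emeasure_distr[OF chart_measurable assms(3)])
  also have "\<dots> \<le> emeasure ?P (\<Pi>\<^sub>E b\<in>B. {-(2 * R)..2 * R})"
  proof (rule emeasure_mono)
    show "\<phi> -` F \<inter> space ?P \<subseteq> (\<Pi>\<^sub>E b\<in>B. {-(2 * R)..2 * R})"
    proof
      fix y assume y: "y \<in> \<phi> -` F \<inter> space ?P"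
      have "\<bar>y b\<bar> \<le> 2 * R" if "b \<in> B" for b
      proof -
        have "y b = (\<phi> y - p) \<bullet> b" using chart_coordinate[OF B(2-4) that] by (simp add: \<phi>_def)
        also have "\<bar>\<dots>\<bar> \<le> norm (\<phi> y - p) * norm b" by (rule Cauchy_Schwarz_ineq2)
        also have "\<dots> \<le> norm (\<phi> y) + norm p" using B(4)[OF that] by (simp add: norm_triangle_ineq4)
        also have "\<dots> \<le> 2 * R" using R[of "\<phi> y"] R[OF B(1)] y by auto
        finally show ?thesis .
      qed
      then show "y \<in> (\<Pi>\<^sub>E b\<in>B. {-(2 * R)..2 * R})"
        using y by (auto simp: space_PiM PiE_iff abs_le_iff minus_le_iff)
    qed
    show "(\<Pi>\<^sub>E b\<in>B. {-(2 * R)..2 * R}) \<in> sets ?P" using B(2) by (intro sets_PiM_I_finite) auto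
  qed
  also have "\<dots> = (\<Prod>b\<in>B. emeasure lborel {-(2 * R)..2 * R})"
    using B(2) by (intro emeasure_PiM) auto
  also have "\<dots> < \<infinity>" using B(2) by (simp add: emeasure_lborel_Icc_eq power_less_top_ennreal)
  finally show "emeasure (hull_lborel F) F < \<infinity>" .
qed

lemma face_inner_lin:
  assumes "flat_face F" "bounded_borel_on F u" "bounded_borel_on F v" "bounded_borel_on F w"
  shows "face_inner F (\<lambda>x. u x + t * v x) w = face_inner F u w + t * face_inner F v w"
proof -
  have "F \<noteq> {}" "bounded F" using assms(1) by (auto simp: flat_face_def)
  note int = set_integrable_bounded_borel[OF bounded_borel_on_inner
      hull_lborel_finite[OF this flat_face_borel[OF assms(1)]]]
  have "(LINT x:F|hull_lborel F. u x \<bullet> w x + t * (v x \<bullet> w x)) =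
      (LINT x:F|hull_lborel F. u x \<bullet> w x) + (LINT x:F|hull_lborel F. t * (v x \<bullet> w x))"
    by (intro set_integral_add int set_integrable_mult_right assms)
  then show ?thesis by (simp add: face_inner_def algebra_simps)
qed

text \<open>Otherwise, by continuity and relative openness of \<open>F\<close>, the chart would map
  a whole box of coordinates into points of \<open>F\<close> with \<open>g \<noteq> 0\<close>, and a
  box has positive measure.\<close>

lemma hull_lborel_AE_on_face:
  assumes F: "flat_face F" and ae: "AE x in hull_lborel F. x \<in> F \<longrightarrow> g x = (0::real)"
    and g: "continuous_on UNIV g" and x0: "x0 \<in> F"
  shows "g x0 = 0"
proof (rule ccontr)
  assume ne: "g x0 \<noteq> 0"
  obtain a \<beta> where a: "a \<noteq> 0" "openin (top_of_set {x. a \<bullet> x = \<beta>}) F" using F by (auto simp: flat_face_def)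
  obtain U where U: "open U" "F = {x. a \<bullet> x = \<beta>} \<inter> U" using a(2) by (auto simp: openin_open)
  obtain p B where B: "p \<in> F" "finite B" "pairwise orthogonal B" "\<And>b. b \<in> B \<Longrightarrow> norm b = 1"
    "span B = span {x - y | x y. x \<in> F \<and> y \<in> F}"
    and eq: "hull_lborel F = distr (\<Pi>\<^sub>M b\<in>B. lborel) borel (\<lambda>y. p + (\<Sum>b\<in>B. y b *\<^sub>R b))"
    by (rule hull_lborel_chart[of F]) (use x0 in blast)+
  have dir: "a \<bullet> b = 0" if "b \<in> B" for b
  proof -
    have "span {x - y | x y. x \<in> F \<and> y \<in> F} \<subseteq> {v. a \<bullet> v = 0}"
      using U(2) by (intro span_minimal subspace_hyperplane) (auto simp: inner_diff_right)
    then show ?thesis using that B(5) span_base by blast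
  qed
  define \<phi> where "\<phi> y = p + (\<Sum>b\<in>B. y b *\<^sub>R b)" for y :: "'a \<Rightarrow> real"
  let ?P = "\<Pi>\<^sub>M b\<in>B. (lborel :: real measure)"
  have on_plane: "a \<bullet> \<phi> y = \<beta>" for y
    using B(1) U(2) dir by (simp add: \<phi>_def inner_add_right inner_sum_right)
  have "open (U \<inter> g -` (- {0}))" using U(1) g by (intro open_Int open_vimage) auto
  moreover have "x0 \<in> U \<inter> g -` (- {0})" using ne x0 U(2) by simp
  ultimately obtain e where e: "e > 0" "ball x0 e \<subseteq> U \<inter> g -` (- {0})"
    using open_contains_ball by blast
  \<comment> \<open>The coordinates of \<open>x0\<close>. By the triangle inequality, a box of
    half-width \<open>\<delta>\<close> around them is mapped into \<open>ball x0 e\<close>, as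
    \<open>card B * \<delta> < e\<close>; the 1 in the denominator covers empty
    \<open>B\<close>.\<close>
  define y0 where "y0 b = (x0 - p) \<bullet> b" for b
  define \<delta> where "\<delta> = e / (real (card B) + 1)"
  have \<delta>: "\<delta> > 0" "card B * \<delta> < e" using e(1) by (auto simp: \<delta>_def field_simps)
  have "x0 - p \<in> span B" unfolding B(5) using x0 B(1) by (intro span_base) auto
  then have "(\<Sum>b\<in>B. y0 b *\<^sub>R b) = x0 - p"
    unfolding y0_def using B by (intro orthonormal_basis_expand) auto
  then have x0_eq: "\<phi> y0 = x0" by (simp add: \<phi>_def)
  define Q where "Q = (\<Pi>\<^sub>E b\<in>B. {y0 b - \<delta><..<y0 b + \<delta>})"
  have in_F: "\<phi> y \<in> F \<and> g (\<phi> y) \<noteq> 0" if "y \<in> Q" for y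
  proof -
    have "norm (\<phi> y - x0) = norm (\<Sum>b\<in>B. (y b - y0 b) *\<^sub>R b)"
      unfolding x0_eq[symmetric] by (simp add: \<phi>_def sum_subtractf scaleR_diff_left)
    also have "\<dots> \<le> (\<Sum>b\<in>B. \<delta>)"
    proof (rule sum_norm_le)
      fix b assume b: "b \<in> B"
      then have "y b \<in> {y0 b - \<delta><..<y0 b + \<delta>}" using that unfolding Q_def by blast
      then show "norm ((y b - y0 b) *\<^sub>R b) \<le> \<delta>" using B(4)[OF b] by (simp add: abs_le_iff)
    qed
    also have "\<dots> < e" using \<delta> by simp
    finally have "\<phi> y \<in> ball x0 e" by (simp add: dist_norm norm_minus_commute)
    then show ?thesis using e(2) on_plane U(2) by auto
  qed
  have "AE y in ?P. \<phi> y \<in> F \<longrightarrow> g (\<phi> y) = 0"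
    using ae unfolding eq \<phi>_def by (rule AE_distrD[OF chart_measurable])
  then have "AE y in ?P. y \<notin> Q" using in_F by (auto elim!: eventually_mono)
  moreover have Q: "Q \<in> sets ?P" unfolding Q_def using B(2) by (intro sets_PiM_I_finite) auto
  ultimately have "emeasure ?P Q = 0"
    by (simp add: AE_iff_null_sets null_setsD1)
  moreover interpret product_sigma_finite "\<lambda>_::'a. lborel :: real measure" by standard
  have "emeasure ?P Q = (\<Prod>b\<in>B. emeasure lborel {y0 b - \<delta><..<y0 b + \<delta>})"
    unfolding Q_def using B(2) by (intro emeasure_PiM) auto
  ultimately show False using \<delta>(1) B(2) by (auto simp: prod_zero_iff)
qed

lemma face_inner_definite:
  assumes F: "flat_face F" and u: "continuous_on UNIV u" and "face_inner F u u = 0" "x \<in> F"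
  shows "u x = 0"
proof -
  have ne: "F \<noteq> {}" and bd: "bounded F" using F by (auto simp: flat_face_def)
  note meas = flat_face_borel[OF F]
  have bb: "bounded_borel_on F u" by (rule bounded_borel_on_continuous[OF u bd meas])
  have "integrable (hull_lborel F) (\<lambda>x. indicat_real F x *\<^sub>R (u x * u x))"
    using set_integrable_bounded_borel[OF bounded_borel_on_inner[OF bb bb]
        hull_lborel_finite[OF ne bd meas]]
    by (simp add: set_integrable_def)
  then have "AE x in hull_lborel F. indicat_real F x *\<^sub>R (u x * u x) = 0"
    using assms(3) unfolding face_inner_def set_lebesgue_integral_def
    by (subst integral_nonneg_eq_0_iff_AE[symmetric]) auto
  then have "AE x in hull_lborel F. x \<in> F \<longrightarrow> u x = 0"
    by eventually_elim (auto simp: indicator_def split: if_splits)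
  then show ?thesis by (rule hull_lborel_AE_on_face[OF F _ u assms(4)])
qed

section \<open>Normals and face projections\<close>

text \<open>Where no outward normal exists, the definite description has a fixed junk value; elsewhere on \<open>F\<close>
  the normal is one of the two unit normals of the hyperplane of \<open>F\<close>, each on a relatively open set.
  Nothing more is needed, since the flux terms vanish in the definiteness argument anyway.\<close>

lemma outward_normal_bounded_borel:
  fixes F T :: "'a::euclidean_space set"
  assumes "open T" "F \<subseteq> frontier T" "flat_face F"
  shows "bounded_borel_on F (outward_normal T)"
proof -
  obtain a \<beta> where a: "a \<noteq> 0" "openin (top_of_set {x. a \<bullet> x = \<beta>}) F"
    using assms(3) by (auto simp: flat_face_def)
  obtain U where U: "open U" "F = {x. a \<bullet> x = \<beta>} \<inter> U" using a(2) by (auto simp: openin_open)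
  define \<nu> where "\<nu> = a /\<^sub>R norm a"
  have \<nu>: "norm \<nu> = 1" "\<nu> \<bullet> \<nu> = 1" using a(1) by (simp_all add: \<nu>_def dot_square_norm)
  have a_\<nu>: "a = norm a *\<^sub>R \<nu>" using a(1) by (simp add: \<nu>_def)
  define P where "P x n \<longleftrightarrow> norm n = 1 \<and> (\<exists>r>0. T \<inter> ball x r = {y \<in> ball x r. (y - x) \<bullet> n < 0})" for x n
  have dir: "n = \<nu> \<or> n = - \<nu>" if x: "x \<in> F" and "P x n" for x n
  proof -
    obtain r where n: "norm n = 1" and r: "r > 0" "T \<inter> ball x r = {y \<in> ball x r. (y - x) \<bullet> n < 0}"
      using \<open>P x n\<close> unfolding P_def by blast
    obtain e where e: "e > 0" "ball x e \<subseteq> U" using x U open_contains_ball by blast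
    \<comment> \<open>The component of \<open>n\<close> along the hyperplane. A short step from
      \<open>x\<close> in direction \<open>v\<close> stays in \<open>F\<close>, hence on the
      frontier of \<open>T\<close>. Near \<open>x\<close>, frontier points lie neither in the
      half-space that is \<open>T\<close> nor in the open complementary one, so
      \<open>v \<bullet> n = 0\<close>; this inner product is the square of the norm of
      \<open>v\<close>.\<close>
    define v where "v = n - (n \<bullet> \<nu>) *\<^sub>R \<nu>"
    have v\<nu>: "v \<bullet> \<nu> = 0" using \<nu> by (simp add: v_def inner_diff_left)
    define \<delta> where "\<delta> = min r e / 2 / (norm v + 1)"
    have \<delta>: "\<delta> > 0" using r(1) e(1) by (auto simp: \<delta>_def intro!: divide_pos_pos add_nonneg_pos)
    define y where "y = x + \<delta> *\<^sub>R v"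
    have "\<delta> * norm v < min r e"
    proof -
      have "\<delta> * norm v \<le> \<delta> * (norm v + 1)" using \<delta> by (simp add: mult_left_mono)
      also have "\<dots> = min r e / 2"
      proof -
        have "norm v + 1 \<noteq> 0" using norm_ge_zero[of v] by linarith
        from nonzero_divide_eq_eq[OF this, THEN iffD1, OF refl] show ?thesis unfolding \<delta>_def by (rule sym)
      qed
      also have "\<dots> < min r e" using r(1) e(1) by (simp add: min_def)
      finally show ?thesis .
    qed
    then have y_ball: "y \<in> ball x r" "y \<in> ball x e" using \<delta> by (auto simp: y_def dist_norm)
    have "a \<bullet> v = 0" using v\<nu> by (subst a_\<nu>) (simp add: inner_commute)
    then have "a \<bullet> y = \<beta>" using x U(2) by (simp add: y_def inner_add_right)
    then have "y \<in> F" using y_ball e U(2) by auto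
    then have fr: "y \<in> closure T" "y \<notin> T"
      using assms(1,2) by (auto simp: frontier_def interior_open)
    have "\<not> (y - x) \<bullet> n < 0" using fr(2) r(2) y_ball by blast
    moreover have "\<not> (y - x) \<bullet> n > 0"
    proof
      assume pos: "(y - x) \<bullet> n > 0"
      have "open {z. 0 < (z - x) \<bullet> n}" by (intro open_Collect_less continuous_intros)
      then have "open (ball x r \<inter> {z. 0 < (z - x) \<bullet> n})" by blast
      moreover have "T \<inter> (ball x r \<inter> {z. 0 < (z - x) \<bullet> n}) = {}" using r(2) by force
      moreover have "y \<in> ball x r \<inter> {z. 0 < (z - x) \<bullet> n}" using pos y_ball by blast
      ultimately show False using fr(1) open_Int_closure_eq_empty by blast
    qed
    ultimately have "v \<bullet> n = 0" using \<delta> by (simp add: y_def)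
    moreover have "v \<bullet> v = v \<bullet> n - (n \<bullet> \<nu>) * (v \<bullet> \<nu>)" by (subst (2) v_def) (simp add: inner_diff_right)
    ultimately have "v = 0" using v\<nu> by simp
    then have n_eq: "n = (n \<bullet> \<nu>) *\<^sub>R \<nu>" by (simp add: v_def)
    then have "\<bar>n \<bullet> \<nu>\<bar> = 1" using n \<nu>(1) by (metis mult.right_neutral norm_scaleR)
    then have "n \<bullet> \<nu> = 1 \<or> n \<bullet> \<nu> = - 1" by linarith
    then show ?thesis using n_eq by (metis scaleR_minus1_left scaleR_one)
  qed
  have excl: "\<not> P x (- \<nu>)" if "P x \<nu>" for x
  proof
    assume "P x (- \<nu>)"
    then obtain s where s: "s > 0" "T \<inter> ball x s = {y \<in> ball x s. (y - x) \<bullet> (- \<nu>) < 0}"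
      unfolding P_def by blast
    obtain r where r: "r > 0" "T \<inter> ball x r = {y \<in> ball x r. (y - x) \<bullet> \<nu> < 0}"
      using \<open>P x \<nu>\<close> unfolding P_def by blast
    \<comment> \<open>A step from \<open>x\<close> against \<open>\<nu>\<close>: in \<open>T\<close>
      by the first description of \<open>T\<close> near \<open>x\<close>, outside by the
      second.\<close>
    define y where "y = x - (min r s / 2) *\<^sub>R \<nu>"
    have y: "y \<in> ball x r" "y \<in> ball x s" using r(1) s(1) \<nu> by (auto simp: y_def dist_norm)
    have val: "(y - x) \<bullet> \<nu> = - (min r s / 2)" using \<nu> by (simp add: y_def)
    then have "(y - x) \<bullet> \<nu> < 0" using r(1) s(1) by simp
    then have "y \<in> T" using r(2) y(1) by blast
    then have "(y - x) \<bullet> (- \<nu>) < 0" using s(2) y(2) by blast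
    then show False using \<open>(y - x) \<bullet> \<nu> < 0\<close> by simp
  qed
  define junk where "junk = (THE n :: 'a. False)"
  have on: "outward_normal T x = (if P x \<nu> then \<nu> else if P x (- \<nu>) then - \<nu> else junk)" if x: "x \<in> F" for x
  proof -
    \<comment> \<open>The description as an explicit predicate, which is either a singleton or
      identically false; in the latter case it evaluates to \<open>junk\<close>.\<close>
    have "P x = (\<lambda>n. n = (if P x \<nu> then \<nu> else - \<nu>) \<and> (P x \<nu> \<or> P x (- \<nu>)))"
      using dir[OF x] excl[of x] by (intro ext) (metis)
    moreover have "outward_normal T x = The (P x)"
      unfolding outward_normal_def P_def by simp
    ultimately have "outward_normal T x =
        (THE n. n = (if P x \<nu> then \<nu> else - \<nu>) \<and> (P x \<nu> \<or> P x (- \<nu>)))" by simp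
    then show ?thesis by (cases "P x \<nu>"; cases "P x (- \<nu>)") (simp_all add: junk_def)
  qed
  have F_borel: "F \<in> sets borel" by (rule flat_face_borel[OF assms(3)])
  have borel: "{x \<in> F. P x n} \<in> sets borel" if n: "n = \<nu> \<or> n = - \<nu>" for n
  proof -
    have orth: "(x' - x) \<bullet> n = 0" if "x \<in> F" "x' \<in> F" for x x'
    proof -
      have "norm a * ((x' - x) \<bullet> \<nu>) = a \<bullet> (x' - x)" by (subst (2) a_\<nu>) (simp add: inner_commute)
      also have "\<dots> = 0" using that U(2) by (simp add: inner_diff_right)
      finally show ?thesis using a(1) n by auto
    qed
    have "openin (top_of_set F) {x \<in> F. P x n}"
      unfolding openin_contains_ball
    proof (intro conjI ballI)
      fix x assume "x \<in> {x \<in> F. P x n}"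
      then have x: "x \<in> F" "P x n" by auto
      then obtain r where r: "norm n = 1" "r > 0" "T \<inter> ball x r = {y \<in> ball x r. (y - x) \<bullet> n < 0}"
        unfolding P_def by blast
      have "P x' n" if x': "x' \<in> ball x r \<inter> F" for x'
      proof -
        \<comment> \<open>Moving along \<open>F\<close> does not change the half-space, since
          \<open>n\<close> is orthogonal to \<open>F\<close>; the description at \<open>x\<close>
          therefore holds at \<open>x'\<close> on the smaller ball that remains.\<close>
        have sub: "ball x' (r - dist x x') \<subseteq> ball x r"
          by (auto simp: dist_commute) (metis add.commute dist_triangle_lt less_diff_eq dist_commute)
        have eq: "(y - x') \<bullet> n = (y - x) \<bullet> n" for y
          using orth[OF x(1), of x'] x' by (simp add: inner_diff_left)
        have "T \<inter> ball x' (r - dist x x') = {y \<in> ball x' (r - dist x x'). (y - x') \<bullet> n < 0}"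
          using r(3) sub unfolding eq by blast
        then show ?thesis using r(1) x' unfolding P_def by (intro conjI exI[of _ "r - dist x x'"]) auto
      qed
      then show "\<exists>e>0. ball x e \<inter> F \<subseteq> {x \<in> F. P x n}" using r(2) by blast
    qed auto
    then obtain W where "open W" "{x \<in> F. P x n} = F \<inter> W" by (auto simp: openin_open)
    then show ?thesis using F_borel by auto
  qed
  have meas[measurable]: "{x \<in> F. P x \<nu>} \<in> sets borel" "{x \<in> F. P x (- \<nu>)} \<in> sets borel" "F \<in> sets borel"
    using borel F_borel by auto
  \<comment> \<open>Values are measured from \<open>junk\<close>, so that the set without a normal
    needs no indicator of its own.\<close>
  have "indicat_real F x *\<^sub>R outward_normal T x =
      indicat_real {x \<in> F. P x \<nu>} x *\<^sub>R (\<nu> - junk) + indicat_real {x \<in> F. P x (- \<nu>)} x *\<^sub>R (- \<nu> - junk) +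
      indicat_real F x *\<^sub>R junk" for x
    using on[of x] excl[of x] by (cases "x \<in> F") auto
  moreover have "(\<lambda>x. indicat_real {x \<in> F. P x \<nu>} x *\<^sub>R (\<nu> - junk) +
      indicat_real {x \<in> F. P x (- \<nu>)} x *\<^sub>R (- \<nu> - junk) +
      indicat_real F x *\<^sub>R junk) \<in> borel_measurable borel"
    by measurable
  moreover have "norm (outward_normal T x) \<le> norm \<nu> + norm junk" if "x \<in> F" for x
    unfolding on[OF that] by auto
  ultimately show ?thesis by (intro bounded_borel_onI) simp_all
qed

section \<open>Polynomials on faces and their projection\<close>

lemma face_poly_spaceE:
  assumes "q \<in> face_poly_space k F"
  obtains p where "p \<in> poly_space k" "q = restrict p F" "\<And>x. x \<in> F \<Longrightarrow> q x = p x"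
  using assms unfolding face_poly_space_def by auto

lemma face_poly_space_lin:
  assumes "q \<in> face_poly_space k F" "r \<in> face_poly_space k F"
  shows "(\<lambda>x\<in>F. q x + t * r x) \<in> face_poly_space k F"
proof -
  obtain p where p: "p \<in> poly_space k" "\<And>x. x \<in> F \<Longrightarrow> q x = p x"
    using assms(1) by (rule face_poly_spaceE) blast
  obtain s where s: "s \<in> poly_space k" "\<And>x. x \<in> F \<Longrightarrow> r x = s x"
    using assms(2) by (rule face_poly_spaceE) blast
  have "(\<lambda>x\<in>F. q x + t * r x) = restrict (\<lambda>x. p x + t * s x) F"
    using p(2) s(2) by (intro restrict_ext) simp
  then show ?thesis using poly_space_lin[OF p(1) s(1)] unfolding face_poly_space_def by blast
qed

lemma face_poly_space_bounded_borel:
  assumes "flat_face F" "q \<in> face_poly_space k F"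
  shows "bounded_borel_on F q"
proof -
  obtain p where p: "p \<in> poly_space k" "\<And>x. x \<in> F \<Longrightarrow> q x = p x"
    using assms(2) by (rule face_poly_spaceE) blast
  have "bounded F" using assms(1) by (simp add: flat_face_def)
  then have "bounded_borel_on F p"
    by (rule bounded_borel_on_continuous[OF continuous_on_poly_space[OF p(1)] _ flat_face_borel[OF assms(1)]])
  then show ?thesis using bounded_borel_on_cong[of F q p] p(2) by simp
qed

lemma face_poly_space_definite:
  assumes "flat_face F" "q \<in> face_poly_space k F" "face_inner F q q = 0" "x \<in> F"
  shows "q x = 0"
proof -
  obtain p where p: "p \<in> poly_space k" "\<And>x. x \<in> F \<Longrightarrow> q x = p x"
    using assms(2) by (rule face_poly_spaceE) blast
  have "face_inner F q q = face_inner F p p" by (rule face_inner_cong) (simp_all add: p(2))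
  with assms(3) have "face_inner F p p = 0" by simp
  from face_inner_definite[OF assms(1) continuous_on_poly_space[OF p(1)] this assms(4)]
  show ?thesis using p(2)[OF assms(4)] by simp
qed

lemma face_inner_zero: "(\<And>x. x \<in> F \<Longrightarrow> v x = 0) \<Longrightarrow> face_inner F u v = 0"
  using face_inner_cong[of F u u v "\<lambda>x. 0"] by (simp add: face_inner_def)

lemma cell_inner_zero: "(\<And>x. x \<in> F \<Longrightarrow> v x = 0) \<Longrightarrow> cell_inner F u v = 0"
  using cell_inner_cong[of F u u v "\<lambda>x. 0"] by (simp add: cell_inner_def)

lemma face_inner_lin_on:
  assumes "flat_face F" "bounded_borel_on F u" "bounded_borel_on F v" "bounded_borel_on F w"
    and "\<And>x. x \<in> F \<Longrightarrow> s x = u x + t * v x"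
  shows "face_inner F s w = face_inner F u w + t * face_inner F v w"
  unfolding face_inner_lin[OF assms(1-4), symmetric] by (rule face_inner_cong) (simp_all add: assms(5))

text \<open>Existence is \<open>riesz_param\<close>. For uniqueness, the difference of two
  candidates is orthogonal to itself and so vanishes on \<open>F\<close>; both candidates are
  restrictions to \<open>F\<close>, which settles the values elsewhere.\<close>

lemma face_proj_ex1:
  fixes F :: "'a::euclidean_space set"
  assumes F: "flat_face F" and u: "bounded_borel_on F u"
  shows "\<exists>!p. p \<in> face_poly_space k F \<and> (\<forall>w\<in>face_poly_space k F. face_inner F p w = face_inner F u w)"
proof (rule ex_ex1I)
  define \<Phi> where "\<Phi> c = restrict (poly_comb k c) F" for c
  note bb = face_poly_space_bounded_borel[OF F]
  have ran: "\<Phi> c \<in> face_poly_space k F" for c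
    unfolding \<Phi>_def face_poly_space_def poly_space_eq_range by blast
  have \<Phi>_lin: "\<Phi> (\<lambda>i. c i + t * d i) x = \<Phi> c x + t * \<Phi> d x" if "x \<in> F" for c d t x
    using that by (simp add: \<Phi>_def poly_comb_lin)
  have "\<exists>v\<in>face_poly_space k F. \<forall>w\<in>face_poly_space k F. face_inner F v w = face_inner F u w"
  proof (rule riesz_param[of "multi_indices k :: ('a \<Rightarrow> nat) set" \<Phi>, OF finite_multi_indices ran])
    fix v assume "v \<in> face_poly_space k F"
    then obtain p where "p \<in> poly_space k" "v = restrict p F" by (rule face_poly_spaceE)
    then show "\<exists>c. (\<forall>i. i \<notin> multi_indices k \<longrightarrow> c i = 0) \<and> \<Phi> c = v"
      using poly_space_coeffs unfolding \<Phi>_def by metis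
  next
    fix c d t w assume w: "w \<in> face_poly_space k F"
    show "face_inner F (\<Phi> (\<lambda>i. c i + t * d i)) w = face_inner F (\<Phi> c) w + t * face_inner F (\<Phi> d) w"
      by (intro face_inner_lin_on[OF F] bb[OF ran] bb[OF w] \<Phi>_lin)
  next
    fix c d t
    show "face_inner F u (\<Phi> (\<lambda>i. c i + t * d i)) = face_inner F u (\<Phi> c) + t * face_inner F u (\<Phi> d)"
      unfolding face_inner_commute[of F u] by (intro face_inner_lin_on[OF F] bb[OF ran] \<Phi>_lin u)
  next
    fix v assume "v \<in> face_poly_space k F" "face_inner F v v = 0"
    then show "face_inner F u v = 0" using face_inner_zero face_poly_space_definite[OF F] by blast
  qed (rule face_inner_commute face_inner_nonneg)+
  then show "\<exists>p. p \<in> face_poly_space k F \<and> (\<forall>w\<in>face_poly_space k F. face_inner F p w = face_inner F u w)"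
    by blast
next
  note bb = face_poly_space_bounded_borel[OF F]
  fix p q
  assume p: "p \<in> face_poly_space k F \<and> (\<forall>w\<in>face_poly_space k F. face_inner F p w = face_inner F u w)"
    and q: "q \<in> face_poly_space k F \<and> (\<forall>w\<in>face_poly_space k F. face_inner F q w = face_inner F u w)"
  define d where "d = (\<lambda>x\<in>F. p x + (-1) * q x)"
  have d: "d \<in> face_poly_space k F" unfolding d_def by (rule face_poly_space_lin) (use p q in auto)
  have "face_inner F d d = face_inner F p d + (-1) * face_inner F q d"
    by (rule face_inner_lin_on[OF F]) (use p q d bb in \<open>auto simp: d_def\<close>)
  also have "\<dots> = 0" using p q d by simp
  finally have zero: "d x = 0" if "x \<in> F" for x using face_poly_space_definite[OF F d _ that] by simp
  have "p = restrict p F" "q = restrict q F" using p q unfolding face_poly_space_def by auto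
  moreover have "restrict p F = restrict q F"
    using zero by (intro restrict_ext) (simp add: d_def)
  ultimately show "p = q" by simp
qed

lemma
  assumes F: "flat_face F" and u: "bounded_borel_on F u"
  shows face_proj_in: "face_proj k F u \<in> face_poly_space k F"
    and face_proj_inner: "\<And>w. w \<in> face_poly_space k F \<Longrightarrow> face_inner F (face_proj k F u) w = face_inner F u w"
  using theI'[OF face_proj_ex1[OF assms, of k]] unfolding face_proj_def by auto

lemma face_proj_eqI:
  assumes "flat_face F" "bounded_borel_on F u" "p \<in> face_poly_space k F"
    and "\<And>w. w \<in> face_poly_space k F \<Longrightarrow> face_inner F p w = face_inner F u w"
  shows "face_proj k F u = p"
  using the1_equality[OF face_proj_ex1[OF assms(1,2), of k]] assms(3,4) unfolding face_proj_def by blast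

lemma face_proj_lin_on:
  assumes F: "flat_face F" and u: "bounded_borel_on F u" and v: "bounded_borel_on F v"
    and s: "\<And>x. x \<in> F \<Longrightarrow> s x = u x + t * v x"
  shows "face_proj k F s = (\<lambda>x\<in>F. face_proj k F u x + t * face_proj k F v x)"
proof (rule face_proj_eqI[OF F])
  have "bounded_borel_on F (\<lambda>x. u x + t *\<^sub>R v x)" by (rule bounded_borel_on_lin[OF u v])
  then show "bounded_borel_on F s" using bounded_borel_on_cong[of F s "\<lambda>x. u x + t *\<^sub>R v x"] s by simp
  note in_space = face_proj_in[OF F u, of k] face_proj_in[OF F v, of k]
  then show "(\<lambda>x\<in>F. face_proj k F u x + t * face_proj k F v x) \<in> face_poly_space k F"
    by (rule face_poly_space_lin)
  fix w assume w: "w \<in> face_poly_space k F"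
  note bb = face_poly_space_bounded_borel[OF F]
  have "face_inner F (\<lambda>x\<in>F. face_proj k F u x + t * face_proj k F v x) w =
      face_inner F (face_proj k F u) w + t * face_inner F (face_proj k F v) w"
    by (intro face_inner_lin_on[OF F] bb[OF in_space(1)] bb[OF in_space(2)] bb[OF w]) simp
  also have "\<dots> = face_inner F u w + t * face_inner F v w"
    by (simp add: face_proj_inner[OF F u w] face_proj_inner[OF F v w])
  also have "\<dots> = face_inner F s w"
    by (rule face_inner_lin_on[OF F u v bb[OF w] s, symmetric])
  finally show "face_inner F (\<lambda>x\<in>F. face_proj k F u x + t * face_proj k F v x) w = face_inner F s w" .
qed

lemma face_proj_poly:
  assumes F: "flat_face F" and p: "p \<in> face_poly_space k F" and u: "\<And>x. x \<in> F \<Longrightarrow> u x = p x"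
  shows "face_proj k F u = p"
proof (rule face_proj_eqI[OF F _ p])
  show "bounded_borel_on F u"
    using face_poly_space_bounded_borel[OF F p] bounded_borel_on_cong[of F u p] u by simp
  show "face_inner F p w = face_inner F u w" for w
    by (rule face_inner_cong) (simp_all add: u)
qed

section \<open>The local reconstruction\<close>

text \<open>What the local theory knows of a cell. It isolates projections, reconstruction and local
  form from the rest of the mesh.\<close>

locale mesh_cell =
  fixes T :: "'a::euclidean_space set" and \<F> :: "'a set set"
  assumes open_cell: "open T" and bounded_cell: "bounded T" and nonempty_cell: "T \<noteq> {}"
    and finite_cell_faces: "finite (cell_faces \<F> T)"
    and flat_cell_faces: "\<And>F. F \<in> cell_faces \<F> T \<Longrightarrow> flat_face F"
begin

lemma cell_bounded_borel: "continuous_on UNIV u \<Longrightarrow> bounded_borel_on T u"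
  using bounded_borel_on_continuous[OF _ bounded_cell] open_cell by simp

lemma face_bounded_borel:
  assumes "F \<in> cell_faces \<F> T" "continuous_on UNIV u"
  shows "bounded_borel_on F u"
proof -
  have "flat_face F" by (rule flat_cell_faces[OF assms(1)])
  then have "bounded F" "F \<in> sets borel" by (auto simp: flat_face_def flat_face_borel)
  then show ?thesis using bounded_borel_on_continuous assms(2) by blast
qed

lemma flux_bounded_borel:
  assumes "F \<in> cell_faces \<F> T" "w \<in> poly_space l"
  shows "bounded_borel_on F (\<lambda>x. gradient w x \<bullet> outward_normal T x)"
proof (rule bounded_borel_on_inner)
  show "bounded_borel_on F (gradient w)"
    by (rule face_bounded_borel[OF assms(1) continuous_on_gradient[OF assms(2)]])
  show "bounded_borel_on F (outward_normal T)"
    using assms(1) flat_cell_faces[OF assms(1)]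
    by (intro outward_normal_bounded_borel open_cell) (auto simp: cell_faces_def)
qed

lemma cell_inner_lin_on:
  assumes "continuous_on UNIV u" "continuous_on UNIV v" "continuous_on UNIV w"
    and "\<And>x. x \<in> T \<Longrightarrow> s x = u x + t *\<^sub>R v x"
  shows "cell_inner T s w = cell_inner T u w + t * cell_inner T v w"
proof -
  have "T \<in> sets borel" using open_cell by simp
  from cell_inner_lin[OF bounded_cell this, of u v w t] assms(1-3)
  have "cell_inner T (\<lambda>x. u x + t *\<^sub>R v x) w = cell_inner T u w + t * cell_inner T v w"
    by (simp add: cell_bounded_borel)
  moreover have "cell_inner T s w = cell_inner T (\<lambda>x. u x + t *\<^sub>R v x) w"
    by (rule cell_inner_cong) (simp_all add: assms(4))
  ultimately show ?thesis by simp
qed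

lemma cell_inner_poly_definite:
  assumes "p \<in> poly_space l" "cell_inner T p p = 0"
  shows "p = (\<lambda>x. 0)"
proof
  have "p x = 0" if "x \<in> T" for x
    by (rule cell_inner_definite[OF open_cell bounded_cell continuous_on_poly_space[OF assms(1)] assms(2) that])
  then show "p y = 0" for y
    by (rule poly_space_zero_on_open[OF assms(1) open_cell nonempty_cell])
qed

lemma cell_inner_gradient_definite:
  assumes "p \<in> poly_space l" "cell_inner T (gradient p) (gradient p) = 0"
  obtains c where "p = (\<lambda>x. c)"
proof (rule poly_space_gradient_zero_on_open[OF assms(1) open_cell nonempty_cell])
  show "gradient p x = 0" if "x \<in> T" for x
    by (rule cell_inner_definite[OF open_cell bounded_cell continuous_on_gradient[OF assms(1)] assms(2) that])
qed

section \<open>The projection onto polynomials on the cell\<close>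

lemma cell_proj_ex1:
  assumes u: "continuous_on UNIV u"
  shows "\<exists>!p. p \<in> poly_space k \<and> (\<forall>w\<in>poly_space k. cell_inner T p w = cell_inner T u w)"
proof (rule ex_ex1I)
  note cont = continuous_on_poly_space
  have ran: "poly_comb k c \<in> poly_space k" for c :: "('a \<Rightarrow> nat) \<Rightarrow> real" by (simp add: poly_space_eq_range)
  have "\<exists>v\<in>poly_space k. \<forall>w\<in>poly_space k. cell_inner T v w = cell_inner T u w"
  proof (rule riesz_param[of "multi_indices k :: ('a \<Rightarrow> nat) set" "poly_comb k", OF finite_multi_indices ran])
    fix v :: "'a \<Rightarrow> real" assume "v \<in> poly_space k"
    then show "\<exists>c. (\<forall>i. i \<notin> multi_indices k \<longrightarrow> c i = 0) \<and> poly_comb k c = v"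
      using poly_space_coeffs by metis
  next
    fix c d :: "('a \<Rightarrow> nat) \<Rightarrow> real" and t and w :: "'a \<Rightarrow> real" assume w: "w \<in> poly_space k"
    show "cell_inner T (poly_comb k (\<lambda>i. c i + t * d i)) w =
        cell_inner T (poly_comb k c) w + t * cell_inner T (poly_comb k d) w"
      by (intro cell_inner_lin_on cont[OF ran] cont[OF w]) (simp add: poly_comb_lin)
  next
    fix c d :: "('a \<Rightarrow> nat) \<Rightarrow> real" and t
    show "cell_inner T u (poly_comb k (\<lambda>i. c i + t * d i)) =
        cell_inner T u (poly_comb k c) + t * cell_inner T u (poly_comb k d)"
      unfolding cell_inner_commute[of T u]
      by (intro cell_inner_lin_on cont[OF ran] u) (simp add: poly_comb_lin)
  next
    fix v :: "'a \<Rightarrow> real" assume "v \<in> poly_space k" "cell_inner T v v = 0"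
    then have "v = (\<lambda>x. 0)" by (rule cell_inner_poly_definite)
    then show "cell_inner T u v = 0" by (intro cell_inner_zero) simp
  qed (rule cell_inner_commute cell_inner_nonneg)+
  then show "\<exists>p. p \<in> poly_space k \<and> (\<forall>w\<in>poly_space k. cell_inner T p w = cell_inner T u w)"
    by blast
next
  fix p q
  assume p: "p \<in> poly_space k \<and> (\<forall>w\<in>poly_space k. cell_inner T p w = cell_inner T u w)"
    and q: "q \<in> poly_space k \<and> (\<forall>w\<in>poly_space k. cell_inner T q w = cell_inner T u w)"
  define d where "d x = p x + (-1) * q x" for x
  have d_eq: "d = (\<lambda>x. p x + (-1) * q x)" by (auto simp: d_def)
  have d: "d \<in> poly_space k" unfolding d_eq by (rule poly_space_lin) (use p q in auto)
  have "cell_inner T d d = cell_inner T p d + (-1) * cell_inner T q d"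
    by (intro cell_inner_lin_on continuous_on_poly_space[of _ k] d conjunct1[OF p] conjunct1[OF q])
       (simp add: d_def)
  also have "\<dots> = 0" using p q d by simp
  finally have "d = (\<lambda>x. 0)" by (rule cell_inner_poly_definite[OF d])
  then have "d x = 0" for x by simp
  then show "p = q" by (intro ext) (simp add: d_def)
qed

lemma
  assumes u: "continuous_on UNIV u"
  shows cell_proj_in: "cell_proj k T u \<in> poly_space k"
    and cell_proj_inner: "\<And>w. w \<in> poly_space k \<Longrightarrow> cell_inner T (cell_proj k T u) w = cell_inner T u w"
  using theI'[OF cell_proj_ex1[OF assms, of k]] unfolding cell_proj_def by auto

lemma cell_proj_eqI:
  assumes "continuous_on UNIV u" "p \<in> poly_space k"
    and "\<And>w. w \<in> poly_space k \<Longrightarrow> cell_inner T p w = cell_inner T u w"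
  shows "cell_proj k T u = p"
  using the1_equality[OF cell_proj_ex1[OF assms(1), of k]] assms(2,3) unfolding cell_proj_def by blast

lemma cell_proj_lin:
  assumes u: "continuous_on UNIV u" and v: "continuous_on UNIV v"
  shows "cell_proj k T (\<lambda>x. u x + t * v x) = (\<lambda>x. cell_proj k T u x + t * cell_proj k T v x)"
proof (rule cell_proj_eqI)
  show "continuous_on UNIV (\<lambda>x. u x + t * v x)" by (intro continuous_intros u v)
  note in_space = cell_proj_in[OF u, of k] cell_proj_in[OF v, of k]
  then show "(\<lambda>x. cell_proj k T u x + t * cell_proj k T v x) \<in> poly_space k" by (rule poly_space_lin)
  fix w :: "'a \<Rightarrow> real" assume w: "w \<in> poly_space k"
  note cont = continuous_on_poly_space
  have "cell_inner T (\<lambda>x. cell_proj k T u x + t * cell_proj k T v x) w =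
      cell_inner T (cell_proj k T u) w + t * cell_inner T (cell_proj k T v) w"
    by (intro cell_inner_lin_on cont[OF in_space(1)] cont[OF in_space(2)] cont[OF w]) simp
  also have "\<dots> = cell_inner T u w + t * cell_inner T v w"
    by (simp add: cell_proj_inner[OF u w] cell_proj_inner[OF v w])
  also have "\<dots> = cell_inner T (\<lambda>x. u x + t * v x) w"
    by (rule cell_inner_lin_on[OF u v cont[OF w], symmetric]) simp
  finally show "cell_inner T (\<lambda>x. cell_proj k T u x + t * cell_proj k T v x) w =
      cell_inner T (\<lambda>x. u x + t * v x) w" .
qed

section \<open>The local Neumann problem behind the reconstruction\<close>

definition valid_dofs :: "nat \<Rightarrow> 'a local_dofs \<Rightarrow> bool" where
  "valid_dofs k v \<longleftrightarrow> fst v \<in> poly_space k \<and> (\<forall>F\<in>cell_faces \<F> T. snd v F \<in> face_poly_space k F)"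

text \<open>A relation rather than an operation: the face part of \<open>w\<close> is prescribed
  only at points of faces of \<open>T\<close>, and values elsewhere are left free.\<close>

definition comb_dofs :: "'a local_dofs \<Rightarrow> real \<Rightarrow> 'a local_dofs \<Rightarrow> 'a local_dofs \<Rightarrow> bool" where
  "comb_dofs u t v w \<longleftrightarrow> fst w = (\<lambda>x. fst u x + t * fst v x) \<and>
     (\<forall>F\<in>cell_faces \<F> T. \<forall>x\<in>F. snd w F x = snd u F x + t * snd v F x)"

text \<open>The right-hand side of the equation that defines the reconstruction, as a functional of
  the test function \<open>w\<close>.\<close>

definition flux :: "'a local_dofs \<Rightarrow> ('a \<Rightarrow> real) \<Rightarrow> real" where
  "flux v w = cell_inner T (gradient (fst v)) (gradient w) +
     (\<Sum>F\<in>cell_faces \<F> T.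
        face_inner F (\<lambda>x. snd v F x - fst v x) (\<lambda>x. gradient w x \<bullet> outward_normal T x))"

lemma valid_dofs_jump:
  assumes "valid_dofs k v" "F \<in> cell_faces \<F> T"
  shows "bounded_borel_on F (\<lambda>x. snd v F x - fst v x)"
proof -
  have "bounded_borel_on F (snd v F)"
    using assms by (intro face_poly_space_bounded_borel flat_cell_faces) (auto simp: valid_dofs_def)
  moreover have "bounded_borel_on F (fst v)"
    using assms by (intro face_bounded_borel continuous_on_poly_space) (auto simp: valid_dofs_def)
  ultimately show ?thesis using bounded_borel_on_lin[of F "snd v F" "fst v" "-1"] by simp
qed

lemma flux_lin_right:
  assumes v: "valid_dofs k v" and w: "w \<in> poly_space l" and z: "z \<in> poly_space l"
  shows "flux v (\<lambda>x. w x + t * z x) = flux v w + t * flux v z"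
proof -
  have v': "fst v \<in> poly_space k" using v by (simp add: valid_dofs_def)
  have "cell_inner T (gradient (\<lambda>x. w x + t * z x)) (gradient (fst v)) =
      cell_inner T (gradient w) (gradient (fst v)) + t * cell_inner T (gradient z) (gradient (fst v))"
    by (intro cell_inner_lin_on continuous_on_gradient[OF w] continuous_on_gradient[OF z]
        continuous_on_gradient[OF v'] gradient_lin[OF w z])
  moreover have "face_inner F (\<lambda>x. gradient (\<lambda>x. w x + t * z x) x \<bullet> outward_normal T x) (\<lambda>x. snd v F x - fst v x) =
      face_inner F (\<lambda>x. gradient w x \<bullet> outward_normal T x) (\<lambda>x. snd v F x - fst v x) +
      t * face_inner F (\<lambda>x. gradient z x \<bullet> outward_normal T x) (\<lambda>x. snd v F x - fst v x)"
    if F: "F \<in> cell_faces \<F> T" for F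
    by (intro face_inner_lin_on flat_cell_faces[OF F] flux_bounded_borel[OF F w]
        flux_bounded_borel[OF F z] valid_dofs_jump[OF v F])
       (simp add: gradient_lin[OF w z] inner_add_left)
  ultimately show ?thesis
    by (simp add: flux_def cell_inner_commute[of T "gradient (fst v)"]
        face_inner_commute[of _ "\<lambda>x. snd v _ x - fst v x"] sum.distrib sum_distrib_left algebra_simps)
qed

lemma flux_lin_left:
  assumes u: "valid_dofs k u" and v: "valid_dofs k v" and s: "comb_dofs u t v s" and w: "w \<in> poly_space l"
  shows "flux s w = flux u w + t * flux v w"
proof -
  have p: "fst u \<in> poly_space k" "fst v \<in> poly_space k" using u v by (auto simp: valid_dofs_def)
  have s1: "fst s = (\<lambda>x. fst u x + t * fst v x)" using s by (simp add: comb_dofs_def)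
  have "cell_inner T (gradient (fst s)) (gradient w) =
      cell_inner T (gradient (fst u)) (gradient w) + t * cell_inner T (gradient (fst v)) (gradient w)"
    unfolding s1
    by (intro cell_inner_lin_on continuous_on_gradient[OF w] continuous_on_gradient[OF p(1)]
        continuous_on_gradient[OF p(2)] gradient_lin[OF p])
  moreover have "face_inner F (\<lambda>x. snd s F x - fst s x) (\<lambda>x. gradient w x \<bullet> outward_normal T x) =
      face_inner F (\<lambda>x. snd u F x - fst u x) (\<lambda>x. gradient w x \<bullet> outward_normal T x) +
      t * face_inner F (\<lambda>x. snd v F x - fst v x) (\<lambda>x. gradient w x \<bullet> outward_normal T x)"
    if F: "F \<in> cell_faces \<F> T" for F
    by (intro face_inner_lin_on flat_cell_faces[OF F] flux_bounded_borel[OF F w]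
        valid_dofs_jump[OF u F] valid_dofs_jump[OF v F])
       (use s F in \<open>simp add: comb_dofs_def algebra_simps\<close>)
  ultimately show ?thesis
    by (simp add: flux_def sum.distrib sum_distrib_left algebra_simps)
qed

text \<open>The compatibility condition of the Neumann problem; it holds because \<open>flux\<close>
  sees the test function only through its gradient.\<close>

lemma flux_const: "flux v (\<lambda>x. c) = 0"
proof -
  have "cell_inner T (gradient (fst v)) (gradient (\<lambda>x. c)) = 0"
    by (rule cell_inner_zero) (simp add: gradient_const)
  moreover have "face_inner F u (\<lambda>x. gradient (\<lambda>x. c) x \<bullet> outward_normal T x) = 0" for F u
    by (rule face_inner_zero) (simp add: gradient_const)
  ultimately show ?thesis by (simp add: flux_def)
qed

lemma cell_inner_const: "cell_inner T (\<lambda>x. c) u = c * cell_inner T (\<lambda>x. 1) u"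
proof -
  have "(LINT x:T|lebesgue. c * u x) = c * (LINT x:T|lebesgue. u x)" by simp
  then show ?thesis by (simp add: cell_inner_def)
qed

text \<open>The measure of the cell: if it were 0, definiteness would make the polynomial 1
  vanish.\<close>

lemma cell_inner_one: "cell_inner T (\<lambda>x. 1) (\<lambda>x. 1 :: real) \<noteq> 0"
proof
  assume "cell_inner T (\<lambda>x. 1) (\<lambda>x. 1 :: real) = 0"
  from cell_inner_poly_definite[OF poly_space_const this]
  have "(\<lambda>x::'a. 1::real) = (\<lambda>x. 0)" .
  then show False by (simp add: fun_eq_iff)
qed

text \<open>The gradient equation leaves constants free and the mean condition fixes them. Both are
  merged into one equation by adding the product of the means to the gradient form, with a matching
  term in the load. A polynomial on which the merged form \<open>B\<close> vanishes is constant with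
  zero mean, and there the load vanishes too.\<close>

lemma reconstruction_ex1:
  assumes v: "valid_dofs k v"
  shows "\<exists>!r. r \<in> poly_space l \<and>
    (\<forall>w\<in>poly_space l. cell_inner T (gradient r) (gradient w) = flux v w) \<and>
    cell_inner T r (\<lambda>x. 1) = cell_inner T (fst v) (\<lambda>x. 1)"
proof (rule ex_ex1I)
  define B :: "('a \<Rightarrow> real) \<Rightarrow> ('a \<Rightarrow> real) \<Rightarrow> real" where
    "B r w = cell_inner T (gradient r) (gradient w) + cell_inner T r (\<lambda>x. 1) * cell_inner T w (\<lambda>x. 1)" for r w
  define L where "L w = flux v w + cell_inner T (fst v) (\<lambda>x. 1) * cell_inner T w (\<lambda>x. 1)" for w
  note cont = continuous_on_poly_space and gcont = continuous_on_gradient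
  have ran: "poly_comb l c \<in> poly_space l" for c :: "('a \<Rightarrow> nat) \<Rightarrow> real" by (simp add: poly_space_eq_range)
  have comb: "poly_comb l (\<lambda>i. c i + t * d i) = (\<lambda>x. poly_comb l c x + t * poly_comb l d x)"
    for c d :: "('a \<Rightarrow> nat) \<Rightarrow> real" and t by (intro ext poly_comb_lin)
  have mean: "cell_inner T (\<lambda>x. p x + t * q x) (\<lambda>x. 1) = cell_inner T p (\<lambda>x. 1) + t * cell_inner T q (\<lambda>x. 1)"
    if "p \<in> poly_space l" "q \<in> poly_space l" for p q t
    by (intro cell_inner_lin_on cont[OF that(1)] cont[OF that(2)] continuous_on_const) simp
  have "\<exists>r\<in>poly_space l. \<forall>w\<in>poly_space l. B r w = L w"
  proof (rule riesz_param[of "multi_indices l :: ('a \<Rightarrow> nat) set" "poly_comb l", OF finite_multi_indices ran])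
    fix p :: "'a \<Rightarrow> real" assume "p \<in> poly_space l"
    then show "\<exists>c. (\<forall>i. i \<notin> multi_indices l \<longrightarrow> c i = 0) \<and> poly_comb l c = p"
      using poly_space_coeffs by metis
  next
    fix c d :: "('a \<Rightarrow> nat) \<Rightarrow> real" and t and w :: "'a \<Rightarrow> real" assume w: "w \<in> poly_space l"
    have "cell_inner T (gradient (poly_comb l (\<lambda>i. c i + t * d i))) (gradient w) =
        cell_inner T (gradient (poly_comb l c)) (gradient w) + t * cell_inner T (gradient (poly_comb l d)) (gradient w)"
      unfolding comb by (intro cell_inner_lin_on gcont[OF ran] gcont[OF w] gradient_lin[OF ran ran])
    then show "B (poly_comb l (\<lambda>i. c i + t * d i)) w = B (poly_comb l c) w + t * B (poly_comb l d) w"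
      unfolding B_def comb mean[OF ran ran] by (simp add: algebra_simps)
  next
    fix c d :: "('a \<Rightarrow> nat) \<Rightarrow> real" and t
    show "L (poly_comb l (\<lambda>i. c i + t * d i)) = L (poly_comb l c) + t * L (poly_comb l d)"
      unfolding L_def comb mean[OF ran ran] flux_lin_right[OF v ran ran] by (simp add: algebra_simps)
  next
    fix p assume p: "p \<in> poly_space l" and "B p p = 0"
    moreover have "cell_inner T (gradient p) (gradient p) \<ge> 0" by (rule cell_inner_nonneg)
    moreover have "cell_inner T p (\<lambda>x. 1) * cell_inner T p (\<lambda>x. 1) \<ge> 0" by simp
    ultimately have "cell_inner T (gradient p) (gradient p) = 0"
        "cell_inner T p (\<lambda>x. 1) * cell_inner T p (\<lambda>x. 1) = 0"
      unfolding B_def by linarith+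
    moreover from cell_inner_gradient_definite[OF p this(1)] obtain c where "p = (\<lambda>x. c)" by blast
    ultimately show "L p = 0" by (simp add: L_def flux_const)
  next
    show "B p q = B q p" for p q unfolding B_def using cell_inner_commute by (metis mult.commute)
  next
    show "B p p \<ge> 0" for p unfolding B_def by (simp add: cell_inner_nonneg)
  qed
  then obtain r where r: "r \<in> poly_space l" "\<And>w. w \<in> poly_space l \<Longrightarrow> B r w = L w" by blast
  \<comment> \<open>Testing the merged equation with 1 removes the gradient and flux terms and
    leaves the mean condition. With it, the mean terms cancel for every other test function.\<close>
  have "cell_inner T (gradient r) (gradient (\<lambda>x. 1)) = 0"
    by (rule cell_inner_zero) (simp add: gradient_const)
  then have mean_r: "cell_inner T r (\<lambda>x. 1) = cell_inner T (fst v) (\<lambda>x. 1)"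
    using r(2)[OF poly_space_const[of 1]] cell_inner_one unfolding B_def L_def flux_const by simp
  then have "cell_inner T (gradient r) (gradient w) = flux v w" if "w \<in> poly_space l" for w
    using r(2)[OF that] unfolding B_def L_def by simp
  with r(1) mean_r
  show "\<exists>r. r \<in> poly_space l \<and> (\<forall>w\<in>poly_space l. cell_inner T (gradient r) (gradient w) = flux v w) \<and>
      cell_inner T r (\<lambda>x. 1) = cell_inner T (fst v) (\<lambda>x. 1)" by blast
next
  fix p q
  assume p: "p \<in> poly_space l \<and> (\<forall>w\<in>poly_space l. cell_inner T (gradient p) (gradient w) = flux v w) \<and>
      cell_inner T p (\<lambda>x. 1) = cell_inner T (fst v) (\<lambda>x. 1)"
    and q: "q \<in> poly_space l \<and> (\<forall>w\<in>poly_space l. cell_inner T (gradient q) (gradient w) = flux v w) \<and>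
      cell_inner T q (\<lambda>x. 1) = cell_inner T (fst v) (\<lambda>x. 1)"
  note pl = conjunct1[OF p] and ql = conjunct1[OF q]
  define d where "d = (\<lambda>x. p x + (-1) * q x)"
  have d: "d \<in> poly_space l" unfolding d_def by (rule poly_space_lin[OF pl ql])
  have "cell_inner T (gradient d) (gradient d) =
      cell_inner T (gradient p) (gradient d) + (-1) * cell_inner T (gradient q) (gradient d)"
    by (intro cell_inner_lin_on continuous_on_gradient[OF pl] continuous_on_gradient[OF ql]
        continuous_on_gradient[OF d]) (unfold d_def, rule gradient_lin[OF pl ql])
  also have "\<dots> = 0" using p q d by simp
  \<comment> \<open>Two solutions differ by a constant, and this constant has mean zero.\<close>
  finally obtain c where c: "d = (\<lambda>x. c)" by (rule cell_inner_gradient_definite[OF d]) blast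
  have "cell_inner T d (\<lambda>x. 1) = cell_inner T p (\<lambda>x. 1) + (-1) * cell_inner T q (\<lambda>x. 1)"
    by (intro cell_inner_lin_on continuous_on_poly_space[OF pl] continuous_on_poly_space[OF ql]
        continuous_on_const) (simp add: d_def)
  also have "\<dots> = 0" using p q by simp
  finally have "c = 0" unfolding c cell_inner_const[of c] using cell_inner_one by simp
  then have "p x - q x = 0" for x using fun_cong[OF c, of x] by (simp add: d_def)
  then show "p = q" by (intro ext) simp
qed

lemma
  assumes v: "valid_dofs k v"
  shows reconstruction_in: "reconstruction l \<F> T v \<in> poly_space l"
    and reconstruction_gradient: "\<And>w. w \<in> poly_space l \<Longrightarrow>
      cell_inner T (gradient (reconstruction l \<F> T v)) (gradient w) = flux v w"
    and reconstruction_mean: "cell_inner T (reconstruction l \<F> T v) (\<lambda>x. 1) = cell_inner T (fst v) (\<lambda>x. 1)"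
  using theI'[OF reconstruction_ex1[OF assms, of l]] unfolding reconstruction_def flux_def by auto

lemma comb_dofs_valid_mean:
  assumes u: "valid_dofs k u" and v: "valid_dofs k v" and s: "comb_dofs u t v s"
  shows "cell_inner T (fst s) (\<lambda>x. 1) = cell_inner T (fst u) (\<lambda>x. 1) + t * cell_inner T (fst v) (\<lambda>x. 1)"
proof -
  have p: "fst u \<in> poly_space k" "fst v \<in> poly_space k" using u v by (auto simp: valid_dofs_def)
  show ?thesis
    by (intro cell_inner_lin_on continuous_on_poly_space[OF p(1)] continuous_on_poly_space[OF p(2)]
        continuous_on_const) (use s in \<open>simp add: comb_dofs_def\<close>)
qed

text \<open>The combination of the reconstructions satisfies the equations that characterize the
  reconstruction of the combination.\<close>

lemma reconstruction_lin:
  assumes u: "valid_dofs k u" and v: "valid_dofs k v" and s: "valid_dofs k s" "comb_dofs u t v s"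
  shows "reconstruction l \<F> T s = (\<lambda>x. reconstruction l \<F> T u x + t * reconstruction l \<F> T v x)"
proof -
  let ?r = "reconstruction l \<F> T"
  note ru = reconstruction_in[OF u, of l] and rv = reconstruction_in[OF v, of l]
  have "(\<lambda>x. ?r u x + t * ?r v x) \<in> poly_space l" by (rule poly_space_lin[OF ru rv])
  moreover have "cell_inner T (gradient (\<lambda>x. ?r u x + t * ?r v x)) (gradient w) = flux s w"
    if w: "w \<in> poly_space l" for w
  proof -
    have "cell_inner T (gradient (\<lambda>x. ?r u x + t * ?r v x)) (gradient w) =
        cell_inner T (gradient (?r u)) (gradient w) + t * cell_inner T (gradient (?r v)) (gradient w)"
      by (intro cell_inner_lin_on continuous_on_gradient[OF ru] continuous_on_gradient[OF rv]
          continuous_on_gradient[OF w] gradient_lin[OF ru rv])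
    then show ?thesis
      by (simp add: reconstruction_gradient[OF u w] reconstruction_gradient[OF v w]
          flux_lin_left[OF u v s(2) w])
  qed
  moreover have "cell_inner T (\<lambda>x. ?r u x + t * ?r v x) (\<lambda>x. 1) = cell_inner T (fst s) (\<lambda>x. 1)"
  proof -
    have "cell_inner T (\<lambda>x. ?r u x + t * ?r v x) (\<lambda>x. 1) =
        cell_inner T (?r u) (\<lambda>x. 1) + t * cell_inner T (?r v) (\<lambda>x. 1)"
      by (intro cell_inner_lin_on continuous_on_poly_space[OF ru] continuous_on_poly_space[OF rv]
          continuous_on_const) simp
    then show ?thesis
      by (simp add: reconstruction_mean[OF u] reconstruction_mean[OF v] comb_dofs_valid_mean[OF u v s(2)])
  qed
  ultimately show ?thesis
    unfolding reconstruction_def flux_def[symmetric] using the1_equality[OF reconstruction_ex1[OF s(1), of l]]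
    by (metis (no_types, lifting))
qed

end

section \<open>The local bilinear form\<close>

definition local_form ::
    "nat \<Rightarrow> 'a::euclidean_space set set \<Rightarrow> 'a set \<Rightarrow> 'a local_dofs \<Rightarrow> 'a local_dofs \<Rightarrow> real" where
  "local_form k \<F> T u v =
     cell_inner T (gradient (reconstruction (k + 1) \<F> T u)) (gradient (reconstruction (k + 1) \<F> T v)) +
     stabilization k \<F> T u v"

lemma local_form_commute: "local_form k \<F> T u v = local_form k \<F> T v u"
  unfolding local_form_def stabilization_def
  by (intro arg_cong2[where f = "(+)"] arg_cong2[where f = "(*)"] sum.cong refl
      cell_inner_commute face_inner_commute)

lemma stabilization_nonneg: "diameter T \<ge> 0 \<Longrightarrow> stabilization k \<F> T u u \<ge> 0"
  unfolding stabilization_def by (intro mult_nonneg_nonneg sum_nonneg face_inner_nonneg) simp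

context mesh_cell
begin

text \<open>The weight \<open>1 / diameter T\<close> must be positive, for the sign of the
  stabilization and to conclude from its vanishing that each face term vanishes.\<close>

lemma diameter_pos: "diameter T > 0"
proof -
  obtain x r where x: "r > 0" "ball x r \<subseteq> T"
    using open_cell nonempty_cell by (meson ex_in_conv open_contains_ball)
  obtain b :: 'a where b: "b \<in> Basis" using nonempty_Basis by blast
  have "dist x (x + (r / 2) *\<^sub>R b) = r / 2" using b x(1) by (simp add: dist_norm)
  moreover from this have "x \<in> T" "x + (r / 2) *\<^sub>R b \<in> T" using x by auto
  ultimately have "r / 2 \<le> diameter T" using diameter_bounded_bound[OF bounded_cell] by metis
  then show ?thesis using x(1) by simp
qed

lemma local_form_nonneg: "local_form k \<F> T u u \<ge> 0"
  unfolding local_form_def using diameter_pos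
  by (intro add_nonneg_nonneg cell_inner_nonneg stabilization_nonneg) simp

text \<open>Differences are written as \<open>p + (-1) * q\<close>, the shape of the linearity lemmas.\<close>

definition face_residual :: "nat \<Rightarrow> 'a set \<Rightarrow> 'a local_dofs \<Rightarrow> 'a \<Rightarrow> real" where
  "face_residual k F v x = (snd v F x - fst v x) + (-1) *
     (reconstruction (k + 1) \<F> T v x + (-1) * cell_proj k T (reconstruction (k + 1) \<F> T v) x)"

lemma face_diff_eq: "face_diff k \<F> T F v = face_proj k F (face_residual k F v)"
proof -
  have "face_residual k F v = (\<lambda>x. snd v F x - fst v x -
      (reconstruction (k + 1) \<F> T v x - cell_proj k T (reconstruction (k + 1) \<F> T v) x))"
    by (rule ext) (simp add: face_residual_def)
  then show ?thesis by (simp only: face_diff_def Let_def)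
qed

lemma high_order_part_continuous:
  assumes "valid_dofs k v"
  shows "continuous_on UNIV (\<lambda>x. reconstruction (k + 1) \<F> T v x +
    (-1) * cell_proj k T (reconstruction (k + 1) \<F> T v) x)"
proof -
  have "continuous_on UNIV (reconstruction (k + 1) \<F> T v)"
    by (rule continuous_on_poly_space[OF reconstruction_in[OF assms]])
  moreover from this have "continuous_on UNIV (cell_proj k T (reconstruction (k + 1) \<F> T v))"
    by (rule continuous_on_poly_space[OF cell_proj_in])
  ultimately show ?thesis by (intro continuous_intros)
qed

lemma face_residual_bounded_borel:
  assumes "valid_dofs k v" "F \<in> cell_faces \<F> T"
  shows "bounded_borel_on F (face_residual k F v)"
  using bounded_borel_on_lin[OF valid_dofs_jump[OF assms]
      face_bounded_borel[OF assms(2) high_order_part_continuous[OF assms(1)]], of "-1"]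
  by (simp only: face_residual_def[abs_def] real_scaleR_def)

lemma face_diff_lin:
  assumes u: "valid_dofs k u" and v: "valid_dofs k v" and s: "valid_dofs k s" "comb_dofs u t v s"
    and F: "F \<in> cell_faces \<F> T"
  shows "face_diff k \<F> T F s = (\<lambda>x\<in>F. face_diff k \<F> T F u x + t * face_diff k \<F> T F v x)"
  unfolding face_diff_eq
proof (rule face_proj_lin_on[OF flat_cell_faces[OF F]])
  show "bounded_borel_on F (face_residual k F u)" by (rule face_residual_bounded_borel[OF u F])
  show "bounded_borel_on F (face_residual k F v)" by (rule face_residual_bounded_borel[OF v F])
  fix x assume x: "x \<in> F"
  let ?r = "reconstruction (k + 1) \<F> T"
  have "?r s = (\<lambda>x. ?r u x + t * ?r v x)" by (rule reconstruction_lin[OF u v s])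
  moreover have "cell_proj k T (\<lambda>x. ?r u x + t * ?r v x) = (\<lambda>x. cell_proj k T (?r u) x + t * cell_proj k T (?r v) x)"
    by (intro cell_proj_lin continuous_on_poly_space[OF reconstruction_in[OF u]]
        continuous_on_poly_space[OF reconstruction_in[OF v]])
  moreover have "snd s F x - fst s x = (snd u F x - fst u x) + t * (snd v F x - fst v x)"
    using s(2) F x by (simp add: comb_dofs_def algebra_simps)
  ultimately show "face_residual k F s x = face_residual k F u x + t * face_residual k F v x"
    unfolding face_residual_def by (simp add: algebra_simps)
qed

lemma face_diff_in:
  assumes "valid_dofs k v" "F \<in> cell_faces \<F> T"
  shows "face_diff k \<F> T F v \<in> face_poly_space k F"
  unfolding face_diff_eq
  by (rule face_proj_in[OF flat_cell_faces[OF assms(2)] face_residual_bounded_borel[OF assms]])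

lemma local_form_lin:
  assumes u: "valid_dofs k u" and v: "valid_dofs k v" and s: "valid_dofs k s" "comb_dofs u t v s"
    and w: "valid_dofs k w"
  shows "local_form k \<F> T s w = local_form k \<F> T u w + t * local_form k \<F> T v w"
proof -
  let ?r = "reconstruction (k + 1) \<F> T"
  note ru = reconstruction_in[OF u, of "k + 1"] and rv = reconstruction_in[OF v, of "k + 1"]
    and rw = reconstruction_in[OF w, of "k + 1"]
  have "cell_inner T (gradient (?r s)) (gradient (?r w)) =
      cell_inner T (gradient (?r u)) (gradient (?r w)) + t * cell_inner T (gradient (?r v)) (gradient (?r w))"
    unfolding reconstruction_lin[OF u v s]
    by (intro cell_inner_lin_on continuous_on_gradient[OF ru] continuous_on_gradient[OF rv]
        continuous_on_gradient[OF rw] gradient_lin[OF ru rv])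
  moreover have "face_inner F (face_diff k \<F> T F s) (face_diff k \<F> T F w) =
      face_inner F (face_diff k \<F> T F u) (face_diff k \<F> T F w) +
      t * face_inner F (face_diff k \<F> T F v) (face_diff k \<F> T F w)"
    if F: "F \<in> cell_faces \<F> T" for F
    using face_diff_in[OF u F] face_diff_in[OF v F] face_diff_in[OF w F]
    by (intro face_inner_lin_on face_poly_space_bounded_borel flat_cell_faces[OF F])
       (simp_all add: face_diff_lin[OF u v s F])
  ultimately show ?thesis
    unfolding local_form_def stabilization_def
    by (simp add: sum.distrib sum_distrib_left algebra_simps)
qed

text \<open>The reconstruction of \<open>v\<close> is constant and hence equal to its projection, so that the
  stabilization only sees \<open>v\<^sub>F - v\<^sub>T\<close>.  This vanishes on all faces, and testing the definition of the
  reconstruction with \<open>v\<^sub>T\<close> itself leaves \<open>\<nabla>v\<^sub>T = 0\<close>.\<close>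

lemma local_form_definite:
  assumes v: "valid_dofs k v" and zero: "local_form k \<F> T v v = 0"
  obtains c where "fst v = (\<lambda>x. c)" "\<And>F x. F \<in> cell_faces \<F> T \<Longrightarrow> x \<in> F \<Longrightarrow> snd v F x = c"
proof -
  let ?r = "reconstruction (k + 1) \<F> T v"
  note r = reconstruction_in[OF v, of "k + 1"]
  have v1: "fst v \<in> poly_space k" using v by (simp add: valid_dofs_def)
  have "cell_inner T (gradient ?r) (gradient ?r) \<ge> 0" "stabilization k \<F> T v v \<ge> 0"
    using diameter_pos by (simp_all add: cell_inner_nonneg stabilization_nonneg)
  with zero have grad0: "cell_inner T (gradient ?r) (gradient ?r) = 0" and stab0: "stabilization k \<F> T v v = 0"
    unfolding local_form_def by linarith+
  obtain c' where c': "?r = (\<lambda>x. c')" by (rule cell_inner_gradient_definite[OF r grad0])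
  have proj: "cell_proj k T (\<lambda>x. c') = (\<lambda>x. c')"
    by (rule cell_proj_eqI) (simp_all add: poly_space_const)
  have "(\<Sum>F\<in>cell_faces \<F> T. face_inner F (face_diff k \<F> T F v) (face_diff k \<F> T F v)) = 0"
    using stab0 diameter_pos by (simp add: stabilization_def)
  then have diff0: "face_inner F (face_diff k \<F> T F v) (face_diff k \<F> T F v) = 0" if "F \<in> cell_faces \<F> T" for F
    using that finite_cell_faces by (simp add: sum_nonneg_eq_0_iff face_inner_nonneg)
  have trace: "snd v F x = fst v x" if F: "F \<in> cell_faces \<F> T" and x: "x \<in> F" for F x
  proof -
    \<comment> \<open>On \<open>F\<close> the residual is already a face polynomial of degree at
      most \<open>k\<close>, so the projection in \<open>face_diff\<close> leaves it
      unchanged.\<close>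
    have q: "(\<lambda>x\<in>F. snd v F x + (-1) * restrict (fst v) F x) \<in> face_poly_space k F"
    proof (rule face_poly_space_lin)
      show "snd v F \<in> face_poly_space k F" using v F by (simp add: valid_dofs_def)
      show "restrict (fst v) F \<in> face_poly_space k F" unfolding face_poly_space_def using v1 by (rule imageI)
    qed
    have "face_diff k \<F> T F v = (\<lambda>x\<in>F. snd v F x + (-1) * restrict (fst v) F x)"
      unfolding face_diff_eq
      by (rule face_proj_poly[OF flat_cell_faces[OF F] q]) (unfold face_residual_def c' proj, simp)
    moreover have "face_diff k \<F> T F v x = 0"
      by (rule face_poly_space_definite[OF flat_cell_faces[OF F] face_diff_in[OF v F] diff0[OF F] x])
    ultimately show ?thesis using x by simp
  qed
  have "flux v (fst v) = cell_inner T (gradient ?r) (gradient (fst v))"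
    using reconstruction_gradient[OF v, of "fst v" "k + 1"] v1 poly_space_mono[of k "k + 1"] by auto
  also have "\<dots> = cell_inner T (gradient (fst v)) (gradient ?r)" by (rule cell_inner_commute)
  also have "\<dots> = 0" by (rule cell_inner_zero) (unfold c' gradient_const, rule refl)
  finally have "flux v (fst v) = 0" .
  moreover have "face_inner F (\<lambda>x. snd v F x - fst v x) u = 0" if "F \<in> cell_faces \<F> T" for F u
    using trace[OF that] by (subst face_inner_commute) (simp add: face_inner_zero)
  ultimately have "cell_inner T (gradient (fst v)) (gradient (fst v)) = 0"
    by (simp add: flux_def)
  then obtain c where c: "fst v = (\<lambda>x. c)" by (rule cell_inner_gradient_definite[OF v1])
  moreover have "snd v F x = c" if "F \<in> cell_faces \<F> T" "x \<in> F" for F x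
    using trace[OF that] c by simp
  ultimately show thesis by (rule that)
qed

end

section \<open>Connectedness of the mesh through faces\<close>

lemma polytopal_set_bounded: "polytopal_set X \<Longrightarrow> bounded X"
  unfolding polytopal_set_def
  by (metis bounded_Union bounded_subset interior_subset polytope_imp_bounded)

text \<open>Being the interior of a closed set, a polytopal set is regular open. For the domain this
  excludes slits, across which a boundary face could have cells on both sides.\<close>

lemma polytopal_set_interior_closure:
  assumes "polytopal_set X"
  shows "interior (closure X) = X"
proof -
  obtain \<P> where "finite \<P>" "\<forall>P\<in>\<P>. polytope P" and X: "X = interior (\<Union>\<P>)"
    using assms by (auto simp: polytopal_set_def)
  then have "closed (\<Union>\<P>)" by (intro closed_Union) (auto intro: polytope_imp_closed)
  then have "closure X \<subseteq> \<Union>\<P>" using X by (simp add: closure_minimal interior_subset)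
  then have "interior (closure X) \<subseteq> X" unfolding X by (rule interior_mono)
  moreover have "X \<subseteq> interior (closure X)"
    using X by (intro interior_maximal closure_subset) simp
  ultimately show ?thesis by blast
qed

text \<open>If the segment meets two of the hyperplanes at the same point, then \<open>q\<close>
  lies on the hyperplane of their pencil that passes through \<open>p\<close>; this is the equation
  \<open>n i \<bullet> q = \<beta> i\<close>. For \<open>n i \<noteq> 0\<close> it describes a null
  set, and finitely many null sets cannot cover \<open>W\<close>.\<close>

lemma generic_segment:
  fixes \<A> :: "('a::euclidean_space \<times> real) set"
  assumes "finite \<A>" and p: "\<And>a b. (a, b) \<in> \<A> \<Longrightarrow> a \<bullet> p \<noteq> b" and W: "open W" "W \<noteq> {}"
  shows "\<exists>q\<in>W. \<forall>a b a' b' x. (a, b) \<in> \<A> \<longrightarrow> (a', b') \<in> \<A> \<longrightarrow> x \<in> closed_segment p q \<longrightarrow>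
       a \<bullet> x = b \<longrightarrow> a' \<bullet> x = b' \<longrightarrow> {x. a \<bullet> x = b} = {x. a' \<bullet> x = b'}"
proof -
  define n where "n = (\<lambda>((a, b), (a', b')). (a' \<bullet> p - b') *\<^sub>R a - (a \<bullet> p - b) *\<^sub>R a')"
  define \<beta> where "\<beta> = (\<lambda>((a, b), (a', b')). (a' \<bullet> p - b') * b - (a \<bullet> p - b) * b')"
  define I where "I = {i \<in> \<A> \<times> \<A>. n i \<noteq> 0}"
  have "finite I" unfolding I_def using \<open>finite \<A>\<close> by simp
  then have "negligible (\<Union>i\<in>I. {q. n i \<bullet> q = \<beta> i})"
    by (intro negligible_Union finite_imageI) (auto simp: I_def intro: negligible_hyperplane)
  then have "\<not> W \<subseteq> (\<Union>i\<in>I. {q. n i \<bullet> q = \<beta> i})"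
    using open_not_negligible[OF W] negligible_subset by blast
  then obtain q where q: "q \<in> W" "\<And>i. i \<in> I \<Longrightarrow> n i \<bullet> q \<noteq> \<beta> i" by blast
  show ?thesis
  proof (intro bexI[OF _ q(1)] allI impI)
    fix a b a' b' x
    assume A: "(a, b) \<in> \<A>" "(a', b') \<in> \<A>" and x: "x \<in> closed_segment p q" "a \<bullet> x = b" "a' \<bullet> x = b'"
    obtain t where t: "x = (1 - t) *\<^sub>R p + t *\<^sub>R q" using x(1) by (auto simp: in_segment)
    define \<mu> \<mu>' where "\<mu> = a \<bullet> p - b" and "\<mu>' = a' \<bullet> p - b'"
    have \<mu>: "\<mu> \<noteq> 0" "\<mu>' \<noteq> 0" using p A by (auto simp: \<mu>_def \<mu>'_def)
    have "t \<noteq> 0" using t x(2) p[OF A(1)] by auto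
    have e1: "t * (a \<bullet> q - b) = - (1 - t) * \<mu>"
      using x(2) unfolding t \<mu>_def by (simp add: inner_add_right algebra_simps)
    have e2: "t * (a' \<bullet> q - b') = - (1 - t) * \<mu>'"
      using x(3) unfolding t \<mu>'_def by (simp add: inner_add_right algebra_simps)
    \<comment> \<open>Eliminating \<open>1 - t\<close> from \<open>e1\<close> and \<open>e2\<close>
      puts \<open>q\<close> on the pencil hyperplane; \<open>t \<noteq> 0\<close> since
      \<open>p\<close> avoids the hyperplanes.\<close>
    have "t * (\<mu>' * (a \<bullet> q - b) - \<mu> * (a' \<bullet> q - b')) =
        \<mu>' * (t * (a \<bullet> q - b)) - \<mu> * (t * (a' \<bullet> q - b'))"
      by (simp add: algebra_simps)
    also have "\<dots> = 0" unfolding e1 e2 by (simp add: algebra_simps)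
    finally have cross: "\<mu>' * (a \<bullet> q - b) - \<mu> * (a' \<bullet> q - b') = 0" using \<open>t \<noteq> 0\<close> by simp
    have n_eq: "n ((a, b), (a', b')) = \<mu>' *\<^sub>R a - \<mu> *\<^sub>R a'"
      by (simp add: n_def \<mu>_def \<mu>'_def)
    have \<beta>_eq: "\<beta> ((a, b), (a', b')) = \<mu>' * b - \<mu> * b'" by (simp add: \<beta>_def \<mu>_def \<mu>'_def)
    have "n ((a, b), (a', b')) \<bullet> q = \<beta> ((a, b), (a', b'))"
      unfolding n_eq \<beta>_eq using cross by (simp add: inner_diff_left algebra_simps)
    then have "((a, b), (a', b')) \<notin> I" using q(2) by blast
    then have "n ((a, b), (a', b')) = 0" using A by (simp add: I_def)
    \<comment> \<open>The normals are parallel, and the common point \<open>x\<close> makes the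
      offsets match.\<close>
    then have par: "\<mu>' *\<^sub>R a = \<mu> *\<^sub>R a'" by (simp add: n_eq)
    have b: "\<mu>' * b = \<mu> * b'" using arg_cong[OF par, of "\<lambda>v. v \<bullet> x"] x by simp
    have "a \<bullet> y = b \<longleftrightarrow> a' \<bullet> y = b'" for y
    proof -
      have "a \<bullet> y = b \<longleftrightarrow> \<mu>' * (a \<bullet> y) = \<mu>' * b" using \<mu> by simp
      also have "\<dots> \<longleftrightarrow> \<mu> * (a' \<bullet> y) = \<mu> * b'"
        using arg_cong[OF par, of "\<lambda>v. v \<bullet> y"] b by simp
      also have "\<dots> \<longleftrightarrow> a' \<bullet> y = b'" using \<mu> by simp
      finally show ?thesis .
    qed
    then show "{x. a \<bullet> x = b} = {x. a' \<bullet> x = b'}" by simp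
  qed
qed

lemma frontier_open: "open T \<Longrightarrow> frontier T = closure T - T"
  by (simp add: frontier_def interior_open)

lemma connected_open_dichotomy:
  assumes "connected Q" "open Q" "open T" "Q \<inter> frontier T = {}"
  shows "Q \<subseteq> T \<or> Q \<inter> closure T = {}"
  using assms connected_Int_frontier[of Q T] open_Int_closure_eq_empty[of Q T] by blast

text \<open>Let \<open>D\<close> be the union of the closed cells with a given value \<open>c T\<^sub>0 \<noteq> 0\<close>.  A generic segment
  that leaves \<open>D\<close> does so at a point \<open>x\<close> of a single face hyperplane.  Near \<open>x\<close>, each side of this
  hyperplane is contained in one cell or outside the domain, so the face at \<open>x\<close> separates a cell
  with value \<open>c T\<^sub>0\<close> from one with another value or from the exterior.\<close>

lemma mesh_constants_zero:
  fixes \<Omega> :: "'a::euclidean_space set" and c :: "'a set \<Rightarrow> real"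
  assumes mesh: "polytopal_mesh \<Omega> \<T> \<F> h" and \<Omega>: "open \<Omega>" "bounded \<Omega>" "polytopal_set \<Omega>"
    and trace: "\<And>T F x. T \<in> \<T> \<Longrightarrow> F \<in> cell_faces \<F> T \<Longrightarrow> x \<in> F \<Longrightarrow> g F x = c T"
    and bdry: "\<And>F x. F \<in> boundary_faces \<Omega> \<T> \<F> \<Longrightarrow> x \<in> F \<Longrightarrow> g F x = 0"
    and T\<^sub>0: "T\<^sub>0 \<in> \<T>"
  shows "c T\<^sub>0 = 0"
proof (rule ccontr)
  assume c0: "c T\<^sub>0 \<noteq> 0"
  have fin: "finite \<T>" "finite \<F>" and disj: "disjoint \<T>"
    and cells: "\<And>T. T \<in> \<T> \<Longrightarrow> T \<noteq> {} \<and> open T"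
    and cover: "closure \<Omega> = (\<Union>T\<in>\<T>. closure T)"
    and skeleton: "(\<Union>T\<in>\<T>. frontier T) = (\<Union>F\<in>\<F>. closure F)"
    and kinds: "\<F> = internal_faces \<T> \<F> \<union> boundary_faces \<Omega> \<T> \<F>"
    and planes: "\<forall>F\<in>\<F>. \<exists>ab. fst ab \<noteq> 0 \<and> openin (top_of_set {x. fst ab \<bullet> x = snd ab}) F"
    using mesh unfolding polytopal_mesh_def by auto
  obtain ab :: "'a set \<Rightarrow> 'a \<times> real" where ab: "\<And>F. F \<in> \<F> \<Longrightarrow> fst (ab F) \<noteq> 0"
      "\<And>F. F \<in> \<F> \<Longrightarrow> openin (top_of_set {x. fst (ab F) \<bullet> x = snd (ab F)}) F"
    using bchoice[OF planes] by blast
  define H where "H F = {x. fst (ab F) \<bullet> x = snd (ab F)}" for F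
  have H_closed: "closed (H F)" for F unfolding H_def by (rule closed_hyperplane)
  have H_negl: "negligible (H F)" if "F \<in> \<F>" for F
    unfolding H_def using ab(1)[OF that] by (intro negligible_hyperplane) simp
  have F_H: "closure F \<subseteq> H F" if "F \<in> \<F>" for F
    using ab(2)[OF that] H_closed[of F] by (intro closure_minimal) (auto simp: H_def openin_open)
  have fr_H: "frontier T \<subseteq> (\<Union>F\<in>\<F>. H F)" if "T \<in> \<T>" for T using that skeleton F_H by blast
  define A where "A = {T \<in> \<T>. c T = c T\<^sub>0}"
  define D where "D = (\<Union>T\<in>A. closure T)"
  have "finite A" "A \<subseteq> \<T>" using fin by (auto simp: A_def)
  have "closed D" unfolding D_def using \<open>finite A\<close> by (intro closed_UN) auto
  have "D \<subseteq> closure \<Omega>" unfolding D_def cover using \<open>A \<subseteq> \<T>\<close> by blast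
  then have "bounded D" using \<Omega>(2) bounded_subset by blast
  then have "D \<noteq> UNIV" using not_bounded_UNIV by metis
  then have "open (- D)" "- D \<noteq> {}" using \<open>closed D\<close> by auto
  have A_int: "T \<subseteq> interior D" if "T \<in> A" for T
    using that cells \<open>A \<subseteq> \<T>\<close> closure_subset unfolding D_def by (intro interior_maximal) blast+
  \<comment> \<open>The start of the segment must avoid all face hyperplanes, as
    \<open>generic_segment\<close> requires; an open cell has room for it because hyperplanes are
    null sets.\<close>
  have "negligible (\<Union>F\<in>\<F>. H F)" using fin H_negl by (intro negligible_Union) auto
  then have "\<not> T\<^sub>0 \<subseteq> (\<Union>F\<in>\<F>. H F)"
    using open_not_negligible cells[OF T\<^sub>0] negligible_subset by blast
  then obtain p where p: "p \<in> T\<^sub>0" "\<And>F. F \<in> \<F> \<Longrightarrow> p \<notin> H F" by blast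
  have fin_ab: "finite (ab ` \<F>)" using fin by simp
  have off: "a \<bullet> p \<noteq> b" if "(a, b) \<in> ab ` \<F>" for a b
    using that p(2) unfolding H_def by (metis (mono_tags, lifting) fst_conv imageE mem_Collect_eq snd_conv)
  obtain q where q: "q \<in> - D"
    and gen: "\<forall>a b a' b' x. (a, b) \<in> ab ` \<F> \<longrightarrow> (a', b') \<in> ab ` \<F> \<longrightarrow> x \<in> closed_segment p q \<longrightarrow>
       a \<bullet> x = b \<longrightarrow> a' \<bullet> x = b' \<longrightarrow> {x. a \<bullet> x = b} = {x. a' \<bullet> x = b'}"
    using generic_segment[OF fin_ab off \<open>open (- D)\<close> \<open>- D \<noteq> {}\<close>] by blast
  have gen': "H F = H G" if "F \<in> \<F>" "G \<in> \<F>" "x \<in> closed_segment p q" "x \<in> H F" "x \<in> H G" for F G x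
    using gen[rule_format, of "fst (ab F)" "snd (ab F)" "fst (ab G)" "snd (ab G)" x] that by (simp add: H_def)
  have "p \<in> D" using p(1) T\<^sub>0 closure_subset unfolding D_def A_def by blast
  then have "closed_segment p q \<inter> frontier D \<noteq> {}"
    using q by (intro connected_Int_frontier) auto
  then obtain x where x: "x \<in> closed_segment p q" "x \<in> D" "x \<notin> interior D"
    using \<open>closed D\<close> by (auto simp: frontier_def)
  obtain T where T: "T \<in> A" "x \<in> closure T" using x(2) unfolding D_def by blast
  have "T \<in> \<T>" "open T" using T(1) cells \<open>A \<subseteq> \<T>\<close> by auto
  have "x \<in> frontier T" using T A_int[OF T(1)] x(3) frontier_open[OF \<open>open T\<close>] by blast
  then obtain F where F: "F \<in> \<F>" "x \<in> closure F" using skeleton \<open>T \<in> \<T>\<close> by blast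
  then have "x \<in> H F" using F_H by blast
  \<comment> \<open>The complement of all face hyperplanes other than that of \<open>F\<close>.
    Genericity puts the exit point \<open>x\<close> into it, so \<open>H F\<close> is the only face
    hyperplane that meets a small ball around \<open>x\<close>.\<close>
  define O' where "O' = - (\<Union>G\<in>{G\<in>\<F>. H G \<noteq> H F}. H G)"
  have "open O'" unfolding O'_def using fin H_closed by (intro open_Compl closed_UN) auto
  moreover have "x \<in> O'" unfolding O'_def using gen'[OF _ F(1) x(1) _ \<open>x \<in> H F\<close>] by blast
  ultimately obtain r where r: "r > 0" "ball x r \<subseteq> O'" using open_contains_ball by blast
  define a b where "a = fst (ab F)" and "b = snd (ab F)"
  have a: "a \<noteq> 0" using ab(1)[OF F(1)] by (simp add: a_def)
  have HF: "H F = {y. a \<bullet> y = b}" by (simp add: H_def a_def b_def)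
  \<comment> \<open>For \<open>s = 1\<close> and \<open>s = -1\<close>, the two open half-balls cut
    out by \<open>H F\<close>. They are connected and meet no face hyperplane, hence no cell
    frontier, so a cell contains such a half or its closure is disjoint from it.\<close>
  define Q where "Q s = ball x r \<inter> {y. (s *\<^sub>R a) \<bullet> y > s * b}" for s :: real
  have Q_open: "open (Q s)" for s unfolding Q_def by (intro open_Int open_ball open_halfspace_gt)
  have Q_conn: "connected (Q s)" for s
    unfolding Q_def by (intro convex_connected convex_Int convex_ball convex_halfspace_gt)
  have Q_dich: "Q s \<subseteq> S \<or> Q s \<inter> closure S = {}" if "S \<in> \<T>" for s S
  proof (rule connected_open_dichotomy[OF Q_conn Q_open])
    show "open S" using cells that by blast
    have "Q s \<inter> H G = {}" if G: "G \<in> \<F>" for G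
    proof (cases "H G = H F")
      case True
      then show ?thesis unfolding Q_def HF by auto
    next
      case False
      then show ?thesis using r(2) G unfolding Q_def O'_def by blast
    qed
    then show "Q s \<inter> frontier S = {}" using fr_H[OF that] by blast
  qed
  \<comment> \<open>\<open>H F\<close> is a null set, so an open set that meets the ball meets one
    of its halves.\<close>
  have Q_dense: "V \<inter> Q 1 \<noteq> {} \<or> V \<inter> Q (-1) \<noteq> {}" if "open V" "V \<inter> ball x r \<noteq> {}" for V
  proof -
    have "\<not> V \<inter> ball x r \<subseteq> H F"
      using open_not_negligible[of "V \<inter> ball x r"] that H_negl[OF F(1)] negligible_subset by blast
    then obtain y where "y \<in> V" "y \<in> ball x r" "a \<bullet> y \<noteq> b" unfolding HF by blast
    then show ?thesis unfolding Q_def by (cases "a \<bullet> y < b") auto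
  qed
  have near: "Q 1 \<noteq> {} \<and> Q 1 \<subseteq> S \<or> Q (-1) \<noteq> {} \<and> Q (-1) \<subseteq> S"
    if S: "S \<in> \<T>" and y: "y \<in> closure S" "y \<in> ball x r" for S y
  proof -
    have "S \<inter> ball x r \<noteq> {}"
      using y open_Int_closure_eq_empty[OF open_ball, of x r S] by blast
    then have "S \<inter> Q 1 \<noteq> {} \<or> S \<inter> Q (-1) \<noteq> {}" using Q_dense[of S] cells[OF S] by blast
    then show ?thesis using Q_dich[OF S, of 1] Q_dich[OF S, of "-1"] closure_subset[of S] by blast
  qed
  have ball_closed: "ball x r \<subseteq> K" if "closed K" "Q 1 \<subseteq> K" "Q (-1) \<subseteq> K" for K
    using Q_dense[of "- K"] that by blast
  have not_both: "\<not> (Q 1 \<subseteq> D \<and> Q (-1) \<subseteq> D)"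
  proof
    assume "Q 1 \<subseteq> D \<and> Q (-1) \<subseteq> D"
    then have "ball x r \<subseteq> interior D"
      using ball_closed[OF \<open>closed D\<close>] by (intro interior_maximal) auto
    moreover have "x \<in> ball x r" using r(1) by simp
    ultimately show False using x(3) by blast
  qed
  have sub_D: "S \<subseteq> D" if "S \<in> A" for S using A_int[OF that] interior_subset by blast
  \<comment> \<open>\<open>s\<close> is a side occupied by \<open>T\<close>. The far side is not
    inside \<open>D\<close>, since otherwise \<open>x\<close> would be interior to
    \<open>D\<close>.\<close>
  obtain s where s: "s = 1 \<or> s = -1" "Q s \<noteq> {}" "Q s \<subseteq> T"
    using near[OF \<open>T \<in> \<T>\<close> T(2)] r(1) by auto
  then have other: "\<not> Q (- s) \<subseteq> D" using not_both sub_D[OF T(1)] by auto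
  have unique: "S = S'" if "S \<in> \<T>" "S' \<in> \<T>" "Q s' \<noteq> {}" "Q s' \<subseteq> S" "Q s' \<subseteq> S'" for S S' s'
    using disj that unfolding disjoint_def by blast
  have "x \<in> ball x r \<inter> closure F" using F(2) r(1) by simp
  \<comment> \<open>\<open>x\<close> is only known to lie in the closure of \<open>F\<close>; values
    on the face are compared at a nearby point \<open>y\<close> of \<open>F\<close>.\<close>
  then obtain y where y: "y \<in> F" "y \<in> ball x r"
    using open_Int_closure_eq_empty[OF open_ball, of x r F] by blast
  have side: "S = T \<or> Q (- s) \<subseteq> S" if S: "S \<in> \<T>" and "F \<subseteq> frontier S" for S
  proof -
    have "y \<in> closure S" using that y by (auto simp: frontier_def)
    then show ?thesis using near[OF S _ y(2)] unique[OF S \<open>T \<in> \<T>\<close>] s by auto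
  qed
  have "F \<in> internal_faces \<T> \<F> \<or> F \<in> boundary_faces \<Omega> \<T> \<F>" using kinds F(1) by blast
  then show False
  proof
    assume "F \<in> internal_faces \<T> \<F>"
    then obtain T1 T2 where T12: "T1 \<in> \<T>" "T2 \<in> \<T>" "T1 \<noteq> T2" "F \<subseteq> frontier T1" "F \<subseteq> frontier T2"
      unfolding internal_faces_def by auto
    have ne: "Q (- s) \<noteq> {}" using other by blast
    \<comment> \<open>By disjointness, at most one of \<open>T1\<close> and \<open>T2\<close> fills
      the far half, so one of them is \<open>T\<close> and the other fills that half. In particular
      \<open>F\<close> lies on the frontier of \<open>T\<close>, of which only \<open>x\<close> was
      known so far.\<close>
    have "\<exists>S\<in>\<T>. F \<subseteq> frontier T \<and> F \<subseteq> frontier S \<and> Q (- s) \<subseteq> S"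
      using side[OF T12(1,4)] side[OF T12(2,5)] unique[OF T12(1,2) ne] T12 by blast
    then obtain S where S: "S \<in> \<T>" "F \<subseteq> frontier T" "F \<subseteq> frontier S" "Q (- s) \<subseteq> S" by blast
    have "g F y = c T" using S(2) F(1) y(1) by (intro trace \<open>T \<in> \<T>\<close>) (simp add: cell_faces_def)
    moreover have "g F y = c S" using S F(1) y(1) by (intro trace) (simp_all add: cell_faces_def)
    ultimately have "S \<in> A" using T(1) S(1) unfolding A_def by simp
    then show False using sub_D S(4) other by blast
  next
    assume bF: "F \<in> boundary_faces \<Omega> \<T> \<F>"
    then obtain S where S: "S \<in> \<T>" "F \<subseteq> frontier S" "F \<subseteq> frontier \<Omega>"
      unfolding boundary_faces_def by auto
    have in_\<Omega>: "S' \<subseteq> closure \<Omega>" if "S' \<in> \<T>" for S' using that cover closure_subset by blast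
    have "y \<notin> \<Omega>" using S(3) y(1) frontier_open[OF \<Omega>(1)] by blast
    \<comment> \<open>With cells on both sides, the ball would lie in the closure of \<Omega>, hence
      in \<Omega> by regular openness, although \<open>y\<close> is on the boundary. So the cell
      adjacent to this boundary face is \<open>T\<close> itself.\<close>
    have "\<not> Q (- s) \<subseteq> S"
    proof
      assume "Q (- s) \<subseteq> S"
      then have "Q 1 \<subseteq> closure \<Omega>" "Q (-1) \<subseteq> closure \<Omega>"
        using s in_\<Omega>[OF S(1)] in_\<Omega>[OF \<open>T \<in> \<T>\<close>] by auto
      then have "ball x r \<subseteq> closure \<Omega>" by (intro ball_closed) auto
      then have "ball x r \<subseteq> \<Omega>"
        using interior_maximal[OF _ open_ball] polytopal_set_interior_closure[OF \<Omega>(3)] by blast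
      then show False using y(2) \<open>y \<notin> \<Omega>\<close> by blast
    qed
    then have "S = T" using side[OF S(1,2)] by blast
    then have "g F y = c T" using S F(1) y(1) by (intro trace \<open>T \<in> \<T>\<close>) (simp add: cell_faces_def)
    then show False using bdry[OF bF y(1)] c0 T(1) unfolding A_def by simp
  qed
qed

section \<open>The global problem\<close>

text \<open>Cells are bounded as polytopal sets, and faces because they lie in the closure of a
  cell.\<close>

lemma mesh_cell_of_mesh:
  assumes mesh: "polytopal_mesh \<Omega> \<T> \<F> h" and T: "T \<in> \<T>"
  shows "mesh_cell T \<F>"
proof
  have TT: "T \<noteq> {}" "open T" "polytopal_set T" and "finite \<F>"
    and faces: "\<And>F. F \<in> \<F> \<Longrightarrow> F \<noteq> {} \<and> (\<exists>a b. a \<noteq> 0 \<and> openin (top_of_set {x. a \<bullet> x = b}) F)"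
    using mesh T unfolding polytopal_mesh_def by auto
  show "open T" "T \<noteq> {}" by fact+
  show bd: "bounded T" using TT(3) by (rule polytopal_set_bounded)
  show "finite (cell_faces \<F> T)" using \<open>finite \<F>\<close> by (simp add: cell_faces_def)
  fix F assume "F \<in> cell_faces \<F> T"
  then have F: "F \<in> \<F>" "F \<subseteq> frontier T" by (auto simp: cell_faces_def)
  then have "F \<subseteq> closure T" by (auto simp: frontier_def)
  then have "bounded F" by (rule bounded_subset[OF bounded_closure[OF bd]])
  then show "flat_face F" using faces[OF F(1)] unfolding flat_face_def by blast
qed

lemma hho_form_eq:
  "hho_form k \<T> \<F> u v =
     (\<Sum>T\<in>\<T>. local_form k \<F> T (local_restriction \<F> T u) (local_restriction \<F> T v))"
  by (simp add: hho_form_def local_form_def Let_def)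

lemma hho_form_commute: "hho_form k \<T> \<F> u v = hho_form k \<T> \<F> v u"
  unfolding hho_form_eq by (intro sum.cong refl local_form_commute)

text \<open>Plain pointwise arithmetic would leave the extensional functions that make up
  \<open>hho_space\<close>; the restrictions put the unspecified values back, also off each
  face.\<close>

definition global_comb ::
    "'a::euclidean_space set set \<Rightarrow> 'a set set \<Rightarrow> 'a global_dofs \<Rightarrow> real \<Rightarrow> 'a global_dofs \<Rightarrow> 'a global_dofs" where
  "global_comb \<T> \<F> u t v =
     (\<lambda>T\<in>\<T>. \<lambda>x. fst u T x + t * fst v T x, \<lambda>F\<in>\<F>. \<lambda>x\<in>F. snd u F x + t * snd v F x)"

definition global_zero :: "'a::euclidean_space set set \<Rightarrow> 'a set set \<Rightarrow> 'a global_dofs" where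
  "global_zero \<T> \<F> = (\<lambda>T\<in>\<T>. \<lambda>x. 0, \<lambda>F\<in>\<F>. \<lambda>x\<in>F. 0)"

lemma hho_space0_iff:
  "v \<in> hho_space0 k \<Omega> \<T> \<F> \<longleftrightarrow>
     fst v \<in> (\<Pi>\<^sub>E T\<in>\<T>. poly_space k) \<and> snd v \<in> (\<Pi>\<^sub>E F\<in>\<F>. face_poly_space k F) \<and>
     (\<forall>F\<in>boundary_faces \<Omega> \<T> \<F>. \<forall>x\<in>F. snd v F x = 0)"
  by (auto simp: hho_space0_def hho_space_def mem_Times_iff)

lemma boundary_faces_subset: "boundary_faces \<Omega> \<T> \<F> \<subseteq> \<F>"
  by (auto simp: boundary_faces_def)

lemma hho_space0_cell: "v \<in> hho_space0 k \<Omega> \<T> \<F> \<Longrightarrow> T \<in> \<T> \<Longrightarrow> fst v T \<in> poly_space k"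
  unfolding hho_space0_iff by auto

lemma hho_space0_face: "v \<in> hho_space0 k \<Omega> \<T> \<F> \<Longrightarrow> F \<in> \<F> \<Longrightarrow> snd v F \<in> face_poly_space k F"
  unfolding hho_space0_iff by auto

lemma global_comb_in:
  assumes u: "u \<in> hho_space0 k \<Omega> \<T> \<F>" and v: "v \<in> hho_space0 k \<Omega> \<T> \<F>"
  shows "global_comb \<T> \<F> u t v \<in> hho_space0 k \<Omega> \<T> \<F>"
  unfolding hho_space0_iff
proof (intro conjI ballI)
  show "fst (global_comb \<T> \<F> u t v) \<in> (\<Pi>\<^sub>E T\<in>\<T>. poly_space k)"
    unfolding global_comb_def fst_conv
    by (intro restrict_PiE_iff[THEN iffD2] ballI poly_space_lin hho_space0_cell[OF u] hho_space0_cell[OF v])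
  show "snd (global_comb \<T> \<F> u t v) \<in> (\<Pi>\<^sub>E F\<in>\<F>. face_poly_space k F)"
    unfolding global_comb_def snd_conv
    by (intro restrict_PiE_iff[THEN iffD2] ballI face_poly_space_lin hho_space0_face[OF u] hho_space0_face[OF v])
  fix F x assume "F \<in> boundary_faces \<Omega> \<T> \<F>" "x \<in> F"
  moreover from this have "F \<in> \<F>" using boundary_faces_subset by blast
  ultimately show "snd (global_comb \<T> \<F> u t v) F x = 0"
    using u v by (simp add: global_comb_def hho_space0_iff)
qed

lemma global_zero_in: "global_zero \<T> \<F> \<in> hho_space0 k \<Omega> \<T> \<F>"
  unfolding hho_space0_iff
proof (intro conjI ballI)
  show "fst (global_zero \<T> \<F>) \<in> (\<Pi>\<^sub>E T\<in>\<T>. poly_space k)"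
    unfolding global_zero_def fst_conv by (intro restrict_PiE_iff[THEN iffD2] ballI poly_space_const)
  show "snd (global_zero \<T> \<F>) \<in> (\<Pi>\<^sub>E F\<in>\<F>. face_poly_space k F)"
    unfolding global_zero_def snd_conv face_poly_space_def
    by (intro restrict_PiE_iff[THEN iffD2] ballI imageI poly_space_const)
  fix F x assume "F \<in> boundary_faces \<Omega> \<T> \<F>" "x \<in> F"
  moreover from this have "F \<in> \<F>" using boundary_faces_subset by blast
  ultimately show "snd (global_zero \<T> \<F>) F x = 0" by (simp add: global_zero_def)
qed

lemma local_restriction_valid:
  assumes mesh: "polytopal_mesh \<Omega> \<T> \<F> h" and T: "T \<in> \<T>" and v: "v \<in> hho_space0 k \<Omega> \<T> \<F>"
  shows "mesh_cell.valid_dofs T \<F> k (local_restriction \<F> T v)"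
proof -
  interpret mesh_cell T \<F> by (rule mesh_cell_of_mesh[OF mesh T])
  have "snd v F \<in> face_poly_space k F" if "F \<in> cell_faces \<F> T" for F
    using that by (intro hho_space0_face[OF v]) (simp add: cell_faces_def)
  then show ?thesis using hho_space0_cell[OF v T] by (simp add: valid_dofs_def local_restriction_def)
qed

lemma local_restriction_comb:
  assumes mesh: "polytopal_mesh \<Omega> \<T> \<F> h" and T: "T \<in> \<T>"
  shows "mesh_cell.comb_dofs T \<F> (local_restriction \<F> T u) t (local_restriction \<F> T v)
    (local_restriction \<F> T (global_comb \<T> \<F> u t v))"
proof -
  interpret mesh_cell T \<F> by (rule mesh_cell_of_mesh[OF mesh T])
  have "F \<in> \<F>" if "F \<in> cell_faces \<F> T" for F using that by (simp add: cell_faces_def)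
  then show ?thesis using T by (simp add: comb_dofs_def local_restriction_def global_comb_def)
qed

lemma hho_form_lin:
  assumes mesh: "polytopal_mesh \<Omega> \<T> \<F> h" and u: "u \<in> hho_space0 k \<Omega> \<T> \<F>"
    and v: "v \<in> hho_space0 k \<Omega> \<T> \<F>" and w: "w \<in> hho_space0 k \<Omega> \<T> \<F>"
  shows "hho_form k \<T> \<F> (global_comb \<T> \<F> u t v) w = hho_form k \<T> \<F> u w + t * hho_form k \<T> \<F> v w"
proof -
  have "local_form k \<F> T (local_restriction \<F> T (global_comb \<T> \<F> u t v)) (local_restriction \<F> T w) =
      local_form k \<F> T (local_restriction \<F> T u) (local_restriction \<F> T w) +
      t * local_form k \<F> T (local_restriction \<F> T v) (local_restriction \<F> T w)" if T: "T \<in> \<T>" for T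
  proof -
    interpret mesh_cell T \<F> by (rule mesh_cell_of_mesh[OF mesh T])
    note valid = local_restriction_valid[OF mesh T]
    show ?thesis
      by (rule local_form_lin[OF valid[OF u] valid[OF v] valid[OF global_comb_in[OF u v]]
            local_restriction_comb[OF mesh T] valid[OF w]])
  qed
  then show ?thesis unfolding hho_form_eq by (simp add: sum.distrib sum_distrib_left)
qed

lemma hho_form_nonneg:
  assumes "polytopal_mesh \<Omega> \<T> \<F> h"
  shows "hho_form k \<T> \<F> v v \<ge> 0"
  unfolding hho_form_eq
  by (intro sum_nonneg mesh_cell.local_form_nonneg mesh_cell_of_mesh[OF assms])

text \<open>All summands are nonnegative, so each local form vanishes and yields a constant per
  cell; \<open>mesh_constants_zero\<close> with \<open>snd v\<close> as \<open>g\<close> makes these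
  zero. The faces follow since each lies on the frontier of some cell.\<close>

lemma hho_form_definite:
  assumes mesh: "polytopal_mesh \<Omega> \<T> \<F> h" and \<Omega>: "open \<Omega>" "bounded \<Omega>" "polytopal_set \<Omega>"
    and v: "v \<in> hho_space0 k \<Omega> \<T> \<F>" and zero: "hho_form k \<T> \<F> v v = 0"
  shows "T \<in> \<T> \<Longrightarrow> fst v T = (\<lambda>x. 0)" and "F \<in> \<F> \<Longrightarrow> x \<in> F \<Longrightarrow> snd v F x = 0"
proof -
  have fin: "finite \<T>" and kinds: "\<F> = internal_faces \<T> \<F> \<union> boundary_faces \<Omega> \<T> \<F>"
    using mesh unfolding polytopal_mesh_def by auto
  have "\<exists>c. fst v T = (\<lambda>x. c) \<and> (\<forall>F\<in>cell_faces \<F> T. \<forall>x\<in>F. snd v F x = c)" if T: "T \<in> \<T>" for T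
  proof -
    interpret mesh_cell T \<F> by (rule mesh_cell_of_mesh[OF mesh T])
    have "local_form k \<F> T (local_restriction \<F> T v) (local_restriction \<F> T v) = 0"
      using zero fin T mesh_cell.local_form_nonneg[OF mesh_cell_of_mesh[OF mesh]]
      by (simp add: hho_form_eq sum_nonneg_eq_0_iff)
    from local_form_definite[OF local_restriction_valid[OF mesh T v] this]
    obtain c where "fst (local_restriction \<F> T v) = (\<lambda>x. c)"
      "\<And>F x. F \<in> cell_faces \<F> T \<Longrightarrow> x \<in> F \<Longrightarrow> snd (local_restriction \<F> T v) F x = c" by blast
    then show ?thesis by (intro exI[of _ c]) (simp add: local_restriction_def)
  qed
  then obtain c where c: "\<And>T. T \<in> \<T> \<Longrightarrow> fst v T = (\<lambda>x. c T)"
    and trace: "\<And>T F x. T \<in> \<T> \<Longrightarrow> F \<in> cell_faces \<F> T \<Longrightarrow> x \<in> F \<Longrightarrow> snd v F x = c T"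
    by metis
  have bdry: "snd v F x = 0" if "F \<in> boundary_faces \<Omega> \<T> \<F>" "x \<in> F" for F x
    using v that by (simp add: hho_space0_iff)
  have c0: "c T = 0" if "T \<in> \<T>" for T
    by (rule mesh_constants_zero[OF mesh \<Omega> trace bdry that])
  show "fst v T = (\<lambda>x. 0)" if "T \<in> \<T>" using c c0 that by simp
  show "snd v F x = 0" if F: "F \<in> \<F>" and x: "x \<in> F"
  proof -
    have "F \<in> internal_faces \<T> \<F> \<or> F \<in> boundary_faces \<Omega> \<T> \<F>" using F kinds by blast
    then obtain T where "T \<in> \<T>" "F \<subseteq> frontier T"
      unfolding internal_faces_def boundary_faces_def by blast
    then show ?thesis using trace[of T F x] c0 F x by (simp add: cell_faces_def)
  qed
qed

text \<open>It delivers the conclusion of \<open>definite\<close> in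
  \<open>nonlocal_problem_ex1\<close>: extensionality turns vanishing on cells and faces into an
  equality of pairs of functions.\<close>

lemma global_comb_eq_zero:
  assumes u: "u \<in> hho_space0 k \<Omega> \<T> \<F>"
    and "\<And>T. T \<in> \<T> \<Longrightarrow> fst (global_comb \<T> \<F> u t v) T = (\<lambda>x. 0)"
    and "\<And>F x. F \<in> \<F> \<Longrightarrow> x \<in> F \<Longrightarrow> snd (global_comb \<T> \<F> u t v) F x = 0"
  shows "u = global_comb \<T> \<F> (global_zero \<T> \<F>) (- t) v"
proof (rule prod_eqI)
  have cell: "fst u T x + t * fst v T x = 0" if "T \<in> \<T>" for T x
    using fun_cong[OF assms(2)[OF that], of x] that by (simp add: global_comb_def)
  have face: "snd u F x + t * snd v F x = 0" if "F \<in> \<F>" "x \<in> F" for F x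
    using assms(3)[OF that] that by (simp add: global_comb_def)
  have "fst u \<in> extensional \<T>" using u by (auto simp: hho_space0_iff PiE_iff)
  then show "fst u = fst (global_comb \<T> \<F> (global_zero \<T> \<F>) (- t) v)"
    using cell by (intro extensionalityI[of _ \<T>])
      (auto simp: global_comb_def global_zero_def fun_eq_iff eq_neg_iff_add_eq_0)
  have "snd u F = (\<lambda>x\<in>F. - t * snd v F x)" if F: "F \<in> \<F>" for F
  proof (rule extensionalityI[of _ F])
    show "snd u F \<in> extensional F"
      using hho_space0_face[OF u F] by (auto simp: face_poly_space_def)
  qed (use face[OF F] in \<open>auto simp: eq_neg_iff_add_eq_0\<close>)
  moreover have "snd u \<in> extensional \<F>" using u by (auto simp: hho_space0_iff PiE_iff)
  ultimately show "snd u = snd (global_comb \<T> \<F> (global_zero \<T> \<F>) (- t) v)"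
    by (intro extensionalityI[of _ \<F>]) (auto simp: global_comb_def global_zero_def fun_eq_iff)
qed

section \<open>The load functional and its representative\<close>

lemma broken_poly_comb:
  "broken_poly \<T> (global_comb \<T> \<F> u t v) x = broken_poly \<T> u x + t * broken_poly \<T> v x"
  by (simp add: broken_poly_def global_comb_def sum.distrib sum_distrib_left algebra_simps)

lemma broken_poly_bounded_borel:
  assumes mesh: "polytopal_mesh \<Omega> \<T> \<F> h" and v: "v \<in> hho_space0 k \<Omega> \<T> \<F>"
  shows "\<exists>C\<ge>0. broken_poly \<T> v \<in> borel_measurable borel \<and> (\<forall>x. \<bar>broken_poly \<T> v x\<bar> \<le> C)"
proof -
  have "\<exists>C. (\<lambda>x. indicat_real T x * fst v T x) \<in> borel_measurable borel \<and>
      (\<forall>x. \<bar>indicat_real T x * fst v T x\<bar> \<le> C)" if T: "T \<in> \<T>" for T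
  proof -
    interpret mesh_cell T \<F> by (rule mesh_cell_of_mesh[OF mesh T])
    have "bounded_borel_on T (fst v T)"
      by (intro cell_bounded_borel continuous_on_poly_space[OF hho_space0_cell[OF v T]])
    then obtain C where "(\<lambda>x. indicat_real T x *\<^sub>R fst v T x) \<in> borel_measurable borel"
        "\<And>x. x \<in> T \<Longrightarrow> norm (fst v T x) \<le> C" "C \<ge> 0" by (rule bounded_borel_onE) blast
    then show ?thesis by (intro exI[of _ C]) (auto simp: indicator_def)
  qed
  then obtain C where C: "\<And>T. T \<in> \<T> \<Longrightarrow> (\<lambda>x. indicat_real T x * fst v T x) \<in> borel_measurable borel"
      "\<And>T x. T \<in> \<T> \<Longrightarrow> \<bar>indicat_real T x * fst v T x\<bar> \<le> C T" by metis
  have "broken_poly \<T> v \<in> borel_measurable borel"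
    unfolding broken_poly_def[abs_def] by (intro borel_measurable_sum C(1))
  moreover have le: "\<bar>broken_poly \<T> v x\<bar> \<le> (\<Sum>T\<in>\<T>. C T)" for x
    unfolding broken_poly_def by (rule order_trans[OF sum_abs sum_mono[OF C(2)]])
  moreover have "(\<Sum>T\<in>\<T>. C T) \<ge> 0" using le order_trans[OF abs_ge_zero] by blast
  ultimately show ?thesis by blast
qed

text \<open>Only integrability needs an argument: \<open>f\<close> times a bounded function is
  dominated by a multiple of 1 + f^2, which is integrable because \<Omega> has finite
  measure.\<close>

lemma source_lin:
  assumes mesh: "polytopal_mesh \<Omega> \<T> \<F> h" and \<Omega>: "open \<Omega>" "bounded \<Omega>"
    and f: "f \<in> borel_measurable (lebesgue_on \<Omega>)" "integrable (lebesgue_on \<Omega>) (\<lambda>x. (f x)\<^sup>2)"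
    and u: "u \<in> hho_space0 k \<Omega> \<T> \<F>" and v: "v \<in> hho_space0 k \<Omega> \<T> \<F>"
  shows "cell_inner \<Omega> f (broken_poly \<T> (global_comb \<T> \<F> u t v)) =
    cell_inner \<Omega> f (broken_poly \<T> u) + t * cell_inner \<Omega> f (broken_poly \<T> v)"
proof -
  have meas: "\<Omega> \<in> sets lebesgue" "emeasure lebesgue \<Omega> < \<infinity>"
    using lebesgue_bounded_borel[OF \<Omega>(2)] \<Omega>(1) by auto
  have int: "set_integrable lebesgue \<Omega> (\<lambda>x. f x * broken_poly \<T> w x)"
    if w: "w \<in> hho_space0 k \<Omega> \<T> \<F>" for w
  proof -
    obtain C where C: "broken_poly \<T> w \<in> borel_measurable borel" "\<And>x. \<bar>broken_poly \<T> w x\<bar> \<le> C" "C \<ge> 0"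
      using broken_poly_bounded_borel[OF mesh w] by blast
    have "emeasure (lebesgue_on \<Omega>) (space (lebesgue_on \<Omega>)) \<noteq> \<infinity>"
      using meas by (simp add: emeasure_restrict_space)
    then have "finite_measure (lebesgue_on \<Omega>)" by (rule finite_measureI)
    then have "integrable (lebesgue_on \<Omega>) (\<lambda>x. C * (1 + (f x)\<^sup>2))"
      using f(2) by (intro integrable_mult_right Bochner_Integration.integrable_add
          finite_measure.integrable_const)
    moreover have "broken_poly \<T> w \<in> borel_measurable (lebesgue_on \<Omega>)"
      using C(1) by (intro measurable_restrict_space1 measurable_completion) simp
    then have "(\<lambda>x. f x * broken_poly \<T> w x) \<in> borel_measurable (lebesgue_on \<Omega>)"
      using f(1) by (intro borel_measurable_times)
    moreover have "norm (f x * broken_poly \<T> w x) \<le> norm (C * (1 + (f x)\<^sup>2))" for x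
    proof -
      have "0 \<le> (\<bar>f x\<bar> - 1)\<^sup>2" by simp
      then have "2 * \<bar>f x\<bar> \<le> 1 + (f x)\<^sup>2" by (simp add: power2_diff)
      then have "\<bar>f x\<bar> \<le> 1 + (f x)\<^sup>2" using abs_ge_zero[of "f x"] by linarith
      then have "\<bar>f x\<bar> * \<bar>broken_poly \<T> w x\<bar> \<le> (1 + (f x)\<^sup>2) * C"
        using C(2)[of x] by (intro mult_mono) auto
      then show ?thesis using C(3) by (simp add: abs_mult mult.commute)
    qed
    ultimately have "integrable (lebesgue_on \<Omega>) (\<lambda>x. f x * broken_poly \<T> w x)"
      using Bochner_Integration.integrable_bound by blast
    then show ?thesis
      using meas by (simp add: set_integrable_def integrable_restrict_space)
  qed
  have "(LINT x:\<Omega>|lebesgue. f x * broken_poly \<T> u x + t * (f x * broken_poly \<T> v x)) =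
      (LINT x:\<Omega>|lebesgue. f x * broken_poly \<T> u x) + (LINT x:\<Omega>|lebesgue. t * (f x * broken_poly \<T> v x))"
    by (intro set_integral_add int set_integrable_mult_right u v)
  then show ?thesis by (simp add: cell_inner_def broken_poly_comb algebra_simps)
qed

lemma hho_riesz:
  fixes \<Omega> :: "'a::euclidean_space set"
  assumes mesh: "polytopal_mesh \<Omega> \<T> \<F> h" and \<Omega>: "open \<Omega>" "bounded \<Omega>" "polytopal_set \<Omega>"
    and f: "f \<in> borel_measurable (lebesgue_on \<Omega>)" "integrable (lebesgue_on \<Omega>) (\<lambda>x. (f x)\<^sup>2)"
  shows "\<exists>z\<in>hho_space0 k \<Omega> \<T> \<F>. \<forall>v\<in>hho_space0 k \<Omega> \<T> \<F>.
    hho_form k \<T> \<F> z v = cell_inner \<Omega> f (broken_poly \<T> v)"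
proof -
  let ?V = "hho_space0 k \<Omega> \<T> \<F>" and ?bd = "boundary_faces \<Omega> \<T> \<F>"
  have fin: "finite \<T>" "finite \<F>" using mesh unfolding polytopal_mesh_def by auto
  \<comment> \<open>Coefficients are indexed by a cell or a non-boundary face together with a
    multi-index. Cells and faces have the same type, so the sum type keeps their coefficients
    apart.\<close>
  define S :: "(('a set + 'a set) \<times> ('a \<Rightarrow> nat)) set" where
    "S = (Inl ` \<T> \<union> Inr ` (\<F> - ?bd)) \<times> multi_indices k"
  define \<Phi> :: "(('a set + 'a set) \<times> ('a \<Rightarrow> nat) \<Rightarrow> real) \<Rightarrow> 'a global_dofs" where
    \<comment> \<open>The boundary condition is built into the parametrization: boundary faces
      receive zero whatever the coefficients are.\<close>
    "\<Phi> c = (\<lambda>T\<in>\<T>. poly_comb k (\<lambda>\<alpha>. c (Inl T, \<alpha>)),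
            \<lambda>F\<in>\<F>. \<lambda>x\<in>F. if F \<in> ?bd then 0 else poly_comb k (\<lambda>\<alpha>. c (Inr F, \<alpha>)) x)" for c
  have poly: "poly_comb k c \<in> poly_space k" for c :: "('a \<Rightarrow> nat) \<Rightarrow> real" by (simp add: poly_space_eq_range)
  have ran: "\<Phi> c \<in> ?V" for c
    unfolding hho_space0_iff
  proof (intro conjI ballI)
    show "fst (\<Phi> c) \<in> (\<Pi>\<^sub>E T\<in>\<T>. poly_space k)"
      unfolding \<Phi>_def fst_conv by (intro restrict_PiE_iff[THEN iffD2] ballI poly)
    have "(\<lambda>x\<in>F. if F \<in> ?bd then 0 else poly_comb k (\<lambda>\<alpha>. c (Inr F, \<alpha>)) x) \<in> face_poly_space k F" for F
      unfolding face_poly_space_def by (intro imageI) (cases "F \<in> ?bd"; simp add: poly poly_space_const)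
    then show "snd (\<Phi> c) \<in> (\<Pi>\<^sub>E F\<in>\<F>. face_poly_space k F)"
      unfolding \<Phi>_def snd_conv by (intro restrict_PiE_iff[THEN iffD2] ballI)
    fix F x assume "F \<in> ?bd" "x \<in> F"
    moreover from this have "F \<in> \<F>" using boundary_faces_subset by blast
    ultimately show "snd (\<Phi> c) F x = 0" by (simp add: \<Phi>_def)
  qed
  have \<Phi>_lin: "\<Phi> (\<lambda>i. c i + t * d i) = global_comb \<T> \<F> (\<Phi> c) t (\<Phi> d)" for c d t
    unfolding \<Phi>_def global_comb_def fst_conv snd_conv
    by (intro arg_cong2[where f = Pair] restrict_ext ext) (simp_all add: poly_comb_lin)
  show ?thesis
  proof (rule riesz_param[of S \<Phi>, OF _ ran])
    show "finite S" unfolding S_def using fin by (simp add: finite_multi_indices)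
  next
    fix v assume v: "v \<in> ?V"
    have "\<exists>c. (\<forall>\<alpha>. \<alpha> \<notin> multi_indices k \<longrightarrow> c \<alpha> = 0) \<and> fst v T = poly_comb k c" if "T \<in> \<T>" for T
      using poly_space_coeffs[OF hho_space0_cell[OF v that]] by metis
    then obtain cT where cT: "\<And>T \<alpha>. T \<in> \<T> \<Longrightarrow> \<alpha> \<notin> multi_indices k \<Longrightarrow> cT T \<alpha> = 0"
        "\<And>T. T \<in> \<T> \<Longrightarrow> fst v T = poly_comb k (cT T)" by metis
    have "\<exists>c. (\<forall>\<alpha>. \<alpha> \<notin> multi_indices k \<longrightarrow> c \<alpha> = 0) \<and> snd v F = restrict (poly_comb k c) F" if F: "F \<in> \<F>" for F
    proof -
      obtain p where p: "p \<in> poly_space k" "snd v F = restrict p F"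
        using hho_space0_face[OF v F] by (rule face_poly_spaceE)
      from p(1) show ?thesis by (rule poly_space_coeffs) (use p(2) in blast)
    qed
    then obtain cF where cF: "\<And>F \<alpha>. F \<in> \<F> \<Longrightarrow> \<alpha> \<notin> multi_indices k \<Longrightarrow> cF F \<alpha> = 0"
        "\<And>F. F \<in> \<F> \<Longrightarrow> snd v F = restrict (poly_comb k (cF F)) F" by metis
    define c where "c i = (if i \<in> S then case fst i of Inl T \<Rightarrow> cT T (snd i) | Inr F \<Rightarrow> cF F (snd i) else 0)" for i
    have "fst (\<Phi> c) = fst v"
    proof (rule extensionalityI[of _ \<T>])
      show "fst v \<in> extensional \<T>" using v by (auto simp: hho_space0_iff PiE_iff)
      fix T assume T: "T \<in> \<T>"
      have "poly_comb k (\<lambda>\<alpha>. c (Inl T, \<alpha>)) = poly_comb k (cT T)"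
        by (rule poly_comb_cong) (use T in \<open>auto simp: c_def S_def\<close>)
      then show "fst (\<Phi> c) T = fst v T" using T by (simp add: \<Phi>_def cT(2))
    qed (simp add: \<Phi>_def)
    moreover have "snd (\<Phi> c) = snd v"
    proof (rule extensionalityI[of _ \<F>])
      show "snd v \<in> extensional \<F>" using v by (auto simp: hho_space0_iff PiE_iff)
      fix F assume F: "F \<in> \<F>"
      show "snd (\<Phi> c) F = snd v F"
      proof (cases "F \<in> ?bd")
        case True
        then have "restrict (poly_comb k (cF F)) F x = 0" if "x \<in> F" for x
          using v that by (simp add: hho_space0_iff flip: cF(2)[OF F])
        then show ?thesis using True F by (auto simp: \<Phi>_def cF(2) intro!: restrict_ext)
      next
        case False
        have "poly_comb k (\<lambda>\<alpha>. c (Inr F, \<alpha>)) = poly_comb k (cF F)"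
          by (rule poly_comb_cong) (use F False in \<open>auto simp: c_def S_def\<close>)
        then show ?thesis using F False by (simp add: \<Phi>_def cF(2))
      qed
    qed (simp add: \<Phi>_def)
    moreover have "\<forall>i. i \<notin> S \<longrightarrow> c i = 0" by (simp add: c_def)
    ultimately show "\<exists>c. (\<forall>i. i \<notin> S \<longrightarrow> c i = 0) \<and> \<Phi> c = v" by (metis prod_eqI)
  next
    fix c d t w assume "w \<in> ?V"
    then show "hho_form k \<T> \<F> (\<Phi> (\<lambda>i. c i + t * d i)) w =
        hho_form k \<T> \<F> (\<Phi> c) w + t * hho_form k \<T> \<F> (\<Phi> d) w"
      unfolding \<Phi>_lin by (rule hho_form_lin[OF mesh ran ran])
  next
    fix c d t
    show "cell_inner \<Omega> f (broken_poly \<T> (\<Phi> (\<lambda>i. c i + t * d i))) =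
        cell_inner \<Omega> f (broken_poly \<T> (\<Phi> c)) + t * cell_inner \<Omega> f (broken_poly \<T> (\<Phi> d))"
      unfolding \<Phi>_lin by (rule source_lin[OF mesh \<Omega>(1,2) f ran ran])
  next
    fix v assume "v \<in> ?V" "hho_form k \<T> \<F> v v = 0"
    \<comment> \<open>The solvability condition of the Riesz lemma: where the form vanishes, all
      cell unknowns are zero, and the load tests only these.\<close>
    from hho_form_definite(1)[OF mesh \<Omega> this]
    have "broken_poly \<T> v x = 0" for x unfolding broken_poly_def by (intro sum.neutral) simp
    then show "cell_inner \<Omega> f (broken_poly \<T> v) = 0" by (intro cell_inner_zero)
  qed (rule hho_form_commute hho_form_nonneg[OF mesh])+
qed

theorem mainTheorem3:
  fixes \<Omega> :: "(real ^ 'n) set"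
    and H :: "real set"
    and \<T> \<F> :: "real \<Rightarrow> (real ^ 'n) set set"
    and f :: "real ^ 'n \<Rightarrow> real"
    and h :: real
    and k :: nat
  assumes "CARD('n) \<in> {2, 3}"
    and "polytopal_domain \<Omega>"
    and "regular_mesh_sequence \<Omega> H \<T> \<F>"
    and "f \<in> borel_measurable (lebesgue_on \<Omega>)"
    and "integrable (lebesgue_on \<Omega>) (\<lambda>x. (f x)\<^sup>2)"
    and "h \<in> H"
  shows "\<exists>!u. u \<in> hho_space0 k \<Omega> (\<T> h) (\<F> h) \<and>
    (\<forall>v \<in> hho_space0 k \<Omega> (\<T> h) (\<F> h).
      (1 + hho_form k (\<T> h) (\<F> h) u u) * hho_form k (\<T> h) (\<F> h) u v =
        cell_inner \<Omega> f (broken_poly (\<T> h) v))"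
proof -
  have mesh: "polytopal_mesh \<Omega> (\<T> h) (\<F> h) h"
    using assms(3,6) unfolding regular_mesh_sequence_def by blast
  have \<Omega>: "open \<Omega>" "bounded \<Omega>" "polytopal_set \<Omega>"
    using assms(2) unfolding polytopal_domain_def by blast+
  let ?V = "hho_space0 k \<Omega> (\<T> h) (\<F> h)"
  let ?comb = "global_comb (\<T> h) (\<F> h)" and ?zero = "global_zero (\<T> h) (\<F> h)"
  show ?thesis
  proof (rule nonlocal_problem_ex1[of ?V ?comb "hho_form k (\<T> h) (\<F> h)" ?zero])
    fix v assume v: "v \<in> ?V"
    \<comment> \<open>Since 0 = 0 + 1 * 0, linearity says that the value of the form at zero equals
      twice itself.\<close>
    have "?zero = ?comb ?zero 1 ?zero"
      unfolding global_zero_def global_comb_def fst_conv snd_conv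
      by (intro arg_cong2[where f = Pair] restrict_ext ext) simp_all
    then show "hho_form k (\<T> h) (\<F> h) ?zero v = 0"
      using hho_form_lin[OF mesh global_zero_in global_zero_in v, of 1] by simp
  next
    fix u v t assume uv: "u \<in> ?V" "v \<in> ?V"
      and "hho_form k (\<T> h) (\<F> h) (?comb u t v) (?comb u t v) = 0"
    then show "u = ?comb ?zero (- t) v"
      using hho_form_definite[OF mesh \<Omega> global_comb_in[OF uv]] by (intro global_comb_eq_zero[OF uv(1)])
  qed (use hho_riesz[OF mesh \<Omega> assms(4,5)] in
      \<open>auto simp: global_comb_in global_zero_in hho_form_nonneg[OF mesh] hho_form_lin[OF mesh]
         intro: hho_form_commute\<close>)
qed

end
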